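(* Let $\mathcal T$ be a physical theory and let $\widetilde{\mathcal F}_{\mathcal T}$ be the vector space spanned by pairs $(\bar\Gamma,\bar\gamma)$ with $\bar\Gamma$ a connected $1PI$ specified graph, $\bar\gamma\subset\bar\Gamma$ and $\bar\Gamma/\bar\gamma\in\widetilde V_{\mathcal T}$. Equipped with the product $\odot$ defined by $$(\bar\Gamma_1,\bar\gamma_1)\odot(\bar\Gamma_2,\bar\gamma_2)=\sum_{v\in\mathcal V(\Gamma_2-\gamma_2),\ v=\mathrm{res}\,\bar\Gamma_1}(\bar\Gamma_1\triangleright_v\bar\Gamma_2,\ \bar\gamma_1\bar\gamma_2),$$ the space $\widetilde{\mathcal F}_{\mathcal T}$ is a (left) pre-Lie algebra; that is, for all $x,y,z\in\widetilde{\mathcal F}_{\mathcal T}$, $$(x\odot y)\odot z-x\odot(y\odot z)=(y\odot x)\odot z-y\odot(x\odot z).$$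
   Context: **Feynman graphs.** A graph $\Gamma$ is given by a finite set $\mathcal V(\Gamma)$ of vertices, a finite set $\mathcal E(\Gamma)$ of half-edges, a map $\partial:\mathcal E(\Gamma)\to\mathcal V(\Gamma)$ and an involution $\sigma_\Gamma:\mathcal E(\Gamma)\to\mathcal E(\Gamma)$. Half-edges are partitioned into types and $\sigma_\Gamma$ respects types. Fixed points of $\sigma_\Gamma$ are the external edges; pairs $\{e,\sigma_\Gamma(e)\}$ with $e\ne\sigma_\Gamma(e)$ are the internal edges; $st(v)=\partial^{-1}(v)$. Graphs are considered up to isomorphism. $\pi_0(\Gamma)$ is the set of connected components. A $1PI$ graph is a connected graph which remains connected when any one internal edge is cut (replaced by two external edges); a graph is locally $1PI$ if all its connected components are $1PI$. The residue $\mathrm{res}\,\Gamma$ is obtained by shrinking each connected component to a point (retaining its external edges). A covering subgraph $\gamma$ of $\Gamma$ is a graph obtained from $\Gamma$ by cutting some internal edges (same vertices and half-edges). $\Gamma/\gamma$ is obtained by shrinking each connected component of $\gamma$ inside $\Gamma$ to a point. **Theory.** A theory $\mathcal T$ prescribes a set $\mathcal E(\mathcal T)$ of half-edge types and a set $\mathcal V(\mathcal T)$ of vertex types. The types of the half-edges in $st(v)$ need not determine the type of $v$; vertex types sharing the same collection of half-edge types are distinguished by an integer index. **Specified graphs.** A specified graph of $\mathcal T$ is a couple $\bar\Gamma=(\Gamma,\underline i)$ where $\Gamma$ is a locally $1PI$ superficially divergent graph (the residue of each component is a vertex of $\mathcal T$) with half-edges and vertices of the types prescribed by $\mathcal T$,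 and $\underline i:\pi_0(\Gamma)\to\mathbb N$ is such that $\underline i(\gamma)$ is one of the indices allowed by the possible types of the vertex obtained by contracting the component $\gamma$. A specified graph $\bar\gamma=(\gamma,\underline j)$ is a specified covering subgraph of $\bar\Gamma=(\Gamma,\underline i)$, written $\bar\gamma\subset\bar\Gamma$, if $\gamma$ is a covering subgraph of $\Gamma$ and $\underline j(\gamma_0)=\underline i(\gamma_0)$ for every component $\gamma_0$ of $\gamma$ that is also a component of $\Gamma$. The contracted graph $\bar\Gamma/\bar\gamma$ is $\Gamma/\gamma$ with the new vertices given the types specified by $\underline j$, and with specification $\underline i$. $\widetilde V_{\mathcal T}$ is the vector space (over a field $k$) generated by the connected ($1PI$) specified graphs. **Insertion.** For connected specified graphs $\bar\Gamma_1=(\Gamma_1,\underline i)$, $\bar\Gamma_2=(\Gamma_2,\underline j)$ and $v\in\mathcal V(\Gamma_2)$, $\bar\Gamma_1\triangleright_v\bar\Gamma_2=(\Gamma_1\cup_v\Gamma_2,\underline j)$ if $v=\mathrm{res}\,\bar\Gamma_1$ (the type of $v$ is that of the vertex $\mathrm{res}\,\bar\Gamma_1$), and $0$ otherwise. Here $\Gamma_1\cup_v\Gamma_2$ is the sum of all possible graphs obtained by replacing $v$ by $\Gamma_1$ in $\Gamma_2$, i.e. the sum over all type-preserving bijections between the external edges of $\Gamma_1$ and $st(v)$. **Convention for pairs.** In a pair $(\bar\Gamma,\bar\gamma)$ the components of $\gamma$ consisting of a single vertex without internal edge are suppressed from the notation: $\mathcal V(\gamma)$ denotes the set of vertices lying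 in components of $\gamma$ having at least one internal edge, and $\mathcal V(\Gamma-\gamma)$ denotes the set of vertices of $\Gamma$ which are not vertices of $\gamma$. In $(\bar\Gamma_1\triangleright_v\bar\Gamma_2,\bar\gamma_1\bar\gamma_2)$, each term of the sum $\bar\Gamma_1\triangleright_v\bar\Gamma_2$ is paired with the disjoint union $\bar\gamma_1\bar\gamma_2$, seen as a subgraph of that term (completed by isolated vertices). The product $\odot$ is extended bilinearly.
   Formalization: A component consisting of a single vertex without internal edge is required to be specified by that vertex's own index; with another allowed index the product would leave the space. *)

theory Defs
  imports Complex_Main "HOL-Library.Multiset" "HOL-Library.FuncSet" "HOL-Library.Poly_Mapping"
begin

section \<open>Theories and graphs\<close>

text \<open>
  A vertex type is a collection (multiset) of half-edge types together with the integer index that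
  distinguishes vertex types sharing this collection.
\<close>

type_synonym 't vtype = "'t multiset \<times> nat"

record 't qft =
  half_types :: "'t set"
  vert_types :: "'t vtype set"

definition is_qft :: "'t qft \<Rightarrow> bool" where
  "is_qft T \<longleftrightarrow> (\<forall>(M, n) \<in> vert_types T. set_mset M \<subseteq> half_types T)"

text \<open>
  The field \<open>bd\<close> is the map from half-edges to vertices and \<open>sig\<close> is the involution; only the values
  of the functions on \<open>hedges\<close> and \<open>verts\<close> matter.  The type of a vertex consists of the types of the
  half-edges adjacent to it, read off from the graph, and of the index \<open>vindex\<close>.
\<close>

record ('v, 'h, 't) fgraph =
  verts :: "'v set"
  hedges :: "'h set"
  bd :: "'h \<Rightarrow> 'v"
  sig :: "'h \<Rightarrow> 'h"
  htype :: "'h \<Rightarrow> 't"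
  vindex :: "'v \<Rightarrow> nat"

definition wf_graph :: "('v, 'h, 't) fgraph \<Rightarrow> bool" where
  "wf_graph G \<longleftrightarrow> finite (verts G) \<and> finite (hedges G) \<and>
     (\<forall>e \<in> hedges G. bd G e \<in> verts G \<and> sig G e \<in> hedges G \<and> sig G (sig G e) = e \<and>
        htype G (sig G e) = htype G e)"

definition star :: "('v, 'h, 't) fgraph \<Rightarrow> 'v \<Rightarrow> 'h set" where
  "star G v = {e \<in> hedges G. bd G e = v}"

definition ext_edges :: "('v, 'h, 't) fgraph \<Rightarrow> 'h set" where
  "ext_edges G = {e \<in> hedges G. sig G e = e}"

definition int_hedges :: "('v, 'h, 't) fgraph \<Rightarrow> 'h set" where
  "int_hedges G = {e \<in> hedges G. sig G e \<noteq> e}"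

definition vtype :: "('v, 'h, 't) fgraph \<Rightarrow> 'v \<Rightarrow> 't vtype" where
  "vtype G v = (image_mset (htype G) (mset_set (star G v)), vindex G v)"

definition graph_of :: "'t qft \<Rightarrow> ('v, 'h, 't) fgraph \<Rightarrow> bool" where
  "graph_of T G \<longleftrightarrow> wf_graph G \<and> htype G ` hedges G \<subseteq> half_types T \<and>
     vtype G ` verts G \<subseteq> vert_types T"

definition component :: "('v, 'h, 't) fgraph \<Rightarrow> 'v \<Rightarrow> 'v set" where
  "component G v =
     {w \<in> verts G. (v, w) \<in> {(bd G e, bd G (sig G e)) | e. e \<in> hedges G}\<^sup>*}"

text \<open>Connected components are represented by their sets of vertices.\<close>

definition components :: "('v, 'h, 't) fgraph \<Rightarrow> 'v set set" where
  "components G = component G ` verts G"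

definition comp_graph :: "('v, 'h, 't) fgraph \<Rightarrow> 'v set \<Rightarrow> ('v, 'h, 't) fgraph" where
  "comp_graph G C = G\<lparr>verts := C, hedges := {e \<in> hedges G. bd G e \<in> C}\<rparr>"

definition connected_graph :: "('v, 'h, 't) fgraph \<Rightarrow> bool" where
  "connected_graph G \<longleftrightarrow> (\<exists>C. components G = {C})"

definition cut_edge :: "('v, 'h, 't) fgraph \<Rightarrow> 'h \<Rightarrow> ('v, 'h, 't) fgraph" where
  "cut_edge G e = G\<lparr>sig := (sig G)(e := e, sig G e := sig G e)\<rparr>"

definition one_pi :: "('v, 'h, 't) fgraph \<Rightarrow> bool" where
  "one_pi G \<longleftrightarrow> connected_graph G \<and> (\<forall>e \<in> int_hedges G. connected_graph (cut_edge G e))"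

definition locally_one_pi :: "('v, 'h, 't) fgraph \<Rightarrow> bool" where
  "locally_one_pi G \<longleftrightarrow> (\<forall>C \<in> components G. one_pi (comp_graph G C))"

definition covering_subgraph :: "('v, 'h, 't) fgraph \<Rightarrow> ('v, 'h, 't) fgraph \<Rightarrow> bool" where
  "covering_subgraph g G \<longleftrightarrow> wf_graph g \<and> verts g = verts G \<and> hedges g = hedges G \<and>
     (\<forall>v \<in> verts G. vindex g v = vindex G v) \<and>
     (\<forall>e \<in> hedges G. bd g e = bd G e \<and> htype g e = htype G e \<and> sig g e \<in> {e, sig G e})"


section \<open>Specified graphs\<close>

type_synonym ('v, 'h, 't) sgraph = "('v, 'h, 't) fgraph \<times> ('v set \<Rightarrow> nat)"

text \<open>
  The vertices of the contracted graph are the components of the subgraph \<open>g\<close>, its half-edges are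
  the external edges of \<open>g\<close>.  A component of the contracted graph is a set of components of \<open>g\<close>, and
  the union of these is the corresponding component of \<open>G\<close>.
\<close>

fun contract :: "('v, 'h, 't) sgraph \<Rightarrow> ('v, 'h, 't) sgraph \<Rightarrow> ('v set, 'h, 't) sgraph" where
  "contract (G, i) (g, j) =
     (\<lparr>verts = components g, hedges = ext_edges g, bd = (\<lambda>e. component g (bd g e)),
       sig = sig G, htype = htype G, vindex = j\<rparr>, \<lambda>D. i (\<Union>D))"

definition residue :: "('v, 'h, 't) sgraph \<Rightarrow> ('v set, 'h, 't) fgraph" where
  "residue S = fst (contract S S)"

text \<open>
  The last clause says that a component which is a bare vertex is specified by the index of this
  vertex: contracting it gives back the same vertex, which already has a type.
\<close>

fun specified_graph :: "'t qft \<Rightarrow> ('v, 'h, 't) sgraph \<Rightarrow> bool" where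
  "specified_graph T (G, i) \<longleftrightarrow> graph_of T G \<and> locally_one_pi G \<and>
     (\<forall>C \<in> components G. vtype (residue (G, i)) C \<in> vert_types T) \<and>
     (\<forall>v \<in> verts G. star G v \<subseteq> ext_edges G \<longrightarrow> i {v} = vindex G v)"

text \<open>A component of \<open>g\<close> is also a component of \<open>G\<close> if none of its half-edges has been cut.\<close>

fun specified_subgraph :: "('v, 'h, 't) sgraph \<Rightarrow> ('v, 'h, 't) sgraph \<Rightarrow> bool" where
  "specified_subgraph (g, j) (G, i) \<longleftrightarrow> covering_subgraph g G \<and>
     (\<forall>C \<in> components g \<inter> components G.
        (\<forall>e \<in> hedges G. bd G e \<in> C \<longrightarrow> sig g e = sig G e) \<longrightarrow> j C = i C)"

text \<open>The generators of the vector space of connected (1PI) specified graphs.\<close>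

definition connected_specified :: "'t qft \<Rightarrow> ('v, 'h, 't) sgraph \<Rightarrow> bool" where
  "connected_specified T S \<longleftrightarrow> specified_graph T S \<and> one_pi (fst S)"

text \<open>The type of the only vertex of the residue of a connected specified graph.\<close>

definition res_type :: "('v, 'h, 't) sgraph \<Rightarrow> 't vtype" where
  "res_type S = vtype (residue S) (verts (fst S))"


section \<open>Pairs\<close>

type_synonym ('v, 'h, 't) gpair = "('v, 'h, 't) sgraph \<times> ('v, 'h, 't) sgraph"

text \<open>
  The subgraph of a pair keeps its bare vertices; their specification carries no information.  Where
  the vertices of a subgraph are meant in the sense that disregards them, \<open>nontriv_verts\<close> is used.
\<close>

fun valid_pair :: "'t qft \<Rightarrow> ('v, 'h, 't) gpair \<Rightarrow> bool" where
  "valid_pair T (S, s) \<longleftrightarrow> connected_specified T S \<and> specified_graph T s \<and>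
     specified_subgraph s S \<and> connected_specified T (contract S s)"

definition nontriv_verts :: "('v, 'h, 't) fgraph \<Rightarrow> 'v set" where
  "nontriv_verts g = {v \<in> verts g. \<exists>e \<in> int_hedges g. bd g e \<in> component g v}"

fun pair_iso :: "('v, 'h, 't) gpair \<Rightarrow> ('w, 'l, 't) gpair \<Rightarrow> bool" where
  "pair_iso ((G, i), (g, j)) ((G', i'), (g', j')) \<longleftrightarrow>
     verts g = verts G \<and> hedges g = hedges G \<and> verts g' = verts G' \<and> hedges g' = hedges G' \<and>
     (\<exists>\<alpha> \<beta>. bij_betw \<alpha> (verts G) (verts G') \<and> bij_betw \<beta> (hedges G) (hedges G') \<and>
        (\<forall>(H, H') \<in> {(G, G'), (g, g')}.
           (\<forall>v \<in> verts G. vindex H' (\<alpha> v) = vindex H v) \<and>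
           (\<forall>e \<in> hedges G. bd H' (\<beta> e) = \<alpha> (bd H e) \<and> sig H' (\<beta> e) = \<beta> (sig H e) \<and>
              htype H' (\<beta> e) = htype H e)) \<and>
        (\<forall>C \<in> components G. i' (\<alpha> ` C) = i C) \<and>
        (\<forall>C \<in> components g. j' (\<alpha> ` C) = j C))"

text \<open>
  As all graphs are finite, every isomorphism class is determined by its members whose vertices and
  half-edges are natural numbers.
\<close>

definition iso_class :: "('v, 'h, 't) gpair \<Rightarrow> (nat, nat, 't) gpair set" where
  "iso_class P = {Q. pair_iso P Q}"


section \<open>Insertion\<close>

definition gluings ::
  "('v, 'h, 't) fgraph \<Rightarrow> ('w, 'l, 't) fgraph \<Rightarrow> 'w \<Rightarrow> ('l \<Rightarrow> 'h) set" where
  "gluings G1 G2 v = {\<phi> \<in> star G2 v \<rightarrow>\<^sub>E ext_edges G1.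
     bij_betw \<phi> (star G2 v) (ext_edges G1) \<and> (\<forall>e \<in> star G2 v. htype G1 (\<phi> e) = htype G2 e)}"

text \<open>
  Replacing \<open>v\<close> by \<open>G1\<close> identifies each half-edge \<open>e\<close> at \<open>v\<close> with the external edge \<open>\<phi> e\<close> of \<open>G1\<close>.
  The half-edge resulting from the identification is called \<open>Inr e\<close>.
\<close>

definition graph_insert :: "('v, 'h, 't) fgraph \<Rightarrow> 'w \<Rightarrow> ('l \<Rightarrow> 'h) \<Rightarrow> ('w, 'l, 't) fgraph
    \<Rightarrow> ('v + 'w, 'h + 'l, 't) fgraph" where
  "graph_insert G1 v \<phi> G2 =
     \<lparr>verts = Inl ` verts G1 \<union> Inr ` (verts G2 - {v}),
      hedges = Inl ` int_hedges G1 \<union> Inr ` hedges G2,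
      bd = case_sum (\<lambda>e. Inl (bd G1 e))
             (\<lambda>e. if bd G2 e = v then Inl (bd G1 (\<phi> e)) else Inr (bd G2 e)),
      sig = case_sum (\<lambda>e. Inl (sig G1 e)) (\<lambda>e. Inr (sig G2 e)),
      htype = case_sum (htype G1) (htype G2),
      vindex = case_sum (vindex G1) (vindex G2)\<rparr>"

text \<open>
  In the disjoint union of the subgraphs \<open>g1\<close> and \<open>g2\<close>, seen inside the insertion, the half-edges
  at \<open>v\<close> stay cut, because \<open>v\<close> is a bare vertex of \<open>g2\<close>.
\<close>

fun pair_insert :: "('v, 'h, 't) gpair \<Rightarrow> 'w \<Rightarrow> ('l \<Rightarrow> 'h) \<Rightarrow> ('w, 'l, 't) gpair
    \<Rightarrow> ('v + 'w, 'h + 'l, 't) gpair" where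
  "pair_insert ((G1, i1), (g1, j1)) v \<phi> ((G2, i2), (g2, j2)) =
     ((graph_insert G1 v \<phi> G2, \<lambda>_. i2 (verts G2)),
      ((graph_insert G1 v \<phi> G2)\<lparr>sig := case_sum (\<lambda>e. Inl (sig g1 e)) (\<lambda>e. Inr (sig g2 e))\<rparr>,
       \<lambda>C. if C \<subseteq> range Inl then j1 (Inl -` C) else j2 (Inr -` C)))"


section \<open>The vector space and its product\<close>

type_synonym ('t, 'k) pvec = "(nat, nat, 't) gpair set \<Rightarrow>\<^sub>0 'k"

definition pm_scale :: "'k::field \<Rightarrow> ('a \<Rightarrow>\<^sub>0 'k) \<Rightarrow> ('a \<Rightarrow>\<^sub>0 'k)" where
  "pm_scale a = Poly_Mapping.map (\<lambda>b. a * b)"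

definition pair_vec :: "('v, 'h, 't) gpair \<Rightarrow> ('t, 'k::field) pvec" where
  "pair_vec P = Poly_Mapping.single (iso_class P) 1"

definition F_space :: "'t qft \<Rightarrow> ('t, 'k::field) pvec set" where
  "F_space T = module.span pm_scale
     {pair_vec P | P :: (nat, nat, 't) gpair. valid_pair T P}"

definition odot_pairs :: "('v, 'h, 't) gpair \<Rightarrow> ('w, 'l, 't) gpair \<Rightarrow> ('t, 'k::field) pvec" where
  "odot_pairs P1 P2 =
     (let S1 = fst P1; G2 = fst (fst P2); g2 = fst (snd P2) in
      \<Sum>v \<in> {v \<in> verts G2 - nontriv_verts g2. vtype G2 v = res_type S1}.
      \<Sum>\<phi> \<in> gluings (fst S1) G2 v. pair_vec (pair_insert P1 v \<phi> P2))"

text \<open>Bilinear extension, by means of an arbitrary representative of each isomorphism class.\<close>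

definition odot :: "('t, 'k::field) pvec \<Rightarrow> ('t, 'k) pvec \<Rightarrow> ('t, 'k) pvec" where
  "odot x y = (\<Sum>c \<in> Poly_Mapping.keys x. \<Sum>d \<in> Poly_Mapping.keys y.
     pm_scale (Poly_Mapping.lookup x c * Poly_Mapping.lookup y d)
       (odot_pairs (SOME P. P \<in> c) (SOME Q. Q \<in> d)))"


section \<open>Pre-Lie algebras\<close>

locale left_pre_Lie_algebra = vector_space scale
  for scale :: "'k::field \<Rightarrow> 'v::ab_group_add \<Rightarrow> 'v" +
  fixes S :: "'v set" and m :: "'v \<Rightarrow> 'v \<Rightarrow> 'v"
  assumes subspace_S: "subspace S"
    and closed: "x \<in> S \<Longrightarrow> y \<in> S \<Longrightarrow> m x y \<in> S"
    and add_left: "x \<in> S \<Longrightarrow> y \<in> S \<Longrightarrow> z \<in> S \<Longrightarrow> m (x + y) z = m x z + m y z"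
    and add_right: "x \<in> S \<Longrightarrow> y \<in> S \<Longrightarrow> z \<in> S \<Longrightarrow> m x (y + z) = m x y + m x z"
    and scale_left: "x \<in> S \<Longrightarrow> y \<in> S \<Longrightarrow> m (scale a x) y = scale a (m x y)"
    and scale_right: "x \<in> S \<Longrightarrow> y \<in> S \<Longrightarrow> m x (scale a y) = scale a (m x y)"
    and pre_Lie: "x \<in> S \<Longrightarrow> y \<in> S \<Longrightarrow> z \<in> S \<Longrightarrow>
      m (m x y) z - m x (m y z) = m (m y x) z - m y (m x z)"

end

theory Submission
  imports Defs
begin

text \<open>
  The product sums over all ways of inserting the first pair at a vertex of the second one.  In
  \<open>x \<odot> (y \<odot> z)\<close> the pair \<open>x\<close> is inserted into some \<open>y \<triangleright>\<^sub>v z\<close>, and the chosen vertex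
  belongs either to \<open>y\<close> or to \<open>z\<close>.  The terms of the first kind are those of
  \<open>(x \<odot> y) \<odot> z\<close>, since it does not matter whether \<open>x\<close> goes into \<open>y\<close> before or after \<open>y\<close> goes
  into \<open>z\<close> (\<open>insert_assoc\<close>, \<open>sum_insert_assoc\<close>).  The terms of the second kind insert \<open>x\<close> and
  \<open>y\<close> at two different vertices of \<open>z\<close>, and the order of these insertions is immaterial
  (\<open>insert_exchange\<close>, \<open>sum_insert_exchange\<close>).  So minus the associator is the sum
  \<open>separate_insertions\<close>, which is symmetric in \<open>x\<close> and \<open>y\<close>: this is the pre-Lie identity on
  generators (\<open>associator_pair_vec\<close>, \<open>pre_Lie_pair_vec\<close>), and bilinearity extends it to the span.

  Two other facts have to be established.  The first is that an insertion of valid pairs is a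
  valid pair (\<open>insertion.valid_insert\<close>).  Here the point is that the subgraph of the result is the disjoint
  union of the two subgraphs, because the vertex \<open>v\<close> is bare in the second subgraph; this is expressed by
  two embeddings onto unions of components (\<open>emb1\<close>, \<open>emb2\<close>), along which components, vertex types,
  residues and 1PI-ness are transported.  The inserted graph itself is 1PI by an argument on
  connectedness (\<open>insert_connected\<close>), and the condition on the contracted graph follows from the
  other conditions (\<open>contract_connected_specified\<close>).

  The second fact is that the product, which is defined through arbitrary representatives
  of isomorphism classes, is the same for all of them (\<open>odot_pairs_cong\<close>).  All identities of
  products are obtained in one way: the gluings on both sides are matched by a bijection, and the glued
  pairs are shown to be isomorphic, which makes the basis vectors equal (\<open>sum_type_bijections\<close>,
  \<open>pair_vec_eq\<close>).
\<close>

section \<open>Connectedness\<close>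

text \<open>
  A set of vertices that no edge leaves.  The components are the minimal non-empty ones, which
  allows to argue about connectedness without paths.
\<close>

definition edge_closed :: "('v, 'h, 't) fgraph \<Rightarrow> 'v set \<Rightarrow> bool" where
  "edge_closed G A \<longleftrightarrow> (\<forall>e \<in> hedges G. bd G e \<in> A \<longrightarrow> bd G (sig G e) \<in> A)"

lemma wf_graphD:
  assumes "wf_graph G"
  shows "finite (verts G)" "finite (hedges G)"
    and "\<And>e. e \<in> hedges G \<Longrightarrow> bd G e \<in> verts G"
    and "\<And>e. e \<in> hedges G \<Longrightarrow> sig G e \<in> hedges G"
    and "\<And>e. e \<in> hedges G \<Longrightarrow> sig G (sig G e) = e"
    and "\<And>e. e \<in> hedges G \<Longrightarrow> htype G (sig G e) = htype G e"
  using assms by (auto simp: wf_graph_def)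

lemma component_subset: "component G v \<subseteq> verts G"
  by (auto simp: component_def)

lemma component_refl: "v \<in> verts G \<Longrightarrow> v \<in> component G v"
  by (auto simp: component_def)

lemma edge_closed_component:
  assumes "wf_graph G"
  shows "edge_closed G (component G v)"
  unfolding edge_closed_def
proof (intro ballI impI)
  fix e assume e: "e \<in> hedges G" "bd G e \<in> component G v"
  have "(bd G e, bd G (sig G e)) \<in> {(bd G e, bd G (sig G e)) | e. e \<in> hedges G}"
    using e(1) by blast
  moreover have "(v, bd G e) \<in> {(bd G e, bd G (sig G e)) | e. e \<in> hedges G}\<^sup>*"
    using e(2) by (simp add: component_def)
  ultimately have "(v, bd G (sig G e)) \<in> {(bd G e, bd G (sig G e)) | e. e \<in> hedges G}\<^sup>*"
    by (rule rtrancl_into_rtrancl[rotated])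
  then show "bd G (sig G e) \<in> component G v"
    using wf_graphD[OF assms] e(1) by (simp add: component_def)
qed

lemma component_least:
  assumes "v \<in> A" "edge_closed G A"
  shows "component G v \<subseteq> A"
proof
  fix w assume "w \<in> component G v"
  then have "(v, w) \<in> {(bd G e, bd G (sig G e)) | e. e \<in> hedges G}\<^sup>*"
    by (simp add: component_def)
  then show "w \<in> A"
    by (induction rule: rtrancl_induct) (use assms in \<open>auto simp: edge_closed_def\<close>)
qed

text \<open>
  The involution makes the edge relation symmetric, so the vertices from which \<open>v\<close> can be
  reached again form an edge-closed set.
\<close>

lemma component_eq:
  assumes wf: "wf_graph G" and v: "v \<in> verts G" and u: "u \<in> component G v"
  shows "component G u = component G v"
proof
  show *: "component G u \<subseteq> component G v"
    using u edge_closed_component[OF wf] by (rule component_least)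
  let ?A = "{w \<in> verts G. v \<in> component G w}"
  have "edge_closed G ?A"
    unfolding edge_closed_def
  proof (intro ballI impI)
    fix e assume e: "e \<in> hedges G" "bd G e \<in> ?A"
    let ?w = "bd G (sig G e)"
    have w: "?w \<in> verts G"
      using wf_graphD[OF wf] e by auto
    have "bd G (sig G (sig G e)) \<in> component G ?w"
      using edge_closed_component[OF wf, of ?w] component_refl[OF w] wf_graphD[OF wf] e
      by (auto simp: edge_closed_def)
    then have "bd G e \<in> component G ?w"
      using wf_graphD[OF wf] e by simp
    then have "component G (bd G e) \<subseteq> component G ?w"
      using edge_closed_component[OF wf] by (rule component_least)
    then show "?w \<in> ?A"
      using e w by auto
  qed
  then have "component G v \<subseteq> ?A"
    using component_least[of v ?A G] component_refl[OF v] v by blast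
  then have "v \<in> component G u"
    using u by auto
  then show "component G v \<subseteq> component G u"
    using edge_closed_component[OF wf] by (rule component_least)
qed

lemma components_subset: "C \<in> components G \<Longrightarrow> C \<subseteq> verts G"
  using component_subset by (fastforce simp: components_def)

lemma components_nonempty:
  assumes "C \<in> components G"
  shows "C \<noteq> {}"
proof -
  obtain v where "v \<in> verts G" "C = component G v"
    using assms by (auto simp: components_def)
  then show ?thesis
    using component_refl[of v G] by blast
qed

lemma component_eq_component:
  assumes "wf_graph G" "C \<in> components G" "v \<in> C"
  shows "component G v = C"
  using assms component_eq by (fastforce simp: components_def)

lemma Union_components: "\<Union>(components G) = verts G"
  using component_subset component_refl by (fastforce simp: components_def)

lemma connected_graph_iff_component:
  assumes "wf_graph G"
  shows "connected_graph G \<longleftrightarrow> components G = {verts G}"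
  using Union_components[of G] by (auto simp: connected_graph_def)

text \<open>
  The form in which connectedness is used below: every non-empty set of vertices closed under
  following edges is everything.
\<close>

lemma connected_graph_iff:
  assumes wf: "wf_graph G"
  shows "connected_graph G \<longleftrightarrow> verts G \<noteq> {} \<and>
    (\<forall>A. A \<subseteq> verts G \<and> A \<noteq> {} \<and> edge_closed G A \<longrightarrow> A = verts G)"
    (is "?L \<longleftrightarrow> ?R")
proof
  assume ?L
  then have c: "components G = {verts G}"
    using connected_graph_iff_component[OF wf] by simp
  have "A = verts G" if A: "A \<subseteq> verts G" "A \<noteq> {}" "edge_closed G A" for A
  proof -
    obtain v where "v \<in> A"
      using A by auto
    moreover then have "component G v = verts G"
      using c A by (auto simp: components_def)
    ultimately show ?thesis
      using component_least[of v A G] A by auto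
  qed
  moreover have "verts G \<noteq> {}"
    using c by (auto simp: components_def)
  ultimately show ?R
    by blast
next
  assume R: ?R
  then have "component G v = verts G" if "v \<in> verts G" for v
    using that edge_closed_component[OF wf] component_subset component_refl by (metis empty_iff)
  then have "components G = {verts G}"
    using R by (auto simp: components_def)
  then show ?L
    by (simp add: connected_graph_def)
qed

lemma wf_cut_edge:
  assumes "wf_graph G" "e \<in> hedges G"
  shows "wf_graph (cut_edge G e)"
proof -
  have "sig G x = sig G e \<longleftrightarrow> x = e" "sig G x = e \<longleftrightarrow> x = sig G e" if "x \<in> hedges G" for x
    using that assms(2) wf_graphD(5)[OF assms(1)] by metis+
  then show ?thesis
    using assms(2) wf_graphD[OF assms(1)] by (auto simp: wf_graph_def cut_edge_def)
qed

lemma comp_graph_verts: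
  assumes "wf_graph G"
  shows "comp_graph G (verts G) = G"
proof -
  have "{e \<in> hedges G. bd G e \<in> verts G} = hedges G"
    using assms by (auto simp: wf_graph_def)
  then show ?thesis
    by (simp add: comp_graph_def)
qed

lemma one_pi_imp_locally_one_pi:
  assumes "wf_graph G" "one_pi G"
  shows "locally_one_pi G"
proof -
  have "components G = {verts G}"
    using assms connected_graph_iff_component[OF assms(1)] by (simp add: one_pi_def)
  then show ?thesis
    using assms comp_graph_verts[OF assms(1)] by (simp add: locally_one_pi_def)
qed

lemma one_pi_components:
  assumes "wf_graph G" "one_pi G"
  shows "components G = {verts G}"
  using assms(2) connected_graph_iff_component[OF assms(1)] by (simp add: one_pi_def)

section \<open>Embeddings\<close>

text \<open>
  An isomorphism onto a union of connected components.  The condition on the half-edges of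
  \<open>H'\<close> says that a vertex in the image gets no additional half-edges, so that stars, components
  and vertex types of \<open>H\<close> and of its image coincide.
\<close>

definition emb ::
  "('v \<Rightarrow> 'w) \<Rightarrow> ('h \<Rightarrow> 'l) \<Rightarrow> ('v, 'h, 't) fgraph \<Rightarrow> ('w, 'l, 't) fgraph \<Rightarrow> bool" where
  "emb \<alpha> \<beta> H H' \<longleftrightarrow>
     inj_on \<alpha> (verts H) \<and> inj_on \<beta> (hedges H) \<and>
     \<alpha> ` verts H \<subseteq> verts H' \<and> \<beta> ` hedges H \<subseteq> hedges H' \<and>
     (\<forall>e \<in> hedges H'. bd H' e \<in> \<alpha> ` verts H \<longrightarrow> e \<in> \<beta> ` hedges H) \<and>
     (\<forall>v \<in> verts H. vindex H' (\<alpha> v) = vindex H v) \<and>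
     (\<forall>e \<in> hedges H. bd H' (\<beta> e) = \<alpha> (bd H e) \<and> sig H' (\<beta> e) = \<beta> (sig H e) \<and>
        htype H' (\<beta> e) = htype H e)"

lemma embD:
  assumes "emb \<alpha> \<beta> H H'"
  shows "inj_on \<alpha> (verts H)" "inj_on \<beta> (hedges H)"
    "\<And>v. v \<in> verts H \<Longrightarrow> \<alpha> v \<in> verts H'"
    "\<And>e. e \<in> hedges H \<Longrightarrow> \<beta> e \<in> hedges H'"
    "\<And>e. e \<in> hedges H' \<Longrightarrow> bd H' e \<in> \<alpha> ` verts H \<Longrightarrow> e \<in> \<beta> ` hedges H"
    "\<And>v. v \<in> verts H \<Longrightarrow> vindex H' (\<alpha> v) = vindex H v"
    "\<And>e. e \<in> hedges H \<Longrightarrow> bd H' (\<beta> e) = \<alpha> (bd H e)"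
    "\<And>e. e \<in> hedges H \<Longrightarrow> sig H' (\<beta> e) = \<beta> (sig H e)"
    "\<And>e. e \<in> hedges H \<Longrightarrow> htype H' (\<beta> e) = htype H e"
  using assms by (auto simp: emb_def)

text \<open>
  The image of a component is edge-closed as the image has no further half-edges; the preimage
  of a component is edge-closed because edges are preserved.
\<close>

lemma emb_component:
  assumes wf: "wf_graph H" "wf_graph H'" and em: "emb \<alpha> \<beta> H H'" and v: "v \<in> verts H"
  shows "component H' (\<alpha> v) = \<alpha> ` component H v"
proof
  have "edge_closed H' (\<alpha> ` component H v)"
    unfolding edge_closed_def
  proof (intro ballI impI)
    fix e' assume e': "e' \<in> hedges H'" "bd H' e' \<in> \<alpha> ` component H v"
    then obtain u where u: "u \<in> component H v" "bd H' e' = \<alpha> u"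
      by auto
    then have uH: "u \<in> verts H"
      using component_subset by fast
    then obtain e where e: "e \<in> hedges H" "e' = \<beta> e"
      using embD(5)[OF em] e' u by auto
    then have "bd H e = u"
      using u embD(7)[OF em] wf_graphD(3)[OF wf(1)] uH embD(1)[OF em] by (auto simp: inj_on_def)
    then have "bd H (sig H e) \<in> component H v"
      using edge_closed_component[OF wf(1)] e u by (auto simp: edge_closed_def)
    then show "bd H' (sig H' e') \<in> \<alpha> ` component H v"
      using e embD(7,8)[OF em] wf_graphD(4)[OF wf(1)] by auto
  qed
  then show "component H' (\<alpha> v) \<subseteq> \<alpha> ` component H v"
    using component_refl[OF v] by (intro component_least) auto
  have "edge_closed H (\<alpha> -` component H' (\<alpha> v))"
    unfolding edge_closed_def
  proof (intro ballI impI)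
    fix e assume e: "e \<in> hedges H" "bd H e \<in> \<alpha> -` component H' (\<alpha> v)"
    then have "bd H' (\<beta> e) \<in> component H' (\<alpha> v)"
      using embD(7)[OF em] by auto
    then have "bd H' (sig H' (\<beta> e)) \<in> component H' (\<alpha> v)"
      using edge_closed_component[OF wf(2)] e embD(4)[OF em] by (auto simp: edge_closed_def)
    then show "bd H (sig H e) \<in> \<alpha> -` component H' (\<alpha> v)"
      using e embD(7,8)[OF em] wf_graphD(4)[OF wf(1)] by auto
  qed
  then have "component H v \<subseteq> \<alpha> -` component H' (\<alpha> v)"
    using component_refl[OF embD(3)[OF em v]] v by (intro component_least) auto
  then show "\<alpha> ` component H v \<subseteq> component H' (\<alpha> v)"
    by auto
qed

lemma emb_hedges_at:
  assumes wf: "wf_graph H" and em: "emb \<alpha> \<beta> H H'" and C: "C \<subseteq> verts H"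
  shows "{e \<in> hedges H'. bd H' e \<in> \<alpha> ` C} = \<beta> ` {e \<in> hedges H. bd H e \<in> C}"
proof (intro subset_antisym subsetI)
  fix e' assume e': "e' \<in> {e \<in> hedges H'. bd H' e \<in> \<alpha> ` C}"
  then obtain e where e: "e \<in> hedges H" "e' = \<beta> e"
    using embD(5)[OF em, of e'] C by auto
  then have "bd H e \<in> C"
    using e' embD(7)[OF em] wf_graphD(3)[OF wf] C inj_on_image_mem_iff[OF embD(1)[OF em]]
    by auto
  then show "e' \<in> \<beta> ` {e \<in> hedges H. bd H e \<in> C}"
    using e by auto
qed (use embD(4,7)[OF em] in auto)

lemma emb_sig_fixed:
  assumes "wf_graph H" "emb \<alpha> \<beta> H H'" "e \<in> hedges H"
  shows "sig H' (\<beta> e) = \<beta> e \<longleftrightarrow> sig H e = e"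
  using assms embD(2,8) wf_graphD(4) by (metis inj_onD)

lemma emb_star:
  assumes "wf_graph H" "emb \<alpha> \<beta> H H'" "v \<in> verts H"
  shows "star H' (\<alpha> v) = \<beta> ` star H v"
  using emb_hedges_at[OF assms(1,2), of "{v}"] assms(3) by (simp add: star_def)

text \<open>
  Collections of half-edge types, hence the types of vertices and of residues, are preserved.
\<close>

lemma image_mset_emb:
  assumes "emb \<alpha> \<beta> H H'" "A \<subseteq> hedges H"
  shows "image_mset (htype H') (mset_set (\<beta> ` A)) = image_mset (htype H) (mset_set A)"
proof (cases "finite A")
  case True
  have "inj_on \<beta> A"
    using embD(2)[OF assms(1)] assms(2) by (rule inj_on_subset)
  then have "image_mset (htype H') (mset_set (\<beta> ` A)) = image_mset (htype H' \<circ> \<beta>) (mset_set A)"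
    by (metis image_mset_mset_set multiset.map_comp)
  also have "\<dots> = image_mset (htype H) (mset_set A)"
    using embD(9)[OF assms(1)] assms(2) True by (intro image_mset_cong) auto
  finally show ?thesis .
next
  case False
  moreover have "infinite (\<beta> ` A)"
    using False embD(2)[OF assms(1)] assms(2) by (meson finite_image_iff inj_on_subset)
  ultimately show ?thesis
    by simp
qed

lemma emb_vtype:
  assumes "wf_graph H" "emb \<alpha> \<beta> H H'" "v \<in> verts H"
  shows "vtype H' (\<alpha> v) = vtype H v"
proof -
  have "star H v \<subseteq> hedges H"
    by (auto simp: star_def)
  then show ?thesis
    using image_mset_emb[OF assms(2)] emb_star[OF assms] embD(6)[OF assms(2,3)]
    by (auto simp: vtype_def)
qed

lemma emb_nontriv_verts:
  assumes wf: "wf_graph H" "wf_graph H'" and em: "emb \<alpha> \<beta> H H'" and v: "v \<in> verts H"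
  shows "\<alpha> v \<in> nontriv_verts H' \<longleftrightarrow> v \<in> nontriv_verts H"
proof -
  have *: "x \<in> nontriv_verts K \<longleftrightarrow> x \<in> verts K \<and>
      (\<exists>e \<in> {e \<in> hedges K. bd K e \<in> component K x}. sig K e \<noteq> e)"
    for K :: "('x, 'y, 't) fgraph" and x
    by (auto simp: nontriv_verts_def int_hedges_def)
  show ?thesis
    unfolding * emb_component[OF wf em v] emb_hedges_at[OF wf(1) em component_subset]
    using v embD(3)[OF em v] emb_sig_fixed[OF wf(1) em] by auto
qed

lemma emb_star_ext:
  assumes "wf_graph H" "emb \<alpha> \<beta> H H'" "v \<in> verts H"
  shows "star H' (\<alpha> v) \<subseteq> ext_edges H' \<longleftrightarrow> star H v \<subseteq> ext_edges H"
  unfolding emb_star[OF assms] using emb_sig_fixed[OF assms(1,2)] embD(4)[OF assms(2)]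
  by (auto simp: ext_edges_def star_def)

lemma component_bare:
  assumes "v \<in> verts G" "star G v \<subseteq> ext_edges G"
  shows "component G v = {v}"
proof -
  have "edge_closed G {v}"
    using assms(2) by (auto simp: edge_closed_def star_def ext_edges_def)
  then show ?thesis
    using component_least[of v "{v}" G] component_refl[OF assms(1)] by auto
qed

definition giso ::
  "('v \<Rightarrow> 'w) \<Rightarrow> ('h \<Rightarrow> 'l) \<Rightarrow> ('v, 'h, 't) fgraph \<Rightarrow> ('w, 'l, 't) fgraph \<Rightarrow> bool" where
  "giso \<alpha> \<beta> H H' \<longleftrightarrow> emb \<alpha> \<beta> H H' \<and> \<alpha> ` verts H = verts H' \<and> \<beta> ` hedges H = hedges H'"

lemma giso_wf:
  assumes "giso \<alpha> \<beta> H H'" "wf_graph H"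
  shows "wf_graph H'"
proof -
  have im: "verts H' = \<alpha> ` verts H" "hedges H' = \<beta> ` hedges H" and em: "emb \<alpha> \<beta> H H'"
    using assms by (auto simp: giso_def)
  show ?thesis
    unfolding wf_graph_def im
    using wf_graphD[OF assms(2)] embD(7-9)[OF em] by auto
qed

lemma giso_components:
  assumes "wf_graph H" "giso \<alpha> \<beta> H H'"
  shows "components H' = (`) \<alpha> ` components H"
proof -
  have "component H' (\<alpha> v) = \<alpha> ` component H v" if "v \<in> verts H" for v
    using emb_component[OF assms(1) giso_wf[OF assms(2,1)]] that assms(2) by (auto simp: giso_def)
  then have "component H' ` \<alpha> ` verts H = (`) \<alpha> ` component H ` verts H"
    by (auto simp: image_image)
  then show ?thesis
    using assms(2) by (simp add: components_def giso_def)
qed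

lemma giso_connected:
  assumes "wf_graph H" "giso \<alpha> \<beta> H H'"
  shows "connected_graph H' \<longleftrightarrow> connected_graph H"
proof -
  have wf': "wf_graph H'"
    using assms giso_wf by blast
  have inj: "inj_on \<alpha> (verts H)" and im: "\<alpha> ` verts H = verts H'"
    using assms embD by (auto simp: giso_def)
  have "components H' = {verts H'} \<longleftrightarrow> components H = {verts H}"
  proof
    assume "components H' = {verts H'}"
    then have *: "(`) \<alpha> ` components H = {\<alpha> ` verts H}"
      using giso_components[OF assms] im by simp
    have "C = verts H" if "C \<in> components H" for C
    proof -
      have "\<alpha> ` C = \<alpha> ` verts H"
        using * that by blast
      then show ?thesis
        using inj_on_image_eq_iff[OF inj components_subset[OF that]] by simp
    qed
    then show "components H = {verts H}"
      using * by auto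
  next
    assume "components H = {verts H}"
    then show "components H' = {verts H'}"
      using giso_components[OF assms] im by simp
  qed
  then show ?thesis
    by (simp only: connected_graph_iff_component[OF wf'] connected_graph_iff_component[OF assms(1)])
qed

lemma giso_cut_edge:
  assumes "wf_graph H" "giso \<alpha> \<beta> H H'" "e \<in> hedges H"
  shows "giso \<alpha> \<beta> (cut_edge H e) (cut_edge H' (\<beta> e))"
proof -
  have em: "emb \<alpha> \<beta> H H'"
    using assms by (simp add: giso_def)
  have "\<beta> x = \<beta> y \<longleftrightarrow> x = y" if "x \<in> hedges H" "y \<in> hedges H" for x y
    using embD(2)[OF em] that by (auto simp: inj_on_def)
  then show ?thesis
    using assms wf_graphD(4)[OF assms(1)] embD(8)[OF em]
    by (simp add: giso_def emb_def cut_edge_def)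
qed

lemma giso_int_hedges:
  assumes "wf_graph H" "giso \<alpha> \<beta> H H'"
  shows "int_hedges H' = \<beta> ` int_hedges H"
proof -
  have em: "emb \<alpha> \<beta> H H'" and im: "\<beta> ` hedges H = hedges H'"
    using assms by (auto simp: giso_def)
  show ?thesis
    unfolding int_hedges_def im[symmetric] using emb_sig_fixed[OF assms(1) em] by auto
qed

lemma giso_one_pi:
  assumes "wf_graph H" "giso \<alpha> \<beta> H H'"
  shows "one_pi H' \<longleftrightarrow> one_pi H"
proof -
  have "connected_graph (cut_edge H' (\<beta> e)) \<longleftrightarrow> connected_graph (cut_edge H e)"
    if "e \<in> int_hedges H" for e
  proof -
    have "e \<in> hedges H"
      using that by (simp add: int_hedges_def)
    then show ?thesis
      using giso_connected[OF wf_cut_edge[OF assms(1)] giso_cut_edge[OF assms]] by simp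
  qed
  then show ?thesis
    using giso_connected[OF assms] giso_int_hedges[OF assms] by (auto simp: one_pi_def)
qed

lemma wf_comp_graph:
  assumes "wf_graph G" "C \<subseteq> verts G" "edge_closed G C"
  shows "wf_graph (comp_graph G C)"
  using assms finite_subset[of C "verts G"]
  by (auto simp: wf_graph_def comp_graph_def edge_closed_def)

lemma emb_comp_graph_incl:
  assumes "wf_graph G" "C \<subseteq> verts G"
  shows "emb id id (comp_graph G C) G"
  using assms by (auto simp: emb_def comp_graph_def)

lemma emb_comp_graph:
  assumes wf: "wf_graph H" and em: "emb \<alpha> \<beta> H H'" and C: "C \<subseteq> verts H"
  shows "giso \<alpha> \<beta> (comp_graph H C) (comp_graph H' (\<alpha> ` C))"
proof -
  have "inj_on \<alpha> C" "inj_on \<beta> {e \<in> hedges H. bd H e \<in> C}"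
    using embD(1,2)[OF em] C by (auto intro: inj_on_subset)
  then show ?thesis
    using em C emb_hedges_at[OF wf em C] embD[OF em]
    by (auto simp: giso_def emb_def comp_graph_def)
qed

section \<open>Specified graphs, vertex by vertex\<close>

text \<open>
  The half-edges at a vertex of the residue are those external edges whose end lies in the
  corresponding component.
\<close>

lemma vtype_residue:
  assumes "wf_graph G" "C \<in> components G"
  shows "vtype (residue (G, i)) C =
    (image_mset (htype G) (mset_set {e \<in> ext_edges G. bd G e \<in> C}), i C)"
proof -
  have "component G (bd G e) = C \<longleftrightarrow> bd G e \<in> C" if "e \<in> hedges G" for e
    using component_eq_component[OF assms] component_refl wf_graphD(3)[OF assms(1) that] by auto
  then have "star (residue (G, i)) C = {e \<in> ext_edges G. bd G e \<in> C}"
    by (auto simp: star_def residue_def ext_edges_def)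
  then show ?thesis
    by (simp add: vtype_def residue_def)
qed

lemma emb_components:
  assumes wf: "wf_graph H" "wf_graph H'" and em: "emb \<alpha> \<beta> H H'" and C: "C \<in> components H"
  shows "\<alpha> ` C \<in> components H'"
proof -
  obtain v where "v \<in> verts H" "C = component H v"
    using C by (auto simp: components_def)
  then show ?thesis
    using emb_component[OF wf em, symmetric] embD(3)[OF em] by (simp add: components_def)
qed

lemma emb_vtype_residue:
  assumes wf: "wf_graph H" "wf_graph H'" and em: "emb \<alpha> \<beta> H H'" and C: "C \<in> components H"
    and i: "i' (\<alpha> ` C) = i C"
  shows "vtype (residue (H', i')) (\<alpha> ` C) = vtype (residue (H, i)) C"
proof -
  have "{e \<in> ext_edges H'. bd H' e \<in> \<alpha> ` C} = {e \<in> {e \<in> hedges H'. bd H' e \<in> \<alpha> ` C}. sig H' e = e}"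
    by (auto simp: ext_edges_def)
  also have "\<dots> = \<beta> ` {e \<in> ext_edges H. bd H e \<in> C}"
    unfolding emb_hedges_at[OF wf(1) em components_subset[OF C]]
    using emb_sig_fixed[OF wf(1) em] by (auto simp: ext_edges_def)
  finally show ?thesis
    using image_mset_emb[OF em, of "{e \<in> ext_edges H. bd H e \<in> C}"] i
    by (auto simp: vtype_residue wf C emb_components[OF wf em] ext_edges_def)
qed

text \<open>
  Apart from well-formedness and the half-edge types, the conditions on a specified graph concern
  one component or one vertex, and can be checked at each vertex separately.  This makes them transportable
  along embeddings.
\<close>

definition spec_at :: "'t qft \<Rightarrow> ('v, 'h, 't) fgraph \<Rightarrow> ('v set \<Rightarrow> nat) \<Rightarrow> 'v \<Rightarrow> bool" where
  "spec_at T G i v \<longleftrightarrow> vtype G v \<in> vert_types T \<and>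
     one_pi (comp_graph G (component G v)) \<and>
     vtype (residue (G, i)) (component G v) \<in> vert_types T \<and>
     (star G v \<subseteq> ext_edges G \<longrightarrow> i {v} = vindex G v)"

lemma specified_graph_iff:
  "specified_graph T (G, i) \<longleftrightarrow> wf_graph G \<and> htype G ` hedges G \<subseteq> half_types T \<and>
     (\<forall>v \<in> verts G. spec_at T G i v)"
  by (auto simp: graph_of_def locally_one_pi_def components_def spec_at_def)

text \<open>
  Every ingredient of \<open>spec_at\<close> is computed in the component of \<open>v\<close>.  The last clause involves
  \<open>i {v}\<close> only if \<open>v\<close> has external edges alone, in which case \<open>{v}\<close> is a component.
\<close>

lemma emb_spec_at:
  assumes wf: "wf_graph H" "wf_graph H'" and em: "emb \<alpha> \<beta> H H'" and v: "v \<in> verts H"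
    and i: "i' (\<alpha> ` component H v) = i (component H v)"
  shows "spec_at T H' i' (\<alpha> v) \<longleftrightarrow> spec_at T H i v"
proof -
  let ?C = "component H v"
  have C: "?C \<subseteq> verts H" "?C \<in> components H"
    using component_subset[of H v] v by (simp_all add: components_def)
  have 1: "one_pi (comp_graph H' (\<alpha> ` ?C)) \<longleftrightarrow> one_pi (comp_graph H ?C)"
    by (rule giso_one_pi[OF wf_comp_graph[OF wf(1) C(1) edge_closed_component[OF wf(1)]]
          emb_comp_graph[OF wf(1) em C(1)]])
  have 2: "vtype (residue (H', i')) (\<alpha> ` ?C) = vtype (residue (H, i)) ?C"
    using emb_vtype_residue[OF wf em C(2), of i' i] i by simp
  have 3: "i' {\<alpha> v} = i {v}" if "star H v \<subseteq> ext_edges H"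
    using i component_bare[OF v that] by simp
  show ?thesis
    using 1 2 3 emb_component[OF wf em v] emb_vtype[OF wf(1) em v] emb_star_ext[OF wf(1) em v]
      embD(6)[OF em v] by (auto simp: spec_at_def)
qed

section \<open>Contractions\<close>

lemma coveringD:
  assumes "covering_subgraph g G"
  shows "wf_graph g" "verts g = verts G" "hedges g = hedges G"
    "\<And>v. v \<in> verts G \<Longrightarrow> vindex g v = vindex G v"
    "\<And>e. e \<in> hedges G \<Longrightarrow> bd g e = bd G e"
    "\<And>e. e \<in> hedges G \<Longrightarrow> htype g e = htype G e"
    "\<And>e. e \<in> hedges G \<Longrightarrow> sig g e = e \<or> sig g e = sig G e"
  using assms by (auto simp: covering_subgraph_def)

text \<open>
  If \<open>e\<close> is external in \<open>g\<close> then so is \<open>sig G e\<close>; hence \<open>sig G\<close> acts on the half-edges of the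
  contracted graph.
\<close>

lemma wf_contract:
  assumes G: "wf_graph G" and cov: "covering_subgraph g G"
  shows "wf_graph (fst (contract (G, i) (g, j)))"
proof -
  note c = coveringD[OF cov]
  have "sig G e \<in> ext_edges g" if "e \<in> ext_edges g" for e
  proof -
    have e: "e \<in> hedges G" "sig g e = e"
      using that c by (auto simp: ext_edges_def)
    then have "sig G e \<in> hedges G"
      using wf_graphD[OF G] by auto
    moreover then have "sig g (sig G e) = sig G e"
      using c(7)[of "sig G e"] wf_graphD(5)[OF G e(1)] wf_graphD(5)[OF c(1), of "sig G e"] e c(3)
      by auto
    ultimately show ?thesis
      using c(3) by (simp add: ext_edges_def)
  qed
  moreover have "finite (components g)" "finite (ext_edges g)"
    using wf_graphD[OF c(1)] by (auto simp: components_def ext_edges_def)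
  moreover have "htype g (sig G e) = htype g e" "sig G (sig G e) = e"
    "component g (bd g e) \<in> components g" if "e \<in> ext_edges g" for e
  proof -
    have e: "e \<in> hedges G"
      using that c(3) by (simp add: ext_edges_def)
    show "sig G (sig G e) = e"
      using wf_graphD[OF G] e by auto
    show "component g (bd g e) \<in> components g"
      using wf_graphD(3)[OF c(1)] e c(3) by (auto simp: components_def)
    show "htype g (sig G e) = htype g e"
      using c(6) wf_graphD[OF G] e by auto
  qed
  ultimately show ?thesis
    using c wf_graphD[OF G] by (auto simp: wf_graph_def ext_edges_def)
qed

text \<open>
  The union of an edge-closed set of contracted vertices is edge-closed in \<open>G\<close>: an edge of \<open>G\<close>
  is either an edge of the contracted graph or stays within a component of \<open>g\<close>.
\<close>

lemma contract_connected:
  assumes G: "wf_graph G" and cov: "covering_subgraph g G" and con: "connected_graph G"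
  shows "connected_graph (fst (contract (G, i) (g, j)))"
proof -
  let ?K = "fst (contract (G, i) (g, j))"
  note c = coveringD[OF cov]
  have "A = components g"
    if A: "A \<subseteq> components g" "A \<noteq> {}" "edge_closed ?K A" for A
  proof -
    have "edge_closed G (\<Union>A)"
      unfolding edge_closed_def
    proof (intro ballI impI)
      fix e assume e: "e \<in> hedges G" "bd G e \<in> \<Union>A"
      then obtain C where C: "C \<in> A" "bd G e \<in> C"
        by auto
      have cC: "component g (bd g e) = C"
        using component_eq_component[OF c(1)] A C c(5) e by auto
      show "bd G (sig G e) \<in> \<Union>A"
      proof (cases "e \<in> ext_edges g")
        case True
        then have "component g (bd g (sig G e)) \<in> A"
          using A(3) C cC by (auto simp: edge_closed_def)
        then show ?thesis
          using component_refl[of "bd g (sig G e)" g] c wf_graphD[OF G] e(1) by auto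
      next
        case False
        then have "sig g e = sig G e"
          using c(3,7) e by (auto simp: ext_edges_def)
        then have "bd g (sig G e) \<in> component g (bd g e)"
          using edge_closed_component[OF c(1)] component_refl wf_graphD(3)[OF c(1)] e c(3)
          by (metis edge_closed_def)
        then show ?thesis
          using C cC c(5) wf_graphD[OF G] e by auto
      qed
    qed
    moreover obtain C where "C \<in> A"
      using A by auto
    moreover then have "C \<noteq> {}"
      using A(1) components_nonempty by blast
    moreover have "\<Union>A \<subseteq> verts G"
      using A(1) c(2) components_subset by blast
    ultimately have U: "\<Union>A = verts G"
      using con connected_graph_iff[OF G] by blast
    have "C \<in> A" if "C \<in> components g" for C
    proof -
      obtain v where v: "v \<in> verts g" "C = component g v"
        using \<open>C \<in> components g\<close> unfolding components_def by blast
      then obtain D where "D \<in> A" "v \<in> D"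
        using U c(2) by auto
      then show ?thesis
        using component_eq_component[OF c(1), of D v] A(1) v by auto
    qed
    then show ?thesis
      using A(1) by auto
  qed
  moreover have "components g \<noteq> {}"
    using con connected_graph_iff[OF G] c(2) by (auto simp: components_def)
  ultimately show ?thesis
    using connected_graph_iff[OF wf_contract[OF G cov, of i j]] by auto
qed

text \<open>
  An edge of the contracted graph is cut already in \<open>g\<close>.  So \<open>g\<close> also covers the graph in which
  this edge is cut, and contraction commutes with cutting.
\<close>

lemma contract_one_pi:
  assumes G: "wf_graph G" and cov: "covering_subgraph g G" and pi: "one_pi G"
  shows "one_pi (fst (contract (G, i) (g, j)))"
proof -
  note c = coveringD[OF cov]
  have "connected_graph (cut_edge (fst (contract (G, i) (g, j))) e)"
    if e: "e \<in> int_hedges (fst (contract (G, i) (g, j)))" for e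
  proof -
    have e': "e \<in> hedges G" "sig g e = e" "sig G e \<noteq> e"
      using e c(3) by (auto simp: int_hedges_def ext_edges_def)
    have "sig G e \<in> ext_edges g"
      using wf_graphD(4)[OF wf_contract[OF G cov, of i j], of e] e by (auto simp: int_hedges_def)
    then have "covering_subgraph g (cut_edge G e)"
      using cov e' by (auto simp: covering_subgraph_def cut_edge_def ext_edges_def)
    moreover have "connected_graph (cut_edge G e)"
      using pi e' by (auto simp: one_pi_def int_hedges_def)
    ultimately have "connected_graph (fst (contract (cut_edge G e, i) (g, j)))"
      by (rule contract_connected[OF wf_cut_edge[OF G e'(1)]])
    moreover have "fst (contract (cut_edge G e, i) (g, j)) = cut_edge (fst (contract (G, i) (g, j))) e"
      by (simp add: cut_edge_def)
    ultimately show ?thesis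
      by simp
  qed
  then show ?thesis
    using contract_connected[OF G cov] pi by (auto simp: one_pi_def)
qed

text \<open>
  The contracted graph has the external edges and the index of \<open>G\<close>, and its vertices have types
  of the theory because \<open>g\<close> is specified.  It can have a bare vertex only if \<open>g\<close> equals the
  connected graph \<open>G\<close>, and then the specifications agree by the definition of a specified
  subgraph.
\<close>

lemma contract_connected_specified:
  assumes S: "connected_specified T (G, i)" and s: "specified_graph T (g, j)"
    and sub: "specified_subgraph (g, j) (G, i)"
  shows "connected_specified T (contract (G, i) (g, j))"
proof -
  let ?K = "fst (contract (G, i) (g, j))"
  let ?k = "\<lambda>D. i (\<Union>D)"
  have cov: "covering_subgraph g G"
    using sub by simp
  note c = coveringD[OF cov]
  have G: "wf_graph G" and pi: "one_pi G"
    using S by (auto simp: connected_specified_def graph_of_def)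
  have wfK: "wf_graph ?K" and piK: "one_pi ?K"
    using wf_contract[OF G cov] contract_one_pi[OF G cov pi] by auto
  have cG: "components G = {verts G}"
    using one_pi_components[OF G pi] .
  have cK: "components ?K = {components g}"
    using one_pi_components[OF wfK piK] by simp
  have hK: "htype ?K ` hedges ?K \<subseteq> half_types T"
    using S c(3) by (auto simp: connected_specified_def graph_of_def ext_edges_def)
  have "vtype ?K C = vtype (residue (g, j)) C" for C
  proof -
    have "finite {e \<in> ext_edges g. component g (bd g e) = C}"
      using wf_graphD(2)[OF c(1)] by (simp add: ext_edges_def)
    then show ?thesis
      using c(3,6) by (auto simp: vtype_def residue_def star_def ext_edges_def intro!: image_mset_cong)
  qed
  then have vK: "vtype ?K ` verts ?K \<subseteq> vert_types T"
    using s by auto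
  have extK: "{e \<in> ext_edges ?K. bd ?K e \<in> components g} = {e \<in> ext_edges G. bd G e \<in> verts G}"
    (is "?L = ?R")
  proof (intro subset_antisym subsetI)
    fix e assume "e \<in> ?R"
    then have e: "e \<in> hedges G" "sig G e = e"
      by (auto simp: ext_edges_def)
    then have "sig g e = e"
      using c(7)[of e] by simp
    then show "e \<in> ?L"
      using e c(3) wf_graphD(3)[OF c(1)] by (auto simp: ext_edges_def components_def)
  qed (use c(3) wf_graphD[OF G] in \<open>auto simp: ext_edges_def\<close>)
  have "vtype (residue (?K, ?k)) (components g) = vtype (residue (G, i)) (verts G)"
    using vtype_residue[OF wfK, of "components g" ?k] vtype_residue[OF G, of "verts G" i]
    unfolding extK cK cG by (simp add: Union_components c(2))
  then have rK: "\<forall>C \<in> components ?K. vtype (residue (?K, ?k)) C \<in> vert_types T"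
    using S cK cG by (auto simp: connected_specified_def)
  \<comment> \<open>A vertex \<open>C\<close> of the contracted graph without internal edges: \<open>g\<close> cuts no edge at \<open>C\<close>.\<close>
  have bK: "?k {C} = vindex ?K C" if C: "C \<in> verts ?K" "star ?K C \<subseteq> ext_edges ?K" for C
  proof -
    have Cg: "C \<in> components g"
      using C by simp
    have sg: "sig g e = sig G e" if e: "e \<in> hedges G" "bd G e \<in> C" for e
    proof (cases "e \<in> ext_edges g")
      case True
      then have "e \<in> star ?K C"
        using component_eq_component[OF c(1) Cg] e c(5) by (auto simp: star_def)
      then have "sig G e = e"
        using C(2) by (auto simp: ext_edges_def)
      then show ?thesis
        using c(7)[OF e(1)] by auto
    next
      case False
      then show ?thesis
        using c(3,7) e by (auto simp: ext_edges_def)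
    qed
    have "edge_closed G C"
      unfolding edge_closed_def
    proof (intro ballI impI)
      fix e assume e: "e \<in> hedges G" "bd G e \<in> C"
      have "bd g (sig g e) \<in> C"
        using edge_closed_component[OF c(1)] Cg e c(3,5)
        by (auto simp: edge_closed_def components_def)
      then show "bd G (sig G e) \<in> C"
        using sg[OF e] c(5) wf_graphD(4)[OF G] e by auto
    qed
    moreover have "C \<noteq> {}"
      using Cg by (rule components_nonempty)
    moreover have "C \<subseteq> verts G"
      using components_subset[OF Cg] c(2) by simp
    ultimately have "C = verts G"
      using pi connected_graph_iff[OF G] by (auto simp: one_pi_def)
    then have "j C = i C"
      using sub Cg cG sg by auto
    then show ?thesis
      by simp
  qed
  have "graph_of T ?K"
    using wfK hK vK by (simp only: graph_of_def)
  then have "specified_graph T (?K, ?k)"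
    using one_pi_imp_locally_one_pi[OF wfK piK] rK bK by (simp only: specified_graph.simps) blast
  then have "connected_specified T (?K, ?k)"
    using piK by (simp only: connected_specified_def fst_conv)
  then show ?thesis
    by simp
qed

text \<open>
  Validity is thus a matter of the graph, its subgraph and their compatibility, each of which can
  be transported along embeddings.
\<close>

lemma valid_pair_iff:
  "valid_pair T (S, s) \<longleftrightarrow>
     connected_specified T S \<and> specified_graph T s \<and> specified_subgraph s S"
proof -
  have "connected_specified T (contract S s)"
    if "connected_specified T S" "specified_graph T s" "specified_subgraph s S"
    using contract_connected_specified[of T "fst S" "snd S" "fst s" "snd s"] that by simp
  then show ?thesis
    unfolding valid_pair.simps by metis
qed

section \<open>Isomorphism of pairs\<close>

lemma giso_iff:
  "giso \<alpha> \<beta> H H' \<longleftrightarrow>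
     bij_betw \<alpha> (verts H) (verts H') \<and> bij_betw \<beta> (hedges H) (hedges H') \<and>
     (\<forall>v \<in> verts H. vindex H' (\<alpha> v) = vindex H v) \<and>
     (\<forall>e \<in> hedges H. bd H' (\<beta> e) = \<alpha> (bd H e) \<and> sig H' (\<beta> e) = \<beta> (sig H e) \<and>
        htype H' (\<beta> e) = htype H e)"
  by (auto simp: giso_def emb_def bij_betw_def)

lemma giso_comp:
  assumes "wf_graph H" "giso \<alpha> \<beta> H H'" "giso \<alpha>' \<beta>' H' H''"
  shows "giso (\<alpha>' \<circ> \<alpha>) (\<beta>' \<circ> \<beta>) H H''"
proof -
  have "\<alpha> v \<in> verts H'" if "v \<in> verts H" for v
    using assms(2) that by (auto simp: giso_def)
  moreover have "\<beta> e \<in> hedges H'" if "e \<in> hedges H" for e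
    using assms(2) that by (auto simp: giso_def)
  ultimately show ?thesis
    using assms by (auto simp: giso_iff intro: bij_betw_trans)
qed

lemma giso_inv:
  assumes wf: "wf_graph H" and iso: "giso \<alpha> \<beta> H H'"
  shows "giso (inv_into (verts H) \<alpha>) (inv_into (hedges H) \<beta>) H' H"
proof -
  let ?a = "inv_into (verts H) \<alpha>" and ?b = "inv_into (hedges H) \<beta>"
  have bij: "bij_betw \<alpha> (verts H) (verts H')" "bij_betw \<beta> (hedges H) (hedges H')"
    using iso by (auto simp: giso_iff)
  have a: "?a (\<alpha> v) = v" if "v \<in> verts H" for v
    using bij that by (auto simp: bij_betw_def)
  have b: "?b (\<beta> e) = e" if "e \<in> hedges H" for e
    using bij that by (auto simp: bij_betw_def)
  have im: "verts H' = \<alpha> ` verts H" "hedges H' = \<beta> ` hedges H"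
    using bij by (auto simp: bij_betw_def)
  show ?thesis
    unfolding giso_iff
  proof (intro conjI)
    show "bij_betw ?a (verts H') (verts H)" "bij_betw ?b (hedges H') (hedges H)"
      using bij by (auto intro: bij_betw_inv_into)
  qed (use iso wf_graphD[OF wf] a b in \<open>auto simp: im giso_iff\<close>)
qed

fun wf_pair :: "('v, 'h, 't) gpair \<Rightarrow> bool" where
  "wf_pair ((G, i), (g, j)) \<longleftrightarrow>
     wf_graph G \<and> wf_graph g \<and> verts g = verts G \<and> hedges g = hedges G"

text \<open>
  The explicit form of \<open>pair_iso\<close>, suited to constructing isomorphisms.
\<close>

fun piso ::
  "('v \<Rightarrow> 'w) \<Rightarrow> ('h \<Rightarrow> 'l) \<Rightarrow> ('v, 'h, 't) gpair \<Rightarrow> ('w, 'l, 't) gpair \<Rightarrow> bool" where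
  "piso \<alpha> \<beta> ((G, i), (g, j)) ((G', i'), (g', j')) \<longleftrightarrow>
     giso \<alpha> \<beta> G G' \<and> giso \<alpha> \<beta> g g' \<and>
     (\<forall>C \<in> components G. i' (\<alpha> ` C) = i C) \<and> (\<forall>C \<in> components g. j' (\<alpha> ` C) = j C)"

lemma piso_wf_pair:
  assumes "wf_pair P" "piso \<alpha> \<beta> P Q"
  shows "wf_pair Q"
proof -
  obtain G i g j where P: "P = ((G, i), (g, j))" by (metis surj_pair)
  obtain G' i' g' j' where Q: "Q = ((G', i'), (g', j'))" by (metis surj_pair)
  have "wf_graph G'" "wf_graph g'"
    using assms giso_wf unfolding P Q by (auto simp only: wf_pair.simps piso.simps)
  moreover have "verts G' = \<alpha> ` verts G" "verts g' = \<alpha> ` verts g"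
     "hedges G' = \<beta> ` hedges G" "hedges g' = \<beta> ` hedges g"
    using assms(2) unfolding P Q by (auto simp: giso_def)
  ultimately show ?thesis
    using assms(1) unfolding P Q by simp
qed

lemma pair_iso_iff:
  assumes "wf_pair P"
  shows "pair_iso P Q \<longleftrightarrow> (\<exists>\<alpha> \<beta>. piso \<alpha> \<beta> P Q)"
proof -
  obtain G i g j where P: "P = ((G, i), (g, j))" by (metis surj_pair)
  obtain G' i' g' j' where Q: "Q = ((G', i'), (g', j'))" by (metis surj_pair)
  show ?thesis
  proof
    assume "pair_iso P Q"
    then obtain \<alpha> \<beta> where "bij_betw \<alpha> (verts G) (verts G')" "bij_betw \<beta> (hedges G) (hedges G')"
      "\<forall>(H, H') \<in> {(G, G'), (g, g')}.
           (\<forall>v \<in> verts G. vindex H' (\<alpha> v) = vindex H v) \<and>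
           (\<forall>e \<in> hedges G. bd H' (\<beta> e) = \<alpha> (bd H e) \<and> sig H' (\<beta> e) = \<beta> (sig H e) \<and>
              htype H' (\<beta> e) = htype H e)"
      "\<forall>C \<in> components G. i' (\<alpha> ` C) = i C" "\<forall>C \<in> components g. j' (\<alpha> ` C) = j C"
      unfolding P Q pair_iso.simps by blast
    moreover have "verts g = verts G" "hedges g = hedges G" "verts g' = verts G'" "hedges g' = hedges G'"
      using \<open>pair_iso P Q\<close> unfolding P Q pair_iso.simps by blast+
    ultimately have "piso \<alpha> \<beta> P Q"
      unfolding P Q by (simp add: giso_iff)
    then show "\<exists>\<alpha> \<beta>. piso \<alpha> \<beta> P Q"
      by blast
  next
    assume "\<exists>\<alpha> \<beta>. piso \<alpha> \<beta> P Q"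
    then obtain \<alpha> \<beta> where iso: "piso \<alpha> \<beta> P Q"
      by blast
    have "wf_pair Q"
      using piso_wf_pair assms iso by blast
    then show "pair_iso P Q"
      using assms iso unfolding P Q pair_iso.simps
      by (auto simp: giso_iff intro!: exI[of _ \<alpha>] exI[of _ \<beta>])
  qed
qed

lemma pair_iso_trans:
  assumes wf: "wf_pair P" and "pair_iso P Q" "pair_iso Q R"
  shows "pair_iso P R"
proof -
  obtain G i g j where P: "P = ((G, i), (g, j))" by (metis surj_pair)
  obtain G' i' g' j' where Q: "Q = ((G', i'), (g', j'))" by (metis surj_pair)
  obtain G'' i'' g'' j'' where R: "R = ((G'', i''), (g'', j''))" by (metis surj_pair)
  obtain \<alpha> \<beta> where 1: "piso \<alpha> \<beta> P Q"
    using assms pair_iso_iff by blast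
  then obtain \<alpha>' \<beta>' where 2: "piso \<alpha>' \<beta>' Q R"
    using assms pair_iso_iff piso_wf_pair by blast
  have "giso (\<alpha>' \<circ> \<alpha>) (\<beta>' \<circ> \<beta>) G G''" "giso (\<alpha>' \<circ> \<alpha>) (\<beta>' \<circ> \<beta>) g g''"
    using wf 1 2 giso_comp unfolding P Q R piso.simps wf_pair.simps by blast+
  moreover have "components G' = (`) \<alpha> ` components G" "components g' = (`) \<alpha> ` components g"
    using wf 1 giso_components unfolding P Q piso.simps wf_pair.simps by blast+
  ultimately have "piso (\<alpha>' \<circ> \<alpha>) (\<beta>' \<circ> \<beta>) P R"
    using 1 2 unfolding P Q R by (simp add: image_comp[symmetric] del: o_apply)
  then show ?thesis
    using pair_iso_iff[OF wf] by blast
qed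

lemma pair_iso_sym:
  assumes wf: "wf_pair P" and iso: "pair_iso P Q"
  shows "pair_iso Q P"
proof -
  obtain G i g j where P: "P = ((G, i), (g, j))" by (metis surj_pair)
  obtain G' i' g' j' where Q: "Q = ((G', i'), (g', j'))" by (metis surj_pair)
  obtain \<alpha> \<beta> where 1: "piso \<alpha> \<beta> P Q"
    using assms pair_iso_iff by blast
  have wfs: "wf_graph G" "wf_graph g" "verts g = verts G" "hedges g = hedges G"
    using wf unfolding P by auto
  have isos: "giso \<alpha> \<beta> G G'" "giso \<alpha> \<beta> g g'"
    using 1 unfolding P Q by auto
  let ?a = "inv_into (verts G) \<alpha>" and ?b = "inv_into (hedges G) \<beta>"
  have "giso ?a ?b G' G" "giso ?a ?b g' g"
    using giso_inv[OF wfs(1) isos(1)] giso_inv[OF wfs(2) isos(2)] wfs by auto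
  moreover have "components G' = (`) \<alpha> ` components G" "components g' = (`) \<alpha> ` components g"
    using giso_components wfs isos by blast+
  moreover have "?a ` \<alpha> ` C = C" if "C \<subseteq> verts G" for C
    using that isos by (intro inv_into_image_cancel) (auto simp: giso_iff bij_betw_def)
  ultimately have "piso ?a ?b Q P"
    using 1 components_subset[of _ G] components_subset[of _ g] unfolding P Q
    by (auto simp: wfs)
  then show ?thesis
    using pair_iso_iff piso_wf_pair wf 1 by blast
qed

text \<open>
  The pairs may have different types of vertices and half-edges, whereas their classes consist
  of pairs over the natural numbers.
\<close>

lemma iso_class_eq:
  assumes "wf_pair P" "pair_iso P Q"
  shows "iso_class P = iso_class Q"
proof -
  have Q: "wf_pair Q" "pair_iso Q P"
    using assms piso_wf_pair pair_iso_iff pair_iso_sym by blast+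
  show ?thesis
    using pair_iso_trans[OF assms(1,2)] pair_iso_trans[OF Q] by (auto simp: iso_class_def)
qed

lemma pair_vec_eq:
  assumes "wf_pair P" "piso \<alpha> \<beta> P Q"
  shows "pair_vec P = pair_vec Q"
proof -
  have "pair_iso P Q"
    using pair_iso_iff[OF assms(1)] assms(2) by blast
  then show ?thesis
    by (simp only: pair_vec_def iso_class_eq[OF assms(1)])
qed

text \<open>
  Isomorphism classes are therefore non-empty, and a valid pair over any types represents a
  generator of the vector space.
\<close>

lemma ex_pair_iso_nat:
  assumes "wf_pair P"
  shows "\<exists>Q :: (nat, nat, 't) gpair. pair_iso (P :: ('v, 'h, 't) gpair) Q"
proof -
  obtain G i g j where P: "P = ((G, i), (g, j))" by (metis surj_pair)
  have wfs: "wf_graph G" "wf_graph g" "verts g = verts G" "hedges g = hedges G"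
    using assms unfolding P by auto
  obtain \<alpha> :: "'v \<Rightarrow> nat" where a: "inj_on \<alpha> (verts G)"
    using finite_imp_inj_to_nat_seg[of "verts G"] wf_graphD[OF wfs(1)] by auto
  obtain \<beta> :: "'h \<Rightarrow> nat" where b: "inj_on \<beta> (hedges G)"
    using finite_imp_inj_to_nat_seg[of "hedges G"] wf_graphD[OF wfs(1)] by auto
  let ?a = "inv_into (verts G) \<alpha>" and ?b = "inv_into (hedges G) \<beta>"
  define push :: "('v, 'h, 't) fgraph \<Rightarrow> (nat, nat, 't) fgraph" where
    "push H = \<lparr>verts = \<alpha> ` verts H, hedges = \<beta> ` hedges H, bd = \<lambda>e. \<alpha> (bd H (?b e)),
       sig = \<lambda>e. \<beta> (sig H (?b e)), htype = \<lambda>e. htype H (?b e), vindex = \<lambda>v. vindex H (?a v)\<rparr>"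
    for H
  have push: "giso \<alpha> \<beta> H (push H)" if "verts H = verts G" "hedges H = hedges G" for H
    using a b that by (auto simp: giso_iff push_def bij_betw_def)
  have "?a ` \<alpha> ` C = C" if "C \<subseteq> verts G" for C
    using that a by (intro inv_into_image_cancel) auto
  then have "piso \<alpha> \<beta> P ((push G, \<lambda>C. i (?a ` C)), (push g, \<lambda>C. j (?a ` C)))"
    using push wfs components_subset[of _ G] components_subset[of _ g] unfolding P by simp
  then show ?thesis
    using pair_iso_iff[OF assms] by blast
qed

lemma valid_pair_wf:
  assumes "valid_pair T P"
  shows "wf_pair P"
  using assms
  by (cases P rule: wf_pair.cases)
    (auto simp: connected_specified_def graph_of_def covering_subgraph_def)

lemma specified_graph_giso:
  assumes S: "specified_graph T (G, i)" and iso: "giso \<alpha> \<beta> G G'"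
    and i: "\<forall>C \<in> components G. i' (\<alpha> ` C) = i C"
  shows "specified_graph T (G', i')"
proof -
  have G: "wf_graph G" "htype G ` hedges G \<subseteq> half_types T" "\<forall>v \<in> verts G. spec_at T G i v"
    using S unfolding specified_graph_iff by auto
  have em: "emb \<alpha> \<beta> G G'" and im: "verts G' = \<alpha> ` verts G" "hedges G' = \<beta> ` hedges G"
    using iso by (auto simp: giso_def)
  have G': "wf_graph G'"
    using giso_wf[OF iso G(1)] .
  have "spec_at T G' i' (\<alpha> v)" if "v \<in> verts G" for v
    using emb_spec_at[OF G(1) G' em that, of i' i] i G(3) that by (auto simp: components_def)
  then show ?thesis
    unfolding specified_graph_iff using G G' embD(9)[OF em] by (auto simp: im)
qed

lemma valid_pair_iso:
  assumes val: "valid_pair T P" and "pair_iso P Q"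
  shows "valid_pair T Q"
proof -
  obtain G i g j where P: "P = ((G, i), (g, j))" by (metis surj_pair)
  obtain G' i' g' j' where Q: "Q = ((G', i'), (g', j'))" by (metis surj_pair)
  obtain \<alpha> \<beta> where iso: "piso \<alpha> \<beta> P Q"
    using assms pair_iso_iff valid_pair_wf by blast
  have wfs: "wf_graph G" "wf_graph g" "verts g = verts G" "hedges g = hedges G"
    using valid_pair_wf[OF val] unfolding P by auto
  have isos: "giso \<alpha> \<beta> G G'" "giso \<alpha> \<beta> g g'"
    and ij: "\<forall>C \<in> components G. i' (\<alpha> ` C) = i C" "\<forall>C \<in> components g. j' (\<alpha> ` C) = j C"
    using iso unfolding P Q by auto
  have S: "connected_specified T (G, i)" "specified_graph T (g, j)"
    and sub: "covering_subgraph g G" "\<forall>C \<in> components g \<inter> components G.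
        (\<forall>e \<in> hedges G. bd G e \<in> C \<longrightarrow> sig g e = sig G e) \<longrightarrow> j C = i C"
    using val unfolding P valid_pair_iff by auto
  note cov = coveringD[OF sub(1)]
  have em: "emb \<alpha> \<beta> G G'" "emb \<alpha> \<beta> g g'"
    and im: "verts G' = \<alpha> ` verts G" "hedges G' = \<beta> ` hedges G"
      "verts g' = \<alpha> ` verts G" "hedges g' = \<beta> ` hedges G"
    using isos wfs by (auto simp: giso_def)
  have inj: "inj_on \<alpha> (verts G)" "inj_on \<beta> (hedges G)"
    using embD em by auto
  have "specified_graph T (G', i')" "specified_graph T (g', j')"
    using specified_graph_giso S isos ij unfolding connected_specified_def by blast+
  moreover have "one_pi G'"
    using giso_one_pi[OF wfs(1) isos(1)] S(1) by (simp add: connected_specified_def)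
  moreover have "wf_graph g'"
    using giso_wf[OF isos(2) wfs(2)] .
  then have "covering_subgraph g' G'"
    using cov embD(6-9)[OF em(1)] embD(6-9)[OF em(2)]
    by (simp add: covering_subgraph_def im) metis
  moreover have "j' C' = i' C'" if C': "C' \<in> components g'" "C' \<in> components G'"
      and uncut: "\<forall>e \<in> hedges G'. bd G' e \<in> C' \<longrightarrow> sig g' e = sig G' e" for C'
  proof -
    obtain C D where C: "C \<in> components g" "D \<in> components G" "C' = \<alpha> ` C" "C' = \<alpha> ` D"
      using C' giso_components[OF wfs(1) isos(1)] giso_components[OF wfs(2) isos(2)] by auto
    have "C \<subseteq> verts G" "D \<subseteq> verts G"
      using C components_subset wfs(3) by fastforce+
    then have "D = C"
      using C inj_on_image_eq_iff[OF inj(1)] by metis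
    have "sig g e = sig G e" if e: "e \<in> hedges G" "bd G e \<in> C" for e
    proof -
      have "\<beta> (sig g e) = \<beta> (sig G e)"
        using uncut e C(3) embD(7,8)[OF em(1)] embD(8)[OF em(2)] wfs(4) by (auto simp: im)
      then show ?thesis
        using inj(2) e wf_graphD(4)[OF wfs(1)] wf_graphD(4)[OF wfs(2)] wfs(4)
        by (auto simp: inj_on_def)
    qed
    then have "j C = i C"
      using sub(2) C \<open>D = C\<close> by auto
    then show ?thesis
      using ij C \<open>D = C\<close> by auto
  qed
  ultimately show ?thesis
    unfolding Q valid_pair_iff by (simp add: connected_specified_def)
qed

section \<open>Insertion of pairs\<close>

text \<open>
  Insertion preserves connectedness.  An edge-closed set meeting \<open>G1\<close> contains all of it; replacing
  \<open>G1\<close> by the single vertex \<open>v\<close> turns the set into an edge-closed subset of \<open>G2\<close>.  The graph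
  \<open>H\<close> is described by its properties only, so that the lemma covers insertions with an edge of
  \<open>G1\<close> or of \<open>G2\<close> cut as well.
\<close>

lemma insert_connected:
  assumes wf: "wf_graph H" "wf_graph G1" "wf_graph G2"
    and con: "connected_graph G1" "connected_graph G2" and v: "v \<in> verts G2"
    and V: "verts H = Inl ` verts G1 \<union> Inr ` (verts G2 - {v})"
    and E1: "\<And>e. e \<in> int_hedges G1 \<Longrightarrow>
       Inl e \<in> hedges H \<and> bd H (Inl e) = Inl (bd G1 e) \<and> sig H (Inl e) = Inl (sig G1 e)"
    and E2: "\<And>e. e \<in> hedges G2 \<Longrightarrow> Inr e \<in> hedges H \<and> sig H (Inr e) = Inr (sig G2 e) \<and>
       (if bd G2 e = v then bd H (Inr e) \<in> Inl ` verts G1 else bd H (Inr e) = Inr (bd G2 e))"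
  shows "connected_graph H"
proof -
  have "A = verts H" if A: "A \<subseteq> verts H" "A \<noteq> {}" "edge_closed H A" for A
  proof -
    have "edge_closed G1 (verts G1 \<inter> Inl -` A)"
      unfolding edge_closed_def
    proof (intro ballI impI)
      fix e assume e: "e \<in> hedges G1" "bd G1 e \<in> verts G1 \<inter> Inl -` A"
      show "bd G1 (sig G1 e) \<in> verts G1 \<inter> Inl -` A"
      proof (cases "sig G1 e = e")
        case True
        then show ?thesis
          using e by simp
      next
        case False
        then have "e \<in> int_hedges G1" "sig G1 e \<in> int_hedges G1"
          using e wf_graphD[OF wf(2)] by (auto simp: int_hedges_def)
        then have "bd H (sig H (Inl e)) \<in> A"
          using E1[of e] A(3) e unfolding edge_closed_def by fastforce
        then show ?thesis
          using E1 \<open>e \<in> int_hedges G1\<close> \<open>sig G1 e \<in> int_hedges G1\<close> wf_graphD[OF wf(2)] e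
          by auto
      qed
    qed
    then have A1: "Inl ` verts G1 \<subseteq> A" if "Inl x \<in> A" "x \<in> verts G1" for x
      using that con(1) connected_graph_iff[OF wf(2)] by blast
    have "edge_closed G2 {u \<in> verts G2. if u = v then Inl ` verts G1 \<subseteq> A else Inr u \<in> A}"
      (is "edge_closed G2 ?B")
      unfolding edge_closed_def
    proof (intro ballI impI)
      fix e assume e: "e \<in> hedges G2" "bd G2 e \<in> ?B"
      then have e': "sig G2 e \<in> hedges G2"
        using wf_graphD[OF wf(3)] by auto
      have "bd H (Inr e) \<in> A"
        using e E2[OF e(1)] by (auto split: if_splits)
      then have "bd H (sig H (Inr e)) \<in> A"
        using A(3) E2[OF e(1)] by (auto simp: edge_closed_def)
      then have *: "bd H (Inr (sig G2 e)) \<in> A"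
        using E2[OF e(1)] by simp
      show "bd G2 (sig G2 e) \<in> ?B"
      proof (cases "bd G2 (sig G2 e) = v")
        case True
        then obtain x where "x \<in> verts G1" "Inl x \<in> A"
          using * E2[OF e'] by auto
        then show ?thesis
          using A1 True v by simp
      next
        case False
        then show ?thesis
          using * E2[OF e'] wf_graphD(3)[OF wf(3) e'] by simp
      qed
    qed
    moreover have "?B \<noteq> {}"
    proof -
      obtain a where "a \<in> A" "a \<in> verts H"
        using A by auto
      then consider x where "a = Inl x" "x \<in> verts G1" | u where "a = Inr u" "u \<in> verts G2 - {v}"
        using V by auto
      then show ?thesis
      proof cases
        case 1
        then have "v \<in> ?B"
          using A1 \<open>a \<in> A\<close> v by simp
        then show ?thesis
          by blast
      next
        case 2
        then have "u \<in> ?B"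
          using \<open>a \<in> A\<close> by simp
        then show ?thesis
          by blast
      qed
    qed
    moreover have "?B \<subseteq> verts G2"
      by blast
    ultimately have "?B = verts G2"
      using con(2) connected_graph_iff[OF wf(3)] by blast
    then have B: "u \<in> ?B" if "u \<in> verts G2" for u
      using that by simp
    then have "Inl ` verts G1 \<subseteq> A"
      using v by fastforce
    moreover have "Inr u \<in> A" if "u \<in> verts G2 - {v}" for u
      using B[of u] that by simp
    ultimately show "A = verts H"
      using A(1) unfolding V by blast
  qed
  moreover have "verts H \<noteq> {}"
    using con(1) connected_graph_iff[OF wf(2)] V by simp
  ultimately show ?thesis
    using connected_graph_iff[OF wf(1)] by blast
qed

text \<open>
  The half-edge of the insertion that represents the half-edge \<open>e\<close> of \<open>G1\<close>; an external edge
  is named after the half-edge at \<open>v\<close> glued to it.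
\<close>

definition insert_hedge ::
  "('v, 'h, 't) fgraph \<Rightarrow> 'w \<Rightarrow> ('l \<Rightarrow> 'h) \<Rightarrow> ('w, 'l, 't) fgraph \<Rightarrow> 'h \<Rightarrow> 'h + 'l" where
  "insert_hedge G1 v \<phi> G2 e =
     (if e \<in> int_hedges G1 then Inl e else Inr (inv_into (star G2 v) \<phi> e))"

text \<open>
  One term of the product of two valid pairs.
\<close>

locale insertion =
  fixes T :: "'t qft"
    and G1 :: "('v, 'h, 't) fgraph" and i1 and g1 :: "('v, 'h, 't) fgraph" and j1
    and v :: 'w and \<phi> :: "'l \<Rightarrow> 'h"
    and G2 :: "('w, 'l, 't) fgraph" and i2 and g2 :: "('w, 'l, 't) fgraph" and j2
  assumes valid1: "valid_pair T ((G1, i1), (g1, j1))"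
    and valid2: "valid_pair T ((G2, i2), (g2, j2))"
    and v: "v \<in> verts G2" "v \<notin> nontriv_verts g2"
    and vtype_v: "vtype G2 v = res_type (G1, i1)"
    and \<phi>: "\<phi> \<in> gluings G1 G2 v"
begin

abbreviation "G \<equiv> graph_insert G1 v \<phi> G2"
abbreviation "g \<equiv> G\<lparr>sig := case_sum (\<lambda>e. Inl (sig g1 e)) (\<lambda>e. Inr (sig g2 e))\<rparr>"
abbreviation "J \<equiv> \<lambda>C. if C \<subseteq> range Inl then j1 (Inl -` C) else j2 (Inr -` C)"
abbreviation "\<eta> \<equiv> insert_hedge G1 v \<phi> G2"

lemma pair_insert_eq:
  "pair_insert ((G1, i1), (g1, j1)) v \<phi> ((G2, i2), (g2, j2)) =
     ((G, \<lambda>_. i2 (verts G2)), (g, J))"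
  by simp

lemma S: "connected_specified T (G1, i1)" "connected_specified T (G2, i2)"
    "specified_graph T (g1, j1)" "specified_graph T (g2, j2)"
  and cov: "covering_subgraph g1 G1" "covering_subgraph g2 G2"
  using valid1 valid2 by auto

lemmas cov1 = coveringD[OF cov(1)] and cov2 = coveringD[OF cov(2)]

lemma wfG: "wf_graph G1" "wf_graph G2" and pi: "one_pi G1" "one_pi G2"
  and half: "htype G1 ` hedges G1 \<subseteq> half_types T" "htype G2 ` hedges G2 \<subseteq> half_types T"
  using S by (auto simp: connected_specified_def graph_of_def)

lemmas wfG1 = wf_graphD[OF wfG(1)] and wfG2 = wf_graphD[OF wfG(2)]

lemma comps: "components G1 = {verts G1}" "components G2 = {verts G2}"
  using one_pi_components wfG pi by blast+

lemma \<phi>_bij: "bij_betw \<phi> (star G2 v) (ext_edges G1)"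
  and \<phi>_type: "\<And>e. e \<in> star G2 v \<Longrightarrow> htype G1 (\<phi> e) = htype G2 e"
  using \<phi> by (auto simp: gluings_def)

lemma \<phi>_ext: "e \<in> hedges G2 \<Longrightarrow> bd G2 e = v \<Longrightarrow> \<phi> e \<in> ext_edges G1"
  using \<phi>_bij by (auto simp: bij_betw_def star_def)

text \<open>
  Outside \<open>nontriv_verts\<close> the component of \<open>v\<close> has no internal edge.
\<close>

lemma bare: "e \<in> hedges G2 \<Longrightarrow> bd G2 e = v \<Longrightarrow> sig g2 e = e"
  using v component_refl[of v g2] cov2(2,3,5) by (auto simp: nontriv_verts_def int_hedges_def)

lemma bare_sig: "e \<in> hedges G2 \<Longrightarrow> bd G2 e \<noteq> v \<Longrightarrow> bd G2 (sig g2 e) \<noteq> v"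
  using bare wf_graphD[OF cov2(1)] cov2(3) by metis

lemma star_bare: "star g2 v \<subseteq> ext_edges g2"
  using bare cov2(3,5) by (auto simp: star_def ext_edges_def)

lemma component_v: "component g2 v = {v}"
  using component_bare[OF _ star_bare] v(1) cov2(2) by simp

lemma sig1_int: "e \<in> int_hedges G1 \<Longrightarrow> sig g1 e \<in> int_hedges G1"
  using cov1(7)[of e] wfG1(4,5)[of e] by (auto simp: int_hedges_def)

lemma sig1_ext: "e \<in> ext_edges G1 \<Longrightarrow> sig g1 e = e"
  using cov1(7)[of e] by (auto simp: ext_edges_def)

lemma \<eta>_\<phi>: "e \<in> hedges G2 \<Longrightarrow> bd G2 e = v \<Longrightarrow> \<eta> (\<phi> e) = Inr e"
  using \<phi>_ext[of e] \<phi>_bij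
  by (auto simp: insert_hedge_def int_hedges_def ext_edges_def bij_betw_def star_def)

lemma ext_cases:
  assumes "e \<in> hedges G1"
  obtains "e \<in> int_hedges G1" "\<eta> e = Inl e"
  | f where "f \<in> hedges G2" "bd G2 f = v" "e = \<phi> f" "\<eta> e = Inr f" "e \<in> ext_edges G1"
proof (cases "e \<in> int_hedges G1")
  case True
  then show ?thesis
    using that by (simp add: insert_hedge_def)
next
  case False
  then have "e \<in> ext_edges G1"
    using assms by (auto simp: int_hedges_def ext_edges_def)
  then obtain f where "f \<in> star G2 v" "e = \<phi> f"
    using \<phi>_bij by (auto simp: bij_betw_def)
  then show ?thesis
    using that(2)[of f] \<eta>_\<phi> \<open>e \<in> ext_edges G1\<close> by (auto simp: star_def)
qed

lemma G_simps:
  "verts G = Inl ` verts G1 \<union> Inr ` (verts G2 - {v})"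
  "hedges G = Inl ` int_hedges G1 \<union> Inr ` hedges G2"
  "bd G (Inl e) = Inl (bd G1 e)"
  "bd G2 f = v \<Longrightarrow> bd G (Inr f) = Inl (bd G1 (\<phi> f))"
  "bd G2 f \<noteq> v \<Longrightarrow> bd G (Inr f) = Inr (bd G2 f)"
  "sig G (Inl e) = Inl (sig G1 e)" "sig G (Inr f) = Inr (sig G2 f)"
  "htype G (Inl e) = htype G1 e" "htype G (Inr f) = htype G2 f"
  "vindex G (Inl x) = vindex G1 x" "vindex G (Inr y) = vindex G2 y"
  by (auto simp: graph_insert_def)

lemma verts_cases:
  assumes "x \<in> verts G"
  obtains w where "x = Inl w" "w \<in> verts G1"
  | y where "x = Inr y" "y \<in> verts G2" "y \<noteq> v"
  using assms by (auto simp: G_simps)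

lemma bd_\<phi>: "e \<in> hedges G2 \<Longrightarrow> bd G2 e = v \<Longrightarrow> bd G1 (\<phi> e) \<in> verts G1"
  using \<phi>_ext wfG1(3) by (auto simp: ext_edges_def)

lemma wf_insert: "wf_graph G"
  unfolding wf_graph_def
proof (intro conjI ballI)
  show "finite (verts G)" "finite (hedges G)"
    using wfG1 wfG2 by (auto simp: G_simps int_hedges_def)
  fix x assume "x \<in> hedges G"
  then consider e where "x = Inl e" "e \<in> int_hedges G1" | f where "x = Inr f" "f \<in> hedges G2"
    by (auto simp: G_simps)
  then have "bd G x \<in> verts G \<and> sig G x \<in> hedges G \<and> sig G (sig G x) = x \<and>
      htype G (sig G x) = htype G x"
  proof cases
    case 1
    then show ?thesis
      using wfG1 by (auto simp: G_simps int_hedges_def)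
  next
    case 2
    then show ?thesis
      using wfG2 bd_\<phi> by (cases "bd G2 f = v") (auto simp: G_simps)
  qed
  then show "bd G x \<in> verts G" "sig G x \<in> hedges G" "sig G (sig G x) = x"
    "htype G (sig G x) = htype G x"
    by auto
qed

lemma covering_insert: "covering_subgraph g G"
proof -
  have "wf_graph g"
    unfolding wf_graph_def
  proof (intro conjI ballI)
    show "finite (verts g)" "finite (hedges g)"
      using wf_graphD[OF wf_insert] by auto
    fix x assume "x \<in> hedges g"
    then have "x \<in> hedges G" 
      by simp
    then show "bd g x \<in> verts g"
      using wf_graphD[OF wf_insert] by auto
    consider e where "x = Inl e" "e \<in> int_hedges G1" | f where "x = Inr f" "f \<in> hedges G2"
      using \<open>x \<in> hedges G\<close> by (auto simp: G_simps)
    then have "sig g x \<in> hedges g \<and> sig g (sig g x) = x \<and> htype g (sig g x) = htype g x"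
    proof cases
      case 1
      then have "e \<in> hedges G1"
        by (simp add: int_hedges_def)
      then show ?thesis
        using 1 sig1_int wf_graphD(5,6)[OF cov1(1), of e] cov1(3) cov1(6)[of e]
          cov1(6)[of "sig g1 e"] wf_graphD(4)[OF cov1(1), of e]
        by (simp add: G_simps)
    next
      case 2
      then show ?thesis
        using wf_graphD(4-6)[OF cov2(1), of f] cov2(3) cov2(6)[of f] cov2(6)[of "sig g2 f"]
        by (simp add: G_simps)
    qed
    then show "sig g x \<in> hedges g" "sig g (sig g x) = x" "htype g (sig g x) = htype g x"
      by auto
  qed
  moreover have "sig g x \<in> {x, sig G x}" if x: "x \<in> hedges G" for x
  proof -
    consider e where "x = Inl e" "e \<in> hedges G1" | f where "x = Inr f" "f \<in> hedges G2"
      using x by (auto simp: G_simps int_hedges_def)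
    then show ?thesis
    proof cases
      case 1
      then show ?thesis
        using cov1(7)[of e] by (simp add: G_simps)
    next
      case 2
      then show ?thesis
        using cov2(7)[of f] by (simp add: G_simps)
    qed
  qed
  ultimately show ?thesis
    by (simp add: covering_subgraph_def)
qed

lemmas covG = coveringD[OF covering_insert]

text \<open>
  The half-edges at \<open>v\<close> are cut in \<open>g2\<close>, and the external edges of \<open>G1\<close> are external in
  \<open>g1\<close>, so gluing them leaves \<open>g1\<close> unchanged.
\<close>

lemma emb1: "emb Inl \<eta> g1 g"
  unfolding emb_def
proof (intro conjI ballI impI)
  have "e = e'" if "e \<in> hedges G1" "e' \<in> hedges G1" "\<eta> e = \<eta> e'" for e e'
    using that(3) by (rule_tac ext_cases[OF that(1)]; rule_tac ext_cases[OF that(2)]) auto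
  then show "inj_on \<eta> (hedges g1)"
    using cov1(3) by (auto intro: inj_onI)
  show "\<eta> ` hedges g1 \<subseteq> hedges g"
  proof clarify
    fix e assume "e \<in> hedges g1"
    then have "e \<in> hedges G1"
      using cov1(3) by simp
    then show "\<eta> e \<in> hedges g"
      by (cases rule: ext_cases) (auto simp: G_simps)
  qed
  show "Inl ` verts g1 \<subseteq> verts g"
    using cov1 by (auto simp: G_simps)
  fix x assume x: "x \<in> hedges g" "bd g x \<in> Inl ` verts g1"
  then consider e where "x = Inl e" "e \<in> int_hedges G1" | f where "x = Inr f" "f \<in> hedges G2"
    by (auto simp: G_simps)
  then show "x \<in> \<eta> ` hedges g1"
  proof cases
    case 1
    then show ?thesis
      using cov1(3) by (auto simp: insert_hedge_def int_hedges_def)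
  next
    case 2
    then have "bd G2 f = v"
      using x by (cases "bd G2 f = v") (auto simp: G_simps)
    then show ?thesis
      using 2 \<eta>_\<phi>[of f] \<phi>_ext[of f] cov1(3) by (force simp: ext_edges_def)
  qed
next
  fix w assume "w \<in> verts g1"
  then show "vindex g (Inl w) = vindex g1 w"
    using cov1 by (simp add: G_simps)
next
  fix e assume "e \<in> hedges g1"
  then have e: "e \<in> hedges G1"
    using cov1(3) by simp
  then have "bd g (\<eta> e) = Inl (bd g1 e) \<and> sig g (\<eta> e) = \<eta> (sig g1 e) \<and>
      htype g (\<eta> e) = htype g1 e"
  proof (cases rule: ext_cases)
    case 1
    then show ?thesis
      using sig1_int[of e] cov1(5,6)[OF e] by (simp add: G_simps insert_hedge_def)
  next
    case (2 f)
    then show ?thesis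
      using sig1_ext[of e] cov1(5,6)[OF e] bare[of f] \<phi>_type[of f]
      by (simp add: G_simps star_def)
  qed
  then show "bd g (\<eta> e) = Inl (bd g1 e)" "sig g (\<eta> e) = \<eta> (sig g1 e)"
    "htype g (\<eta> e) = htype g1 e"
    by auto
qed auto

abbreviation "g2' \<equiv> comp_graph g2 (verts g2 - {v})"

lemma wf_g2': "wf_graph g2'"
  using bare_sig cov2(1,3,5) wf_graphD(4)[OF cov2(1)] wf_graphD(3)[OF cov2(1)]
  by (intro wf_comp_graph) (auto simp: edge_closed_def)

text \<open>
  The complement of \<open>v\<close> is a union of components of \<open>g2\<close>, and reappears unchanged.
\<close>

lemma emb2: "emb Inr Inr g2' g"
proof -
  have "e \<in> Inr ` hedges g2'" if e: "e \<in> hedges g" "bd g e \<in> Inr ` verts g2'" for e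
  proof -
    have "e \<notin> range Inl"
      using e(2) by (auto simp: G_simps)
    then obtain f where f: "e = Inr f" "f \<in> hedges G2"
      using e(1) by (auto simp: G_simps)
    then have "bd G2 f \<noteq> v"
      using e(2) G_simps(4)[of f] by fastforce
    then show ?thesis
      using f cov2(2,3,5) wfG2(3) by (auto simp: comp_graph_def)
  qed
  then show ?thesis
    using cov2 unfolding emb_def by (auto simp: comp_graph_def G_simps)
qed

lemma emb2': "emb id id g2' g2"
  by (rule emb_comp_graph_incl[OF cov2(1)]) blast

lemma component_Inl: "x \<in> verts G1 \<Longrightarrow> component g (Inl x) = Inl ` component g1 x"
  using emb_component[OF cov1(1) covG(1) emb1] cov1(2) by simp

lemma component_Inr:
  assumes "y \<in> verts G2" "y \<noteq> v"
  shows "component g (Inr y) = Inr ` component g2 y"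
proof -
  have y: "y \<in> verts g2'"
    using assms cov2(2) by (simp add: comp_graph_def)
  show ?thesis
    using emb_component[OF wf_g2' covG(1) emb2 y] emb_component[OF wf_g2' cov2(1) emb2' y] by simp
qed

lemma components_insert:
  assumes "C \<in> components g"
  obtains D where "D \<in> components g1" "C = Inl ` D"
  | D where "D \<in> components g2" "C = Inr ` D" "v \<notin> D"
proof -
  obtain x where "x \<in> verts G" "C = component g x"
    using assms by (auto simp: components_def)
  from this(1) consider y where "y \<in> verts G1" "C = Inl ` component g1 y"
    | y where "y \<in> verts G2" "y \<noteq> v" "C = Inr ` component g2 y"
    by (cases rule: verts_cases) (use \<open>C = component g x\<close> component_Inl component_Inr in blast)+
  then show ?thesis
  proof cases
    case 1
    then show ?thesis
      using that(1) cov1(2) by (auto simp: components_def)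
  next
    case 2
    then have "v \<notin> component g2 y"
      using component_eq[OF cov2(1), of y v] component_v component_refl[of y g2] cov2(2) by auto
    then show ?thesis
      using that(2) 2 cov2(2) by (auto simp: components_def)
  qed
qed

lemma star_g: "star g = star G" and vtype_g: "vtype g = vtype G"
  by (auto simp: star_def vtype_def fun_eq_iff)

lemma vtype_cov: "covering_subgraph k K \<Longrightarrow> x \<in> verts K \<Longrightarrow> vtype k x = vtype K x"
proof -
  assume k: "covering_subgraph k K" and x: "x \<in> verts K"
  note c = coveringD[OF k]
  have "star k x = star K x"
    using c by (auto simp: star_def)
  moreover have "finite (star K x)"
    using wf_graphD(2)[OF c(1)] c(3) by (simp add: star_def)
  ultimately show "vtype k x = vtype K x"
    using c x by (auto simp: vtype_def star_def intro!: image_mset_cong)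
qed

lemma vtype_Inl: "x \<in> verts G1 \<Longrightarrow> vtype G (Inl x) = vtype G1 x"
  using emb_vtype[OF cov1(1) emb1] vtype_cov[OF cov(1)] cov1(2) by (simp add: vtype_g)

lemma vtype_Inr:
  assumes "y \<in> verts G2" "y \<noteq> v"
  shows "vtype G (Inr y) = vtype G2 y"
proof -
  have y: "y \<in> verts g2'"
    using assms cov2(2) by (simp add: comp_graph_def)
  show ?thesis
    using emb_vtype[OF wf_g2' emb2 y] emb_vtype[OF wf_g2' emb2' y] vtype_cov[OF cov(2) assms(1)]
    by (simp add: vtype_g)
qed

lemma nontriv_Inl: "x \<in> verts G1 \<Longrightarrow> Inl x \<in> nontriv_verts g \<longleftrightarrow> x \<in> nontriv_verts g1"
  using emb_nontriv_verts[OF cov1(1) covG(1) emb1] cov1(2) by simp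

lemma nontriv_Inr:
  assumes "y \<in> verts G2" "y \<noteq> v"
  shows "Inr y \<in> nontriv_verts g \<longleftrightarrow> y \<in> nontriv_verts g2"
proof -
  have y: "y \<in> verts g2'"
    using assms cov2(2) by (simp add: comp_graph_def)
  show ?thesis
    using emb_nontriv_verts[OF wf_g2' covG(1) emb2 y] emb_nontriv_verts[OF wf_g2' cov2(1) emb2' y]
    by simp
qed

lemma star_Inl: "x \<in> verts G1 \<Longrightarrow> star G (Inl x) = \<eta> ` star G1 x"
  using emb_star[OF cov1(1) emb1, of x] cov1(2,3,5) by (auto simp: star_g) (auto simp: star_def)

lemma star_Inr: "y \<noteq> v \<Longrightarrow> star G (Inr y) = Inr ` star G2 y"
  by (auto simp: star_def graph_insert_def split: if_splits)

lemma ext_insert: "ext_edges G = Inr ` ext_edges G2"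
  by (auto simp: ext_edges_def G_simps int_hedges_def)

text \<open>
  Cutting an edge of the insertion amounts to cutting it in \<open>G1\<close> or in \<open>G2\<close>.
\<close>

lemma one_pi_insert: "one_pi G"
proof -
  have con: "connected_graph G1" "connected_graph G2"
    using pi by (auto simp: one_pi_def)
  have E2: "Inr e \<in> hedges G \<and> sig G (Inr e) = Inr (sig G2 e) \<and>
       (if bd G2 e = v then bd G (Inr e) \<in> Inl ` verts G1 else bd G (Inr e) = Inr (bd G2 e))"
    if "e \<in> hedges G2" for e
    using that bd_\<phi> by (auto simp: G_simps)
  have "connected_graph G"
    by (rule insert_connected[OF wf_insert wfG con v(1) G_simps(1) _ E2]) (auto simp: G_simps)
  moreover have "connected_graph (cut_edge G x)" if x: "x \<in> int_hedges G" for x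
  proof -
    have xG: "x \<in> hedges G"
      using x by (simp add: int_hedges_def)
    have wf': "wf_graph (cut_edge G x)"
      using wf_cut_edge[OF wf_insert xG] .
    have cut: "verts (cut_edge K f) = verts K" "hedges (cut_edge K f) = hedges K"
      "bd (cut_edge K f) = bd K" for K :: "('x, 'y, 't) fgraph" and f
      by (auto simp: cut_edge_def)
    consider e where "x = Inl e" "e \<in> int_hedges G1" | f where "x = Inr f" "f \<in> hedges G2"
      using xG by (auto simp: G_simps)
    then show ?thesis
    proof cases
      case 1
      then have e: "e \<in> hedges G1"
        by (simp add: int_hedges_def)
      have int: "int_hedges (cut_edge G1 e) \<subseteq> int_hedges G1"
        by (auto simp: int_hedges_def cut_edge_def)
      show ?thesis
      proof (rule insert_connected[OF wf' wf_cut_edge[OF wfG(1) e] wfG(2) _ con(2) v(1)])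
        show "connected_graph (cut_edge G1 e)"
          using pi 1 by (auto simp: one_pi_def)
        show "verts (cut_edge G x) = Inl ` verts (cut_edge G1 e) \<union> Inr ` (verts G2 - {v})"
          by (simp add: cut G_simps)
      next
        fix e' assume "e' \<in> int_hedges (cut_edge G1 e)"
        then show "Inl e' \<in> hedges (cut_edge G x) \<and> bd (cut_edge G x) (Inl e') = Inl (bd (cut_edge G1 e) e') \<and>
            sig (cut_edge G x) (Inl e') = Inl (sig (cut_edge G1 e) e')"
          using int 1 by (auto simp: cut G_simps) (auto simp: cut_edge_def G_simps)
      next
        fix f assume "f \<in> hedges G2"
        then show "Inr f \<in> hedges (cut_edge G x) \<and> sig (cut_edge G x) (Inr f) = Inr (sig G2 f) \<and>
          (if bd G2 f = v then bd (cut_edge G x) (Inr f) \<in> Inl ` verts (cut_edge G1 e)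
           else bd (cut_edge G x) (Inr f) = Inr (bd G2 f))"
          using E2[of f] 1 by (auto simp: cut) (auto simp: cut_edge_def G_simps)
      qed
    next
      case 2
      then have f: "f \<in> int_hedges G2"
        using x by (auto simp: int_hedges_def G_simps)
      show ?thesis
      proof (rule insert_connected[OF wf' wfG(1) wf_cut_edge[OF wfG(2) 2(2)] con(1)])
        show "connected_graph (cut_edge G2 f)"
          using pi f by (auto simp: one_pi_def)
        show "verts (cut_edge G x) = Inl ` verts G1 \<union> Inr ` (verts (cut_edge G2 f) - {v})"
          by (simp add: cut G_simps)
        show "v \<in> verts (cut_edge G2 f)"
          using v by (simp add: cut)
      next
        fix e' assume "e' \<in> int_hedges G1"
        then show "Inl e' \<in> hedges (cut_edge G x) \<and> bd (cut_edge G x) (Inl e') = Inl (bd G1 e') \<and>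
            sig (cut_edge G x) (Inl e') = Inl (sig G1 e')"
          using 2 by (auto simp: cut G_simps) (auto simp: cut_edge_def G_simps)
      next
        fix f' assume "f' \<in> hedges (cut_edge G2 f)"
        then show "Inr f' \<in> hedges (cut_edge G x) \<and>
           sig (cut_edge G x) (Inr f') = Inr (sig (cut_edge G2 f) f') \<and>
          (if bd (cut_edge G2 f) f' = v then bd (cut_edge G x) (Inr f') \<in> Inl ` verts G1
           else bd (cut_edge G x) (Inr f') = Inr (bd (cut_edge G2 f) f'))"
          using E2[of f'] 2 by (auto simp: cut) (auto simp: cut_edge_def G_simps)
      qed
    qed
  qed
  ultimately show ?thesis
    by (auto simp: one_pi_def)
qed

lemma components_G: "components G = {verts G}"
  using one_pi_components[OF wf_insert one_pi_insert] .

text \<open>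
  The external edges and the index of an insertion are those of \<open>G2\<close>; so the insertion fits
  into the same vertices of a third graph as \<open>G2\<close> does.
\<close>

lemma res_type_insert: "res_type (G, \<lambda>_. i2 (verts G2)) = res_type (G2, i2)"
proof -
  have 1: "{e \<in> ext_edges G. bd G e \<in> verts G} = Inr ` ext_edges G2"
    using ext_insert wf_graphD(3)[OF wf_insert] by (auto simp: ext_edges_def)
  have 2: "{e \<in> ext_edges G2. bd G2 e \<in> verts G2} = ext_edges G2"
    using wfG2(3) by (auto simp: ext_edges_def)
  have "htype G \<circ> Inr = htype G2"
    by (auto simp: G_simps)
  then have "image_mset (htype G) (mset_set (Inr ` ext_edges G2)) =
      image_mset (htype G2) (mset_set (ext_edges G2))"
    by (metis image_mset_mset_set inj_Inr inj_on_subset multiset.map_comp subset_UNIV)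
  then show ?thesis
    using vtype_residue[OF wf_insert] vtype_residue[OF wfG(2)] unfolding res_type_def fst_conv
    by (simp add: components_G comps 1 2)
qed

lemma index_v: "i1 (verts G1) = vindex G2 v"
  using vtype_v vtype_residue[OF wfG(1), of "verts G1"] comps by (simp add: res_type_def vtype_def)

text \<open>
  If the insertion is a bare vertex then so are both graphs, and all indices coincide: that of
  \<open>G1\<close> is the one of \<open>v\<close> by the hypothesis on types, and bare vertices are specified by their
  own index.
\<close>

lemma specified_insert: "specified_graph T (G, \<lambda>_. i2 (verts G2))"
proof -
  have "vtype G x \<in> vert_types T" if "x \<in> verts G" for x
    using that
  proof (cases rule: verts_cases)
    case (1 w)
    then show ?thesis
      using vtype_Inl[of w] S(1) by (auto simp: connected_specified_def graph_of_def)
  next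
    case (2 y)
    then show ?thesis
      using vtype_Inr[of y] S(2) by (auto simp: connected_specified_def graph_of_def)
  qed
  moreover have "htype G ` hedges G \<subseteq> half_types T"
    using half by (auto simp: G_simps int_hedges_def)
  moreover have "vtype (residue (G, \<lambda>_. i2 (verts G2))) C \<in> vert_types T" if "C \<in> components G" for C
    using that components_G res_type_insert S(2) comps
    by (simp add: res_type_def connected_specified_def)
  moreover have "i2 (verts G2) = vindex G x" if x: "x \<in> verts G" "star G x \<subseteq> ext_edges G" for x
  proof -
    have V: "verts G = {x}"
      using component_bare[OF x] components_G x(1) by (auto simp: components_def)
    obtain w where w: "w \<in> verts G1"
      using comps(1) by (auto simp: components_def)
    then have "x = Inl w"
      using V by (auto simp: G_simps)
    then have V1: "verts G1 = {w}" and V2: "verts G2 = {v}"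
      using V w v(1) by (auto simp: G_simps)
    have "star G2 v \<subseteq> ext_edges G2"
    proof
      fix e assume e: "e \<in> star G2 v"
      then have "Inr e \<in> star G x"
        using V1 \<open>x = Inl w\<close> bd_\<phi>[of e] by (auto simp: star_def G_simps)
      then show "e \<in> ext_edges G2"
        using x(2) ext_insert by auto
    qed
    then have "i2 {v} = vindex G2 v"
      using S(2) v(1) by (simp add: connected_specified_def)
    moreover have "star G1 w \<subseteq> ext_edges G1"
    proof
      fix e assume "e \<in> star G1 w"
      then have "e \<in> hedges G1" "\<eta> e \<in> ext_edges G"
        using x(2) star_Inl[OF w] \<open>x = Inl w\<close> by (auto simp: star_def)
      then show "e \<in> ext_edges G1"
        using ext_insert by (cases rule: ext_cases) auto
    qed
    then have "i1 {w} = vindex G1 w"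
      using S(1) w by (simp add: connected_specified_def)
    ultimately show ?thesis
      using index_v V1 V2 \<open>x = Inl w\<close> by (simp add: G_simps)
  qed
  ultimately show ?thesis
    using wf_insert one_pi_imp_locally_one_pi[OF wf_insert one_pi_insert]
    by (auto simp: graph_of_def)
qed

lemma specified_sub: "specified_graph T (g, J)"
proof -
  have g1: "\<forall>x \<in> verts g1. spec_at T g1 j1 x" and g2: "\<forall>x \<in> verts g2. spec_at T g2 j2 x"
    using S(3,4) unfolding specified_graph_iff by auto
  have *: "J (Inl ` C) = j1 C" for C
    by (auto simp: inj_vimage_image_eq)
  have **: "J (Inr ` C) = j2 C" if "C \<noteq> {}" for C
    using that by (auto simp: inj_vimage_image_eq)
  \<comment> \<open>Both embeddings carry specifications along; \<open>g2'\<close> inherits its own from \<open>g2\<close>.\<close>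
  have inl: "spec_at T g J (Inl x)" if "x \<in> verts G1" for x
    using emb_spec_at[OF cov1(1) covG(1) emb1, of x J j1] * g1 that cov1(2) by simp
  have inr: "spec_at T g J (Inr y)" if y: "y \<in> verts G2" "y \<noteq> v" for y
  proof -
    have y': "y \<in> verts g2'"
      using y cov2(2) by (simp add: comp_graph_def)
    then have "component g2' y \<noteq> {}"
      using component_refl[of y g2'] by blast
    then have "spec_at T g J (Inr y) = spec_at T g2' j2 y"
      by (intro emb_spec_at[OF wf_g2' covG(1) emb2 y'] **)
    also have "\<dots> = spec_at T g2 j2 y"
      using emb_spec_at[OF wf_g2' cov2(1) emb2' y', of j2 j2] by simp
    finally show ?thesis
      using g2 y cov2(2) by simp
  qed
  have "spec_at T g J x" if "x \<in> verts G" for x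
    using that
  proof (cases rule: verts_cases)
    case (1 w)
    show ?thesis
      unfolding 1(1) by (rule inl[OF 1(2)])
  next
    case (2 y)
    show ?thesis
      unfolding 2(1) by (rule inr[OF 2(2,3)])
  qed
  moreover have "htype g ` hedges g \<subseteq> half_types T"
    using half by (auto simp: G_simps int_hedges_def)
  ultimately show ?thesis
    using covG(1,2) unfolding specified_graph_iff by blast
qed

text \<open>
  If \<open>g\<close> has all of the insertion as a component and cuts none of its edges, then this component
  is \<open>g1\<close>, with \<open>G2\<close> reduced to the bare vertex \<open>v\<close> and no edge of \<open>G1\<close> cut.  Then the
  index prescribed for \<open>g1\<close> is that of \<open>G1\<close>, which is the index of \<open>v\<close> and thus of \<open>G2\<close>.
\<close>

lemma sub_insert: "specified_subgraph (g, J) (G, \<lambda>_. i2 (verts G2))"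
proof -
  have "J (verts G) = i2 (verts G2)"
    if C: "verts G \<in> components g" and uncut: "\<forall>e \<in> hedges G. bd G e \<in> verts G \<longrightarrow> sig g e = sig G e"
  proof -
    have unc: "sig g e = sig G e" if "e \<in> hedges G" for e
      using that uncut wf_graphD(3)[OF wf_insert] by auto
    obtain w where w: "w \<in> verts G1"
      using comps(1) by (auto simp: components_def)
    from C have V: "verts G = Inl ` verts G1 \<and> verts G1 \<in> components g1"
    proof (cases rule: components_insert)
      case (1 D)
      have "Inr y \<notin> verts G" for y
        unfolding 1(2) by blast
      then have "verts G2 - {v} = {}"
        unfolding G_simps by blast
      then have "verts G = Inl ` verts G1"
        unfolding G_simps by blast
      moreover from this have "D = verts G1"
        using 1(2) by (simp add: inj_image_eq_iff)
      ultimately show ?thesis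
        using 1 by simp
    next
      case (2 D)
      have "Inl w \<in> verts G"
        using w by (simp add: G_simps)
      then show ?thesis
        unfolding 2(2) by blast
    qed
    have "Inr y \<notin> Inl ` verts G1" for y
      by blast
    then have V2: "verts G2 = {v}"
      using V v(1) by (auto simp: G_simps)
    have "sig g1 e = sig G1 e" if e: "e \<in> hedges G1" for e
      using e
    proof (cases rule: ext_cases)
      case 1
      then show ?thesis
        using unc[of "Inl e"] by (simp add: G_simps)
    next
      case (2 f)
      then show ?thesis
        using sig1_ext by (simp add: ext_edges_def)
    qed
    then have 1: "j1 (verts G1) = i1 (verts G1)"
      using valid1 comps V by auto
    have "star G2 v \<subseteq> ext_edges G2"
    proof
      fix e assume e: "e \<in> star G2 v"
      then have "e \<in> hedges G2" "bd G2 e = v"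
        by (auto simp: star_def)
      then show "e \<in> ext_edges G2"
        using bare[of e] unc[of "Inr e"] by (simp add: G_simps ext_edges_def)
    qed
    then have "i2 {v} = vindex G2 v"
      using S(2) v(1) by (simp add: connected_specified_def)
    then show ?thesis
      using 1 index_v V V2 by (auto simp: inj_vimage_image_eq)
  qed
  then have "\<forall>C \<in> components g \<inter> components G.
      (\<forall>e \<in> hedges G. bd G e \<in> C \<longrightarrow> sig g e = sig G e) \<longrightarrow> J C = i2 (verts G2)"
    unfolding components_G by blast
  with covering_insert show ?thesis
    unfolding specified_subgraph.simps by (rule conjI)
qed

lemma valid_insert: "valid_pair T (pair_insert ((G1, i1), (g1, j1)) v \<phi> ((G2, i2), (g2, j2)))"
  unfolding pair_insert_eq valid_pair_iff connected_specified_def fst_conv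
  using specified_insert specified_sub sub_insert one_pi_insert by blast

end

section \<open>Bijections of half-edges\<close>

text \<open>
  Gluings, detached from graphs: \<open>s\<close> and \<open>t\<close> give the types.
\<close>

definition type_bijections ::
  "'a set \<Rightarrow> ('a \<Rightarrow> 't) \<Rightarrow> 'b set \<Rightarrow> ('b \<Rightarrow> 't) \<Rightarrow> ('a \<Rightarrow> 'b) set" where
  "type_bijections A s B t = {\<phi> \<in> A \<rightarrow>\<^sub>E B. bij_betw \<phi> A B \<and> (\<forall>a \<in> A. t (\<phi> a) = s a)}"

lemma gluings_eq:
  "gluings G1 G2 v = type_bijections (star G2 v) (htype G2) (ext_edges G1) (htype G1)"
  by (auto simp: gluings_def type_bijections_def)

lemma transport_type_bijection:
  assumes b: "bij_betw b A A'" and c: "bij_betw c B B'"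
    and s: "\<And>a. a \<in> A \<Longrightarrow> s' (b a) = s a" and t: "\<And>x. x \<in> B \<Longrightarrow> t' (c x) = t x"
    and \<phi>: "\<phi> \<in> type_bijections A s B t"
  defines "\<phi>' \<equiv> restrict (\<lambda>a. c (\<phi> (inv_into A b a))) A'"
  shows "\<phi>' \<in> type_bijections A' s' B' t'"
proof -
  have eq: "\<phi>' (b a) = c (\<phi> a)" if "a \<in> A" for a
    using that b by (auto simp: \<phi>'_def bij_betw_def)
  have A': "A' = b ` A"
    using b by (auto simp: bij_betw_def)
  have \<phi>_bij: "bij_betw \<phi> A B"
    using \<phi> by (simp add: type_bijections_def)
  then have mem: "\<phi> a \<in> B" if "a \<in> A" for a
    using that by (auto simp: bij_betw_def)
  have "bij_betw (c \<circ> \<phi> \<circ> inv_into A b) A' B'"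
    using bij_betw_trans[OF bij_betw_inv_into[OF b] bij_betw_trans[OF \<phi>_bij c]]
    by (simp add: comp_assoc)
  moreover have "bij_betw \<phi>' A' B' \<longleftrightarrow> bij_betw (c \<circ> \<phi> \<circ> inv_into A b) A' B'"
    by (rule bij_betw_cong) (simp add: \<phi>'_def)
  ultimately have "bij_betw \<phi>' A' B'"
    by simp
  moreover from this have "\<phi>' \<in> A' \<rightarrow>\<^sub>E B'"
    by (auto simp: bij_betw_def PiE_def \<phi>'_def)
  moreover have "t' (\<phi>' a') = s' a'" if "a' \<in> A'" for a'
    using that \<phi> s t eq mem by (auto simp: A' type_bijections_def)
  ultimately show "\<phi>' \<in> type_bijections A' s' B' t'"
    by (simp add: type_bijections_def)
qed

text \<open>
  Reindexing of sums over gluings along bijections \<open>b\<close>, \<open>c\<close> of the two sides.  The summands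
  are compared on pairs of corresponding gluings, without naming the correspondence.
\<close>

lemma sum_type_bijections:
  fixes b :: "'a \<Rightarrow> 'b" and c :: "'c \<Rightarrow> 'd"
  assumes b: "bij_betw b A A'" and c: "bij_betw c B B'"
    and s: "\<And>a. a \<in> A \<Longrightarrow> s' (b a) = s a" and t: "\<And>x. x \<in> B \<Longrightarrow> t' (c x) = t x"
    and F: "\<And>\<phi> \<phi>'. \<phi> \<in> type_bijections A s B t \<Longrightarrow> \<phi>' \<in> type_bijections A' s' B' t' \<Longrightarrow>
      (\<And>a. a \<in> A \<Longrightarrow> \<phi>' (b a) = c (\<phi> a)) \<Longrightarrow> F \<phi> = F' \<phi>'"
  shows "sum F (type_bijections A s B t) = sum F' (type_bijections A' s' B' t')"
proof -
  let ?b = "inv_into A b" and ?c = "inv_into B c"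
  have inv: "bij_betw ?b A' A" "bij_betw ?c B' B"
    using b c by (auto intro: bij_betw_inv_into)
  have bb: "?b (b a) = a" if "a \<in> A" for a
    using that b by (auto simp: bij_betw_def)
  have cc: "?c (c x) = x" if "x \<in> B" for x
    using that c by (auto simp: bij_betw_def)
  have A': "A' = b ` A" and B': "B' = c ` B"
    using b c by (auto simp: bij_betw_def)
  have s': "s (?b a') = s' a'" if "a' \<in> A'" for a'
    using that s bb by (auto simp: A')
  have t': "t (?c x') = t' x'" if "x' \<in> B'" for x'
    using that t cc by (auto simp: B')
  let ?J = "\<lambda>\<phi>. restrict (\<lambda>a. c (\<phi> (inv_into A b a))) A'"
  let ?I = "\<lambda>\<phi>'. restrict (\<lambda>a. ?c (\<phi>' (inv_into A' ?b a))) A"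
  have J: "?J \<phi> \<in> type_bijections A' s' B' t'" if "\<phi> \<in> type_bijections A s B t" for \<phi>
    by (rule transport_type_bijection[OF b c _ _ that]) (use s t in auto)
  have I: "?I \<phi> \<in> type_bijections A s B t" if "\<phi> \<in> type_bijections A' s' B' t'" for \<phi>
    by (rule transport_type_bijection[OF inv _ _ that]) (use s' t' in auto)
  have J': "?J \<phi> (b a) = c (\<phi> a)" if "a \<in> A" for \<phi> :: "'a \<Rightarrow> 'c" and a
    using that bb by (simp add: A')
  have I': "?I \<phi> (?b a) = ?c (\<phi> a)" if "a \<in> A'" for \<phi> :: "'b \<Rightarrow> 'd" and a
    using that inv(1) by (auto simp: bij_betw_def)
  have mem: "\<phi> a \<in> B" if "\<phi> \<in> type_bijections A s B t" "a \<in> A" for \<phi> a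
    using that by (auto simp: type_bijections_def bij_betw_def)
  have mem': "\<phi> a \<in> B'" if "\<phi> \<in> type_bijections A' s' B' t'" "a \<in> A'" for \<phi> a
    using that by (auto simp: type_bijections_def bij_betw_def)
  have ext: "\<phi> = \<phi>'" if "\<phi> \<in> type_bijections A s B t" "\<phi>' \<in> type_bijections A s B t"
    "\<And>a. a \<in> A \<Longrightarrow> \<phi> a = \<phi>' a" for \<phi> \<phi>'
    using that by (auto simp: type_bijections_def intro: PiE_ext)
  have ext': "\<phi> = \<phi>'" if "\<phi> \<in> type_bijections A' s' B' t'" "\<phi>' \<in> type_bijections A' s' B' t'"
    "\<And>a. a \<in> A' \<Longrightarrow> \<phi> a = \<phi>' a" for \<phi> \<phi>'
    using that by (auto simp: type_bijections_def intro: PiE_ext)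
  show ?thesis
  proof (rule sum.reindex_bij_witness[where i = ?I and j = ?J])
    fix \<phi> assume \<phi>: "\<phi> \<in> type_bijections A s B t"
    show J1: "?J \<phi> \<in> type_bijections A' s' B' t'"
      by (rule J[OF \<phi>])
    show "?I (?J \<phi>) = \<phi>"
    proof (rule ext[OF I[OF J1] \<phi>])
      fix a assume a: "a \<in> A"
      then have "?I (?J \<phi>) (?b (b a)) = ?c (?J \<phi> (b a))"
        using b by (intro I') (auto simp: A')
      then show "?I (?J \<phi>) a = \<phi> a"
        using J'[OF a, of \<phi>] bb[OF a] cc[OF mem[OF \<phi> a]] by simp
    qed
    show "F' (?J \<phi>) = F \<phi>"
      by (rule F[OF \<phi> J1 J', symmetric])
  next
    fix \<phi>' assume \<phi>': "\<phi>' \<in> type_bijections A' s' B' t'"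
    show I1: "?I \<phi>' \<in> type_bijections A s B t"
      by (rule I[OF \<phi>'])
    show "?J (?I \<phi>') = \<phi>'"
    proof (rule ext'[OF J[OF I1] \<phi>'])
      fix a' assume a': "a' \<in> A'"
      then obtain a where a: "a \<in> A" "a' = b a"
        by (auto simp: A')
      have "?J (?I \<phi>') (b a) = c (?I \<phi>' a)"
        by (rule J'[OF a(1)])
      moreover have "?I \<phi>' (?b a') = ?c (\<phi>' a')"
        by (rule I'[OF a'])
      ultimately show "?J (?I \<phi>') a' = \<phi>' a'"
        using mem'[OF \<phi>' a'] a bb cc by (auto simp: B')
    qed
  qed
qed

section \<open>Insertion and isomorphisms\<close>

lemma image_map_sum: "map_sum f g ` (Inl ` A \<union> Inr ` B) = Inl ` f ` A \<union> Inr ` g ` B"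
  by (simp add: image_Un image_image)

lemma inj_on_map_sum:
  assumes "inj_on f A" "inj_on g B"
  shows "inj_on (map_sum f g) (Inl ` A \<union> Inr ` B)"
  by (intro inj_onI) (auto dest: inj_onD[OF assms(1)] inj_onD[OF assms(2)])

lemma sum_image_simps:
  "Inl ` C \<subseteq> range Inl" "Inr ` D \<subseteq> range Inl \<longleftrightarrow> D = {}"
  "Inl -` Inl ` C = C" "Inr -` Inr ` D = D"
  by (auto simp: inj_vimage_image_eq)

text \<open>
  A half-edge at \<open>v\<close> is reattached to \<open>bd G1 (\<phi> e)\<close>; its image goes to the image of this vertex
  because the gluings correspond.
\<close>

lemma piso_insert:
  assumes ins: "insertion T G1 i1 g1 j1 v \<phi> G2 i2 g2 j2"
    and iso1: "piso \<alpha>1 \<beta>1 ((G1, i1), (g1, j1)) ((G1', i1'), (g1', j1'))"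
    and iso2: "piso \<alpha>2 \<beta>2 ((G2, i2), (g2, j2)) ((G2', i2'), (g2', j2'))"
    and \<phi>': "\<And>e. e \<in> star G2 v \<Longrightarrow> \<phi>' (\<beta>2 e) = \<beta>1 (\<phi> e)"
  shows "piso (map_sum \<alpha>1 \<alpha>2) (map_sum \<beta>1 \<beta>2)
    (pair_insert ((G1, i1), (g1, j1)) v \<phi> ((G2, i2), (g2, j2)))
    (pair_insert ((G1', i1'), (g1', j1')) (\<alpha>2 v) \<phi>' ((G2', i2'), (g2', j2')))"
proof -
  interpret I: insertion T G1 i1 g1 j1 v \<phi> G2 i2 g2 j2
    by (rule ins)
  let ?\<alpha> = "map_sum \<alpha>1 \<alpha>2" and ?\<beta> = "map_sum \<beta>1 \<beta>2"
  let ?G' = "graph_insert G1' (\<alpha>2 v) \<phi>' G2'"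
  let ?g' = "?G'\<lparr>sig := case_sum (\<lambda>e. Inl (sig g1' e)) (\<lambda>e. Inr (sig g2' e))\<rparr>"
  have isos: "giso \<alpha>1 \<beta>1 G1 G1'" "giso \<alpha>1 \<beta>1 g1 g1'" "giso \<alpha>2 \<beta>2 G2 G2'" "giso \<alpha>2 \<beta>2 g2 g2'"
    using iso1 iso2 by auto
  note D1 = isos(1)[unfolded giso_iff] and D2 = isos(3)[unfolded giso_iff]
    and d1 = isos(2)[unfolded giso_iff I.cov1(2,3)] and d2 = isos(4)[unfolded giso_iff I.cov2(2,3)]
  have im: "verts G1' = \<alpha>1 ` verts G1" "verts G2' = \<alpha>2 ` verts G2" "hedges G2' = \<beta>2 ` hedges G2"
    "int_hedges G1' = \<beta>1 ` int_hedges G1"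
    using D1 D2 giso_int_hedges[OF I.wfG(1) isos(1)] by (auto simp: bij_betw_def)
  have inj: "inj_on \<alpha>1 (verts G1)" "inj_on \<alpha>2 (verts G2)" "inj_on \<beta>1 (hedges G1)"
    "inj_on \<beta>2 (hedges G2)"
    using D1 D2 by (auto simp: bij_betw_def)
  have eq_v: "\<alpha>2 x = \<alpha>2 v \<longleftrightarrow> x = v" if "x \<in> verts G2" for x
    using inj(2) that I.v(1) by (auto simp: inj_on_def)
  have "bij_betw ?\<alpha> (verts I.G) (verts ?G')"
    unfolding bij_betw_def
  proof
    show "inj_on ?\<alpha> (verts I.G)"
      unfolding I.G_simps(1) using inj(1,2) by (intro inj_on_map_sum) (auto intro: inj_on_subset)
    have "\<alpha>2 ` (verts G2 - {v}) = \<alpha>2 ` verts G2 - {\<alpha>2 v}"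
      using inj(2) I.v(1) by (simp add: inj_on_image_set_diff[of _ "verts G2"])
    then show "?\<alpha> ` verts I.G = verts ?G'"
      by (simp add: graph_insert_def im image_map_sum)
  qed
  moreover have "bij_betw ?\<beta> (hedges I.G) (hedges ?G')"
    unfolding bij_betw_def
  proof
    show "inj_on ?\<beta> (hedges I.G)"
      unfolding I.G_simps(2) using inj(3,4)
      by (intro inj_on_map_sum) (auto simp: int_hedges_def intro: inj_on_subset)
    show "?\<beta> ` hedges I.G = hedges ?G'"
      by (simp add: graph_insert_def im image_map_sum)
  qed
  moreover have "vindex ?G' (?\<alpha> x) = vindex I.G x" if "x \<in> verts I.G" for x
    using D1 D2 that by (auto simp: graph_insert_def)
  moreover have "bd ?G' (?\<beta> x) = ?\<alpha> (bd I.G x) \<and> sig ?G' (?\<beta> x) = ?\<beta> (sig I.G x) \<and>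
      sig ?g' (?\<beta> x) = ?\<beta> (sig I.g x) \<and> htype ?G' (?\<beta> x) = htype I.G x" if x: "x \<in> hedges I.G" for x
  proof -
    consider e where "x = Inl e" "e \<in> hedges G1" | f where "x = Inr f" "f \<in> hedges G2"
      using x by (auto simp: graph_insert_def int_hedges_def)
    then show ?thesis
    proof cases
      case 1
      then show ?thesis
        using D1 d1 by (simp add: graph_insert_def)
    next
      case 2
      have bd: "bd G2' (\<beta>2 f) = \<alpha>2 (bd G2 f)"
        using D2 2 by simp
      have "bd ?G' (?\<beta> x) = ?\<alpha> (bd I.G x)"
      proof (cases "bd G2 f = v")
        case True
        then have "\<phi>' (\<beta>2 f) = \<beta>1 (\<phi> f)" "\<phi> f \<in> hedges G1"
          using \<phi>'[of f] I.\<phi>_ext[of f] 2 by (auto simp: star_def ext_edges_def)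
        then show ?thesis
          using 2 True bd D1 by (simp add: graph_insert_def)
      next
        case False
        then show ?thesis
          using 2 bd eq_v[OF I.wfG2(3)[OF 2(2)]] by (simp add: graph_insert_def)
      qed
      then show ?thesis
        using D2 d2 2 by (simp add: graph_insert_def)
    qed
  qed
  ultimately have iso: "giso ?\<alpha> ?\<beta> I.G ?G'" "giso ?\<alpha> ?\<beta> I.g ?g'"
    by (simp_all add: giso_iff)
  have i: "i2' (verts G2') = i2 (verts G2)"
    using iso2 I.comps by (simp add: im)
  have j: "(if ?\<alpha> ` C \<subseteq> range Inl then j1' (Inl -` ?\<alpha> ` C) else j2' (Inr -` ?\<alpha> ` C)) = I.J C"
    if C: "C \<in> components I.g" for C
    using C
  proof (cases rule: I.components_insert)
    case (1 D)
    then have "?\<alpha> ` C = Inl ` \<alpha>1 ` D"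
      by (simp add: image_image)
    then show ?thesis
      using 1 iso1 by (simp add: sum_image_simps)
  next
    case (2 D)
    have "D \<noteq> {}"
      using components_nonempty[OF 2(1)] .
    moreover have "?\<alpha> ` C = Inr ` \<alpha>2 ` D"
      using 2 by (simp add: image_image)
    ultimately show ?thesis
      using 2 iso2 by (simp add: sum_image_simps)
  qed
  show ?thesis
    unfolding pair_insert.simps piso.simps using iso i j by blast
qed

definition sites :: "('v, 'h, 't) gpair \<Rightarrow> ('w, 'l, 't) gpair \<Rightarrow> 'w set" where
  "sites P1 P2 = {v \<in> verts (fst (fst P2)) - nontriv_verts (fst (snd P2)).
     vtype (fst (fst P2)) v = res_type (fst P1)}"

lemma odot_pairs_eq:
  "odot_pairs P1 P2 = (\<Sum>v \<in> sites P1 P2. \<Sum>\<phi> \<in> gluings (fst (fst P1)) (fst (fst P2)) v.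
     pair_vec (pair_insert P1 v \<phi> P2))"
  by (simp add: odot_pairs_def sites_def Let_def)

lemma insertionI:
  assumes "valid_pair T ((G1, i1), (g1, j1))" "valid_pair T ((G2, i2), (g2, j2))"
    "v \<in> sites ((G1, i1), (g1, j1)) ((G2, i2), (g2, j2))" "\<phi> \<in> gluings G1 G2 v"
  shows "insertion T G1 i1 g1 j1 v \<phi> G2 i2 g2 j2"
  using assms by unfold_locales (auto simp: sites_def)

lemma valid_pair_insert:
  assumes "valid_pair T P1" "valid_pair T P2" "v \<in> sites P1 P2"
    "\<phi> \<in> gluings (fst (fst P1)) (fst (fst P2)) v"
  shows "valid_pair T (pair_insert P1 v \<phi> P2)"
  using insertion.valid_insert[OF insertionI] assms by (metis prod.collapse)

lemma res_type_giso:
  assumes "wf_graph G" "components G = {verts G}" "giso \<alpha> \<beta> G G'" "i' (\<alpha> ` verts G) = i (verts G)"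
  shows "res_type (G', i') = res_type (G, i)"
proof -
  have "emb \<alpha> \<beta> G G'" "verts G' = \<alpha> ` verts G"
    using assms(3) by (auto simp: giso_def)
  then show ?thesis
    using emb_vtype_residue[OF assms(1) giso_wf[OF assms(3,1)], of \<alpha> \<beta> "verts G" i' i] assms
    by (simp add: res_type_def)
qed

text \<open>
  An isomorphism of the second factors matches the sites, and together with one of the first
  factors it matches the gluings at corresponding sites.  This makes the product of isomorphism
  classes well defined.
\<close>

lemma odot_pairs_cong:
  fixes T :: "'t qft"
  assumes val: "valid_pair T P1" "valid_pair T P2"
    and "pair_iso P1 Q1" "pair_iso P2 Q2"
  shows "odot_pairs P1 P2 = (odot_pairs Q1 Q2 :: ('t, 'k::field) pvec)"
proof -
  obtain G1 i1 g1 j1 where P1: "P1 = ((G1, i1), (g1, j1))" by (metis surj_pair)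
  obtain G2 i2 g2 j2 where P2: "P2 = ((G2, i2), (g2, j2))" by (metis surj_pair)
  obtain G1' i1' g1' j1' where Q1: "Q1 = ((G1', i1'), (g1', j1'))" by (metis surj_pair)
  obtain G2' i2' g2' j2' where Q2: "Q2 = ((G2', i2'), (g2', j2'))" by (metis surj_pair)
  obtain \<alpha>1 \<beta>1 where iso1: "piso \<alpha>1 \<beta>1 P1 Q1"
    using assms pair_iso_iff valid_pair_wf by blast
  obtain \<alpha>2 \<beta>2 where iso2: "piso \<alpha>2 \<beta>2 P2 Q2"
    using assms pair_iso_iff valid_pair_wf by blast
  have isos: "giso \<alpha>1 \<beta>1 G1 G1'" "giso \<alpha>2 \<beta>2 G2 G2'" "giso \<alpha>2 \<beta>2 g2 g2'"
    using iso1 iso2 unfolding P1 P2 Q1 Q2 by auto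
  have wf: "wf_graph G1" "wf_graph G2" "wf_graph g2" "verts g2 = verts G2"
    using valid_pair_wf[OF val(1)] valid_pair_wf[OF val(2)] unfolding P1 P2 by auto
  have "components G1 = {verts G1}"
    using one_pi_components[OF wf(1)] val(1) unfolding P1 by (simp add: connected_specified_def)
  then have res: "res_type (G1', i1') = res_type (G1, i1)"
    using res_type_giso[OF wf(1) _ isos(1)] iso1 unfolding P1 Q1 by simp
  have em: "emb \<alpha>2 \<beta>2 G2 G2'" "emb \<alpha>2 \<beta>2 g2 g2'" and im: "verts G2' = \<alpha>2 ` verts G2"
    and bij: "bij_betw \<alpha>2 (verts G2) (verts G2')"
    using isos by (auto simp: giso_def giso_iff bij_betw_def dest: embD(1))
  have "\<alpha>2 x \<in> sites Q1 Q2 \<longleftrightarrow> x \<in> sites P1 P2" if "x \<in> verts G2" for x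
    using that res emb_vtype[OF wf(2) em(1) that]
      emb_nontriv_verts[OF wf(3) giso_wf[OF isos(3) wf(3)] em(2), of x] wf(4)
    unfolding P1 P2 Q1 Q2 by (auto simp: sites_def im)
  moreover have "sites P1 P2 \<subseteq> verts G2" "sites Q1 Q2 \<subseteq> \<alpha>2 ` verts G2"
    unfolding P1 P2 Q1 Q2 by (auto simp: sites_def im)
  ultimately have bs: "bij_betw \<alpha>2 (sites P1 P2) (sites Q1 Q2)"
    by (intro bij_betw_subset[OF bij]) (auto simp: im)
  have "(\<Sum>\<phi> \<in> gluings G1 G2 v. pair_vec (pair_insert P1 v \<phi> P2)) =
      (\<Sum>\<phi> \<in> gluings G1' G2' (\<alpha>2 v). pair_vec (pair_insert Q1 (\<alpha>2 v) \<phi> Q2) :: ('t, 'k) pvec)"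
    if v: "v \<in> sites P1 P2" for v
    unfolding gluings_eq
  proof (rule sum_type_bijections)
    have vG: "v \<in> verts G2"
      using v unfolding P1 P2 by (simp add: sites_def)
    show "bij_betw \<beta>2 (star G2 v) (star G2' (\<alpha>2 v))"
      using emb_star[OF wf(2) em(1) vG] embD(2)[OF em(1)]
      by (auto simp: bij_betw_def star_def intro: inj_on_subset)
    show "bij_betw \<beta>1 (ext_edges G1) (ext_edges G1')"
    proof -
      have em1: "emb \<alpha>1 \<beta>1 G1 G1'" and "hedges G1' = \<beta>1 ` hedges G1"
        using isos(1) by (auto simp: giso_def)
      then show ?thesis
        using emb_sig_fixed[OF wf(1) em1] embD(2)[OF em1]
        by (auto simp: bij_betw_def ext_edges_def intro: inj_on_subset)
    qed
    show "htype G2' (\<beta>2 a) = htype G2 a" if "a \<in> star G2 v" for a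
      using that isos(2) by (simp add: giso_iff star_def)
    show "htype G1' (\<beta>1 a) = htype G1 a" if "a \<in> ext_edges G1" for a
      using that isos(1) by (simp add: giso_iff ext_edges_def)
    fix \<phi> \<phi>' assume \<phi>: "\<phi> \<in> type_bijections (star G2 v) (htype G2) (ext_edges G1) (htype G1)"
      and eq: "\<And>a. a \<in> star G2 v \<Longrightarrow> \<phi>' (\<beta>2 a) = \<beta>1 (\<phi> a)"
    have \<phi>': "\<phi> \<in> gluings G1 G2 v"
      using \<phi> by (simp add: gluings_eq)
    have "insertion T G1 i1 g1 j1 v \<phi> G2 i2 g2 j2"
      using val v \<phi>' unfolding P1 P2 by (rule insertionI)
    from piso_insert[OF this iso1[unfolded P1 Q1] iso2[unfolded P2 Q2] eq]
    have "piso (map_sum \<alpha>1 \<alpha>2) (map_sum \<beta>1 \<beta>2) (pair_insert P1 v \<phi> P2) (pair_insert Q1 (\<alpha>2 v) \<phi>' Q2)"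
      unfolding P1 P2 Q1 Q2 by blast
    moreover have "wf_pair (pair_insert P1 v \<phi> P2)"
      using \<phi>' by (intro valid_pair_wf[OF valid_pair_insert[OF val v]]) (simp add: P1 P2)
    ultimately show "pair_vec (pair_insert P1 v \<phi> P2) = pair_vec (pair_insert Q1 (\<alpha>2 v) \<phi>' Q2)"
      by (rule pair_vec_eq[rotated])
  qed
  then show ?thesis
    unfolding odot_pairs_eq by (subst sum.reindex_bij_betw[OF bs, symmetric]) (simp add: P1 P2 Q1 Q2 del: pair_insert.simps)
qed

section \<open>Associativity and commutativity of insertions\<close>

text \<open>
  Renamings of vertices and half-edges for iterated insertions.  Vertices and half-edges of an
  insertion are tagged in the same way, so one function serves both.
\<close>

fun assoc_sum :: "('a + 'b) + 'c \<Rightarrow> 'a + ('b + 'c)" where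
  "assoc_sum (Inl (Inl x)) = Inl x"
| "assoc_sum (Inl (Inr y)) = Inr (Inl y)"
| "assoc_sum (Inr z) = Inr (Inr z)"

fun exchange_sum :: "'a + ('b + 'c) \<Rightarrow> 'b + ('a + 'c)" where
  "exchange_sum (Inl x) = Inr (Inl x)"
| "exchange_sum (Inr (Inl y)) = Inl y"
| "exchange_sum (Inr (Inr z)) = Inr (Inr z)"

lemma inj_on_assoc_sum: "inj_on assoc_sum A"
proof (rule inj_onI)
  fix x y :: "('a + 'b) + 'c" assume "assoc_sum x = assoc_sum y"
  then show "x = y"
    by (cases x rule: assoc_sum.cases; cases y rule: assoc_sum.cases) auto
qed

lemma inj_on_exchange_sum: "inj_on exchange_sum A"
proof (rule inj_onI)
  fix x y :: "'a + ('b + 'c)" assume "exchange_sum x = exchange_sum y"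
  then show "x = y"
    by (cases x rule: exchange_sum.cases; cases y rule: exchange_sum.cases) auto
qed

text \<open>
  Inserting the first graph into the second one before or after the second is inserted into the
  third gives the same graph, provided the gluings correspond.  Once the second graph sits in the
  third, its half-edges carry the names given by \<open>insert_hedge\<close>; hence the hypothesis on
  \<open>\<phi>'\<close>.
\<close>

lemma insert_assoc:
  assumes ins12: "insertion T G1 i1 g1 j1 w \<phi> G2 i2 g2 j2"
    and ins23: "insertion T G2 i2 g2 j2 v \<psi>' G3 i3 g3 j3"
    and ins12_3: "insertion T G12 i12 g12 j12 v \<psi> G3 i3 g3 j3"
    and ins1_23: "insertion T G1 i1 g1 j1 (Inl w) \<phi>' G23 i23 g23 j23"
    and eq12: "((G12, i12), (g12, j12)) = pair_insert ((G1, i1), (g1, j1)) w \<phi> ((G2, i2), (g2, j2))"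
    and eq23: "((G23, i23), (g23, j23)) = pair_insert ((G2, i2), (g2, j2)) v \<psi>' ((G3, i3), (g3, j3))"
    and \<psi>: "\<And>e. e \<in> star G3 v \<Longrightarrow> \<psi> e = Inr (\<psi>' e)"
    and \<phi>': "\<And>e. e \<in> star G2 w \<Longrightarrow> \<phi>' (insert_hedge G2 v \<psi>' G3 e) = \<phi> e"
  shows "piso assoc_sum assoc_sum
    (pair_insert ((G12, i12), (g12, j12)) v \<psi> ((G3, i3), (g3, j3)))
    (pair_insert ((G1, i1), (g1, j1)) (Inl w) \<phi>' ((G23, i23), (g23, j23)))"
proof -
  interpret I12: insertion T G1 i1 g1 j1 w \<phi> G2 i2 g2 j2 by (rule ins12)
  interpret I23: insertion T G2 i2 g2 j2 v \<psi>' G3 i3 g3 j3 by (rule ins23)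
  interpret L: insertion T G12 i12 g12 j12 v \<psi> G3 i3 g3 j3 by (rule ins12_3)
  interpret R: insertion T G1 i1 g1 j1 "Inl w" \<phi>' G23 i23 g23 j23 by (rule ins1_23)
  have G12: "G12 = I12.G" "g12 = I12.g" "j12 = I12.J"
    and G23: "G23 = I23.G" "g23 = I23.g" "i23 = (\<lambda>_. i3 (verts G3))" "j23 = I23.J"
    using eq12 eq23 unfolding pair_insert.simps prod.inject by blast+
  let ?a = assoc_sum
  have int12: "int_hedges I12.G = Inl ` int_hedges G1 \<union> Inr ` int_hedges G2"
    by (auto simp: int_hedges_def graph_insert_def)
  have V: "?a ` verts L.G = verts R.G"
    using I12.v(1) by (force simp: G12 G23 graph_insert_def image_Un image_image)
  have H: "?a ` hedges L.G = hedges R.G"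
    unfolding L.G_simps(2) R.G_simps(2) unfolding G12(1) G23(1) int12 I23.G_simps(2)
    by (simp add: image_Un image_image Un_assoc)
  have E: "bd R.G (?a x) = ?a (bd L.G x) \<and> sig R.G (?a x) = ?a (sig L.G x) \<and>
      sig R.g (?a x) = ?a (sig L.g x) \<and> htype R.G (?a x) = htype L.G x" if x: "x \<in> hedges L.G" for x
  proof -
    consider e where "x = Inl (Inl e)" "e \<in> int_hedges G1"
      | e where "x = Inl (Inr e)" "e \<in> int_hedges G2" | f where "x = Inr f" "f \<in> hedges G3"
      using x unfolding L.G_simps(2) unfolding G12(1) int12 by auto
    then show ?thesis
    proof cases
      case 1
      then show ?thesis
        by (simp add: G12 G23 graph_insert_def)
    next
      case 2
      have "\<phi>' (Inl e) = \<phi> e" if "bd G2 e = w"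
        using \<phi>'[of e] that 2 by (simp add: insert_hedge_def star_def int_hedges_def)
      then show ?thesis
        using 2 by (auto simp: G12 G23 graph_insert_def)
    next
      case 3
      \<comment> \<open>A half-edge of the third graph that ends up, through both gluings, in the first graph.\<close>
      have "\<phi>' (Inr f) = \<phi> (\<psi>' f)" if "bd G2 (\<psi>' f) = w" "bd G3 f = v"
        using \<phi>'[of "\<psi>' f"] that 3 I23.\<eta>_\<phi>[of f] I23.\<phi>_ext[of f] by (simp add: star_def ext_edges_def)
      then show ?thesis
        using 3 \<psi>[of f] by (auto simp: G12 G23 graph_insert_def star_def)
    qed
  qed
  have "vindex R.G (?a x) = vindex L.G x" if "x \<in> verts L.G" for x
    by (cases x rule: assoc_sum.cases) (auto simp: G12 G23 graph_insert_def)
  then have iso: "giso ?a ?a L.G R.G" "giso ?a ?a L.g R.g"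
    using V H E by (auto simp: giso_iff bij_betw_def inj_on_assoc_sum)
  have j: "R.J (?a ` C) = L.J C" if C: "C \<in> components L.g" for C
  proof -
    have ne: "C \<noteq> {}"
      using components_nonempty[OF C] .
    from C consider D where "C = Inl ` Inl ` D" | D where "C = Inl ` Inr ` D" | D where "C = Inr ` D"
    proof (cases rule: L.components_insert)
      case (1 D)
      from 1(1)[unfolded G12] show ?thesis
        by (cases rule: I12.components_insert) (use 1 that in auto)
    qed (use that in blast)
    then show ?thesis
    proof cases
      case 1
      then have "?a ` C = Inl ` D"
        by (simp add: image_image)
      then show ?thesis
        using 1 by (simp add: G12 sum_image_simps)
    next
      case 2
      then have "?a ` C = Inr ` Inl ` D"
        by (simp add: image_image)
      then show ?thesis
        using 2 ne by (simp add: G12 G23 sum_image_simps)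
    next
      case 3
      then have "?a ` C = Inr ` Inr ` D"
        by (simp add: image_image)
      then show ?thesis
        using 3 ne by (simp add: G23 sum_image_simps)
    qed
  qed
  show ?thesis
    unfolding pair_insert.simps piso.simps using iso j by (simp add: G23)
qed

text \<open>
  The two insertions reattach disjoint sets of half-edges of the third graph, those at \<open>u\<close> and
  those at \<open>v\<close>, and do not interfere.
\<close>

lemma insert_exchange:
  assumes ins23: "insertion T G2 i2 g2 j2 v \<psi> G3 i3 g3 j3"
    and ins13: "insertion T G1 i1 g1 j1 u \<phi>' G3 i3 g3 j3"
    and ins1_23: "insertion T G1 i1 g1 j1 (Inr u) \<phi> G23 i23 g23 j23"
    and ins2_13: "insertion T G2 i2 g2 j2 (Inr v) \<psi>' G13 i13 g13 j13"
    and eq23: "((G23, i23), (g23, j23)) = pair_insert ((G2, i2), (g2, j2)) v \<psi> ((G3, i3), (g3, j3))"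
    and eq13: "((G13, i13), (g13, j13)) = pair_insert ((G1, i1), (g1, j1)) u \<phi>' ((G3, i3), (g3, j3))"
    and uv: "u \<noteq> v"
    and \<phi>: "\<And>e. e \<in> star G3 u \<Longrightarrow> \<phi> (Inr e) = \<phi>' e"
    and \<psi>': "\<And>e. e \<in> star G3 v \<Longrightarrow> \<psi>' (Inr e) = \<psi> e"
  shows "piso exchange_sum exchange_sum
    (pair_insert ((G1, i1), (g1, j1)) (Inr u) \<phi> ((G23, i23), (g23, j23)))
    (pair_insert ((G2, i2), (g2, j2)) (Inr v) \<psi>' ((G13, i13), (g13, j13)))"
proof -
  interpret I23: insertion T G2 i2 g2 j2 v \<psi> G3 i3 g3 j3 by (rule ins23)
  interpret I13: insertion T G1 i1 g1 j1 u \<phi>' G3 i3 g3 j3 by (rule ins13)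
  interpret L: insertion T G1 i1 g1 j1 "Inr u" \<phi> G23 i23 g23 j23 by (rule ins1_23)
  interpret R: insertion T G2 i2 g2 j2 "Inr v" \<psi>' G13 i13 g13 j13 by (rule ins2_13)
  have G23: "G23 = I23.G" "g23 = I23.g" "i23 = (\<lambda>_. i3 (verts G3))" "j23 = I23.J"
    and G13: "G13 = I13.G" "g13 = I13.g" "i13 = (\<lambda>_. i3 (verts G3))" "j13 = I13.J"
    using eq23 eq13 unfolding pair_insert.simps prod.inject by blast+
  let ?a = exchange_sum
  have V: "?a ` verts L.G = verts R.G"
    using uv by (force simp: G13 G23 graph_insert_def image_Un image_image)
  have H: "?a ` hedges L.G = hedges R.G"
    unfolding L.G_simps(2) R.G_simps(2) unfolding G13(1) G23(1) I13.G_simps(2) I23.G_simps(2)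
    by (simp add: image_Un image_image Un_ac)
  have E: "bd R.G (?a x) = ?a (bd L.G x) \<and> sig R.G (?a x) = ?a (sig L.G x) \<and>
      sig R.g (?a x) = ?a (sig L.g x) \<and> htype R.G (?a x) = htype L.G x" if x: "x \<in> hedges L.G" for x
  proof -
    consider e where "x = Inl e" | e where "x = Inr (Inl e)" | f where "x = Inr (Inr f)" "f \<in> hedges G3"
      using x unfolding L.G_simps(2) unfolding G23(1) I23.G_simps(2) by auto
    then show ?thesis
    proof cases
      case 3
      then show ?thesis
        using uv \<phi>[of f] \<psi>'[of f] by (auto simp: G13 G23 graph_insert_def star_def)
    qed (auto simp: G13 G23 graph_insert_def)
  qed
  have "vindex R.G (?a x) = vindex L.G x" if "x \<in> verts L.G" for x
    by (cases x rule: exchange_sum.cases) (auto simp: G13 G23 graph_insert_def)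
  then have iso: "giso ?a ?a L.G R.G" "giso ?a ?a L.g R.g"
    using V H E by (auto simp: giso_iff bij_betw_def inj_on_exchange_sum)
  have j: "R.J (?a ` C) = L.J C" if C: "C \<in> components L.g" for C
  proof -
    have ne: "C \<noteq> {}"
      using components_nonempty[OF C] .
    from C consider D where "C = Inl ` D" | D where "C = Inr ` Inl ` D" | D where "C = Inr ` Inr ` D"
    proof (cases rule: L.components_insert)
      case (2 D)
      from 2(1)[unfolded G23] show ?thesis
        by (cases rule: I23.components_insert) (use 2 that in auto)
    qed (use that in blast)
    then show ?thesis
    proof cases
      case 1
      then have "?a ` C = Inr ` Inl ` D"
        by (simp add: image_image)
      then show ?thesis
        using 1 ne by (simp add: G13 sum_image_simps)
    next
      case 2
      then have "?a ` C = Inl ` D"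
        by (simp add: image_image)
      then show ?thesis
        using 2 ne by (simp add: G23 sum_image_simps)
    next
      case 3
      then have "?a ` C = Inr ` Inr ` D"
        by (simp add: image_image)
      then show ?thesis
        using 3 ne by (simp add: G13 G23 sum_image_simps)
    qed
  qed
  show ?thesis
    unfolding pair_insert.simps piso.simps using iso j by (simp add: G23 G13)
qed

section \<open>Sums over iterated insertions\<close>

declare valid_pair.simps [simp del]

abbreviation pair_gluings :: "('v, 'h, 't) gpair \<Rightarrow> ('w, 'l, 't) gpair \<Rightarrow> 'w \<Rightarrow> ('l \<Rightarrow> 'h) set" where
  "pair_gluings P1 P2 v \<equiv> gluings (fst (fst P1)) (fst (fst P2)) v"

lemma sites_insert_left:
  assumes "valid_pair T P1" "valid_pair T P2" "w \<in> sites P1 P2" "\<phi> \<in> pair_gluings P1 P2 w"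
  shows "sites (pair_insert P1 w \<phi> P2) P3 = sites P2 P3"
proof -
  obtain G1 i1 g1 j1 where P1: "P1 = ((G1, i1), (g1, j1))" by (metis surj_pair)
  obtain G2 i2 g2 j2 where P2: "P2 = ((G2, i2), (g2, j2))" by (metis surj_pair)
  interpret insertion T G1 i1 g1 j1 w \<phi> G2 i2 g2 j2
    using assms unfolding P1 P2 by (intro insertionI) auto
  show ?thesis
    using res_type_insert unfolding P1 P2 sites_def pair_insert.simps fst_conv by simp
qed

text \<open>
  The subgraphs being disjoint, a vertex of an insertion is bare and of a given type if and only
  if it was so in the graph where it comes from.
\<close>

lemma sites_insert_right:
  assumes "valid_pair T P2" "valid_pair T P3" "v \<in> sites P2 P3" "\<psi> \<in> pair_gluings P2 P3 v"
  shows "sites P1 (pair_insert P2 v \<psi> P3) = Inl ` sites P1 P2 \<union> Inr ` (sites P1 P3 - {v})"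
proof -
  obtain G2 i2 g2 j2 where P2: "P2 = ((G2, i2), (g2, j2))" by (metis surj_pair)
  obtain G3 i3 g3 j3 where P3: "P3 = ((G3, i3), (g3, j3))" by (metis surj_pair)
  interpret insertion T G2 i2 g2 j2 v \<psi> G3 i3 g3 j3
    using assms unfolding P2 P3 by (intro insertionI) auto
  have "x \<in> sites P1 (pair_insert P2 v \<psi> P3) \<longleftrightarrow>
      x \<in> Inl ` sites P1 P2 \<union> Inr ` (sites P1 P3 - {v})" for x
  proof (cases x)
    case (Inl y)
    have "Inl y \<in> sites P1 (pair_insert P2 v \<psi> P3) \<longleftrightarrow> y \<in> verts G2 \<and>
        Inl y \<notin> nontriv_verts g \<and> vtype G (Inl y) = res_type (fst P1)"
      unfolding P2 P3 sites_def pair_insert.simps fst_conv snd_conv by (auto simp: G_simps)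
    then show ?thesis
      using nontriv_Inl[of y] vtype_Inl[of y] unfolding Inl P2 P3 sites_def by auto
  next
    case (Inr y)
    have "Inr y \<in> sites P1 (pair_insert P2 v \<psi> P3) \<longleftrightarrow> y \<in> verts G3 \<and> y \<noteq> v \<and>
        Inr y \<notin> nontriv_verts g \<and> vtype G (Inr y) = res_type (fst P1)"
      unfolding P2 P3 sites_def pair_insert.simps fst_conv snd_conv by (auto simp: G_simps)
    then show ?thesis
      using nontriv_Inr[of y] vtype_Inr[of y] unfolding Inr P2 P3 sites_def by auto
  qed
  then show ?thesis
    by blast
qed

lemma finite_sites:
  assumes "valid_pair T P2"
  shows "finite (sites P1 P2)"
proof -
  have "finite (verts (fst (fst P2)))"
    using valid_pair_wf[OF assms] by (cases P2 rule: wf_pair.cases) (auto simp: wf_graph_def)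
  then show ?thesis
    by (simp add: sites_def)
qed

lemma pair_vec_insert_assoc:
  assumes val: "valid_pair T P1" "valid_pair T P2" "valid_pair T P3"
    and w: "w \<in> sites P1 P2" and v: "v \<in> sites P2 P3"
    and \<phi>: "\<phi> \<in> pair_gluings P1 P2 w" and \<psi>': "\<psi>' \<in> pair_gluings P2 P3 v"
    and \<psi>: "\<psi> \<in> pair_gluings (pair_insert P1 w \<phi> P2) P3 v"
    and \<phi>': "\<phi>' \<in> pair_gluings P1 (pair_insert P2 v \<psi>' P3) (Inl w)"
    and eq: "\<And>e. e \<in> star (fst (fst P3)) v \<Longrightarrow> \<psi> e = Inr (\<psi>' e)"
      "\<And>e. e \<in> star (fst (fst P2)) w \<Longrightarrow>
        \<phi>' (insert_hedge (fst (fst P2)) v \<psi>' (fst (fst P3)) e) = \<phi> e"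
  shows "pair_vec (pair_insert (pair_insert P1 w \<phi> P2) v \<psi> P3) =
    pair_vec (pair_insert P1 (Inl w) \<phi>' (pair_insert P2 v \<psi>' P3))"
proof -
  let ?P12 = "pair_insert P1 w \<phi> P2" and ?P23 = "pair_insert P2 v \<psi>' P3"
  obtain G1 i1 g1 j1 where P1: "P1 = ((G1, i1), (g1, j1))" by (metis surj_pair)
  obtain G2 i2 g2 j2 where P2: "P2 = ((G2, i2), (g2, j2))" by (metis surj_pair)
  obtain G3 i3 g3 j3 where P3: "P3 = ((G3, i3), (g3, j3))" by (metis surj_pair)
  obtain G12 i12 g12 j12 where P12: "?P12 = ((G12, i12), (g12, j12))" by (metis surj_pair)
  obtain G23 i23 g23 j23 where P23: "?P23 = ((G23, i23), (g23, j23))" by (metis surj_pair)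
  have val': "valid_pair T ?P12" "valid_pair T ?P23"
    by (rule valid_pair_insert[OF val(1,2) w \<phi>]) (rule valid_pair_insert[OF val(2,3) v \<psi>'])
  have v': "v \<in> sites ?P12 P3" and w': "Inl w \<in> sites P1 ?P23"
    using v w
    by (simp_all add: sites_insert_left[OF val(1,2) w \<phi>] sites_insert_right[OF val(2,3) v \<psi>'])
  have "piso assoc_sum assoc_sum (pair_insert ?P12 v \<psi> P3) (pair_insert P1 (Inl w) \<phi>' ?P23)"
    unfolding P12 P23 unfolding P1 P3
  proof (rule insert_assoc)
    show "insertion T G1 i1 g1 j1 w \<phi> G2 i2 g2 j2"
      using val(1,2) w \<phi> unfolding P1 P2 by (intro insertionI) auto
    show "insertion T G2 i2 g2 j2 v \<psi>' G3 i3 g3 j3"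
      using val(2,3) v \<psi>' unfolding P2 P3 by (intro insertionI) auto
    show "insertion T G12 i12 g12 j12 v \<psi> G3 i3 g3 j3"
      using val'(1) val(3) v' \<psi> unfolding P12 P3 by (intro insertionI) auto
    show "insertion T G1 i1 g1 j1 (Inl w) \<phi>' G23 i23 g23 j23"
      using val(1) val'(2) w' \<phi>' unfolding P1 P23 by (intro insertionI) auto
    show "((G12, i12), (g12, j12)) = pair_insert ((G1, i1), (g1, j1)) w \<phi> ((G2, i2), (g2, j2))"
      using P12 unfolding P1 P2 by (rule sym)
    show "((G23, i23), (g23, j23)) = pair_insert ((G2, i2), (g2, j2)) v \<psi>' ((G3, i3), (g3, j3))"
      using P23 unfolding P2 P3 by (rule sym)
  qed (use eq in \<open>simp_all add: P2 P3\<close>)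
  moreover have "wf_pair (pair_insert ?P12 v \<psi> P3)"
    using valid_pair_wf[OF valid_pair_insert[OF val'(1) val(3) v' \<psi>]] .
  ultimately show ?thesis
    by (rule pair_vec_eq[rotated])
qed

lemma pair_vec_insert_exchange:
  assumes val: "valid_pair T P1" "valid_pair T P2" "valid_pair T P3"
    and v: "v \<in> sites P2 P3" and u: "u \<in> sites P1 P3" and uv: "u \<noteq> v"
    and \<psi>: "\<psi> \<in> pair_gluings P2 P3 v" and \<phi>': "\<phi>' \<in> pair_gluings P1 P3 u"
    and \<phi>: "\<phi> \<in> pair_gluings P1 (pair_insert P2 v \<psi> P3) (Inr u)"
    and \<psi>': "\<psi>' \<in> pair_gluings P2 (pair_insert P1 u \<phi>' P3) (Inr v)"
    and eq: "\<And>e. e \<in> star (fst (fst P3)) u \<Longrightarrow> \<phi> (Inr e) = \<phi>' e"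
      "\<And>e. e \<in> star (fst (fst P3)) v \<Longrightarrow> \<psi>' (Inr e) = \<psi> e"
  shows "pair_vec (pair_insert P1 (Inr u) \<phi> (pair_insert P2 v \<psi> P3)) =
    pair_vec (pair_insert P2 (Inr v) \<psi>' (pair_insert P1 u \<phi>' P3))"
proof -
  let ?P23 = "pair_insert P2 v \<psi> P3" and ?P13 = "pair_insert P1 u \<phi>' P3"
  obtain G1 i1 g1 j1 where P1: "P1 = ((G1, i1), (g1, j1))" by (metis surj_pair)
  obtain G2 i2 g2 j2 where P2: "P2 = ((G2, i2), (g2, j2))" by (metis surj_pair)
  obtain G3 i3 g3 j3 where P3: "P3 = ((G3, i3), (g3, j3))" by (metis surj_pair)
  obtain G23 i23 g23 j23 where P23: "?P23 = ((G23, i23), (g23, j23))" by (metis surj_pair)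
  obtain G13 i13 g13 j13 where P13: "?P13 = ((G13, i13), (g13, j13))" by (metis surj_pair)
  have val': "valid_pair T ?P23" "valid_pair T ?P13"
    by (rule valid_pair_insert[OF val(2,3) v \<psi>]) (rule valid_pair_insert[OF val(1,3) u \<phi>'])
  have u': "Inr u \<in> sites P1 ?P23" and v': "Inr v \<in> sites P2 ?P13"
    using u v uv
    by (simp_all add: sites_insert_right[OF val(2,3) v \<psi>] sites_insert_right[OF val(1,3) u \<phi>'])
  have "piso exchange_sum exchange_sum
      (pair_insert P1 (Inr u) \<phi> ?P23) (pair_insert P2 (Inr v) \<psi>' ?P13)"
    unfolding P13 P23 unfolding P1 P2
  proof (rule insert_exchange)
    show "insertion T G2 i2 g2 j2 v \<psi> G3 i3 g3 j3"
      using val(2,3) v \<psi> unfolding P2 P3 by (intro insertionI) auto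
    show "insertion T G1 i1 g1 j1 u \<phi>' G3 i3 g3 j3"
      using val(1,3) u \<phi>' unfolding P1 P3 by (intro insertionI) auto
    show "insertion T G1 i1 g1 j1 (Inr u) \<phi> G23 i23 g23 j23"
      using val(1) val'(1) u' \<phi> unfolding P1 P23 by (intro insertionI) auto
    show "insertion T G2 i2 g2 j2 (Inr v) \<psi>' G13 i13 g13 j13"
      using val(2) val'(2) v' \<psi>' unfolding P2 P13 by (intro insertionI) auto
    show "((G23, i23), (g23, j23)) = pair_insert ((G2, i2), (g2, j2)) v \<psi> ((G3, i3), (g3, j3))"
      using P23 unfolding P2 P3 by (rule sym)
    show "((G13, i13), (g13, j13)) = pair_insert ((G1, i1), (g1, j1)) u \<phi>' ((G3, i3), (g3, j3))"
      using P13 unfolding P1 P3 by (rule sym)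
  qed (use eq uv in \<open>simp_all add: P3\<close>)
  moreover have "wf_pair (pair_insert P1 (Inr u) \<phi> ?P23)"
    using valid_pair_wf[OF valid_pair_insert[OF val(1) val'(1) u' \<phi>]] .
  ultimately show ?thesis
    by (rule pair_vec_eq[rotated])
qed

text \<open>
  The set of gluings of \<open>P1 \<triangleright> P2\<close> into \<open>P3\<close> does not depend on \<open>\<phi>\<close>.  This is what permits to
  interchange the two sums over gluings.
\<close>

lemma gluings_insert_left:
  assumes "valid_pair T P1" "valid_pair T P2" "w \<in> sites P1 P2" "\<phi> \<in> pair_gluings P1 P2 w"
  shows "pair_gluings (pair_insert P1 w \<phi> P2) P3 v =
    type_bijections (star (fst (fst P3)) v) (htype (fst (fst P3)))
      (Inr ` ext_edges (fst (fst P2))) (case_sum (htype (fst (fst P1))) (htype (fst (fst P2))))"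
proof -
  obtain G1 i1 g1 j1 where P1: "P1 = ((G1, i1), (g1, j1))" by (metis surj_pair)
  obtain G2 i2 g2 j2 where P2: "P2 = ((G2, i2), (g2, j2))" by (metis surj_pair)
  interpret insertion T G1 i1 g1 j1 w \<phi> G2 i2 g2 j2
    using assms unfolding P1 P2 by (intro insertionI) auto
  have "htype G = case_sum (htype G1) (htype G2)"
    by (simp add: graph_insert_def)
  then show ?thesis
    unfolding P1 P2 gluings_eq using ext_insert by simp
qed

lemma gluings_insert_Inl:
  assumes "valid_pair T P2" "valid_pair T P3" "v \<in> sites P2 P3" "\<psi> \<in> pair_gluings P2 P3 v"
    and w: "w \<in> verts (fst (fst P2))"
  defines "\<eta> \<equiv> insert_hedge (fst (fst P2)) v \<psi> (fst (fst P3))"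
    and "K \<equiv> fst (fst (pair_insert P2 v \<psi> P3))"
  shows "bij_betw \<eta> (star (fst (fst P2)) w) (star K (Inl w))"
    and "e \<in> star (fst (fst P2)) w \<Longrightarrow> htype K (\<eta> e) = htype (fst (fst P2)) e"
proof -
  obtain G2 i2 g2 j2 where P2: "P2 = ((G2, i2), (g2, j2))" by (metis surj_pair)
  obtain G3 i3 g3 j3 where P3: "P3 = ((G3, i3), (g3, j3))" by (metis surj_pair)
  interpret insertion T G2 i2 g2 j2 v \<psi> G3 i3 g3 j3
    using assms unfolding P2 P3 by (intro insertionI) auto
  have defs: "\<eta> = insert_hedge G2 v \<psi> G3" "K = G"
    unfolding \<eta>_def K_def P2 P3 by auto
  show "bij_betw \<eta> (star (fst (fst P2)) w) (star K (Inl w))"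
    unfolding defs bij_betw_def using star_Inl[of w] w embD(2)[OF emb1] cov1(3)
    by (auto simp: P2 star_def intro: inj_on_subset)
  show "htype K (\<eta> e) = htype (fst (fst P2)) e" if "e \<in> star (fst (fst P2)) w"
    using that embD(9)[OF emb1, of e] cov1(3) cov1(6)[of e] unfolding defs
    by (simp add: P2 star_def)
qed

lemma sum_insert_assoc:
  fixes T :: "'t qft"
  assumes val: "valid_pair T P1" "valid_pair T P2" "valid_pair T P3"
    and w: "w \<in> sites P1 P2" and v: "v \<in> sites P2 P3"
  shows "(\<Sum>\<phi> \<in> pair_gluings P1 P2 w. \<Sum>\<psi> \<in> pair_gluings (pair_insert P1 w \<phi> P2) P3 v.
      pair_vec (pair_insert (pair_insert P1 w \<phi> P2) v \<psi> P3)) =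
    (\<Sum>\<psi> \<in> pair_gluings P2 P3 v. \<Sum>\<phi> \<in> pair_gluings P1 (pair_insert P2 v \<psi> P3) (Inl w).
      pair_vec (pair_insert P1 (Inl w) \<phi> (pair_insert P2 v \<psi> P3)) :: ('t, 'k::field) pvec)"
    (is "(\<Sum>\<phi> \<in> _. \<Sum>\<psi> \<in> _. ?L \<phi> \<psi>) = (\<Sum>\<psi> \<in> _. ?R \<psi>)")
proof -
  let ?G1 = "fst (fst P1)" and ?G2 = "fst (fst P2)" and ?G3 = "fst (fst P3)"
  let ?B = "type_bijections (star ?G3 v) (htype ?G3) (Inr ` ext_edges ?G2)
    (case_sum (htype ?G1) (htype ?G2))"
  have "(\<Sum>\<phi> \<in> pair_gluings P1 P2 w. \<Sum>\<psi> \<in> pair_gluings (pair_insert P1 w \<phi> P2) P3 v. ?L \<phi> \<psi>) =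
      (\<Sum>\<phi> \<in> pair_gluings P1 P2 w. \<Sum>\<psi> \<in> ?B. ?L \<phi> \<psi>)"
    by (intro sum.cong[OF refl] sum.cong[OF _ refl] gluings_insert_left[OF val(1,2) w])
  also have "\<dots> = (\<Sum>\<psi> \<in> ?B. \<Sum>\<phi> \<in> pair_gluings P1 P2 w. ?L \<phi> \<psi>)"
    by (rule sum.swap)
  also have "\<dots> = (\<Sum>\<psi> \<in> pair_gluings P2 P3 v. ?R \<psi>)"
    unfolding gluings_eq[of ?G2 ?G3]
  proof (rule sum_type_bijections[symmetric, where b = "\<lambda>e. e" and c = Inr])
    fix \<psi>' \<psi>
    assume \<psi>': "\<psi>' \<in> type_bijections (star ?G3 v) (htype ?G3) (ext_edges ?G2) (htype ?G2)"
      and \<psi>: "\<psi> \<in> ?B" and eq\<psi>: "\<And>e. e \<in> star ?G3 v \<Longrightarrow> \<psi> e = Inr (\<psi>' e)"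
    have \<psi>'_gl: "\<psi>' \<in> pair_gluings P2 P3 v"
      using \<psi>' by (simp add: gluings_eq)
    have wG: "w \<in> verts ?G2"
      using w by (simp add: sites_def)
    note \<eta> = gluings_insert_Inl[OF val(2,3) v \<psi>'_gl wG]
    show "?R \<psi>' = (\<Sum>\<phi> \<in> pair_gluings P1 P2 w. ?L \<phi> \<psi>)"
      unfolding gluings_eq
    proof (rule sum_type_bijections[symmetric, where c = "\<lambda>e. e", OF \<eta>(1)])
      fix \<phi> \<phi>'
      assume "\<phi> \<in> type_bijections (star ?G2 w) (htype ?G2) (ext_edges ?G1) (htype ?G1)"
        and "\<phi>' \<in> type_bijections (star (fst (fst (pair_insert P2 v \<psi>' P3))) (Inl w))
          (htype (fst (fst (pair_insert P2 v \<psi>' P3)))) (ext_edges ?G1) (htype ?G1)"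
        and eq\<phi>: "\<And>e. e \<in> star ?G2 w \<Longrightarrow> \<phi>' (insert_hedge ?G2 v \<psi>' ?G3 e) = \<phi> e"
      then have gl: "\<phi> \<in> pair_gluings P1 P2 w" "\<phi>' \<in> pair_gluings P1 (pair_insert P2 v \<psi>' P3) (Inl w)"
        by (simp_all add: gluings_eq)
      have "\<psi> \<in> pair_gluings (pair_insert P1 w \<phi> P2) P3 v"
        using \<psi> by (simp only: gluings_insert_left[OF val(1,2) w gl(1)])
      then show "?L \<phi> \<psi> = pair_vec (pair_insert P1 (Inl w) \<phi>' (pair_insert P2 v \<psi>' P3))"
        using pair_vec_insert_assoc[OF val w v gl(1) \<psi>'_gl _ gl(2) eq\<psi> eq\<phi>] by blast
    qed (simp_all add: \<eta>(2) bij_betw_def)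
  qed (auto simp: bij_betw_def)
  finally show ?thesis .
qed

text \<open>
  At the other vertices gluings are independent of \<open>\<psi>\<close>, so sums can be interchanged here too.
\<close>

lemma gluings_insert_Inr:
  assumes "valid_pair T P2" "valid_pair T P3" "v \<in> sites P2 P3" "\<psi> \<in> pair_gluings P2 P3 v" "u \<noteq> v"
  shows "pair_gluings P1 (pair_insert P2 v \<psi> P3) (Inr u) =
    type_bijections (Inr ` star (fst (fst P3)) u)
      (case_sum (htype (fst (fst P2))) (htype (fst (fst P3))))
      (ext_edges (fst (fst P1))) (htype (fst (fst P1)))"
proof -
  obtain G2 i2 g2 j2 where P2: "P2 = ((G2, i2), (g2, j2))" by (metis surj_pair)
  obtain G3 i3 g3 j3 where P3: "P3 = ((G3, i3), (g3, j3))" by (metis surj_pair)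
  interpret insertion T G2 i2 g2 j2 v \<psi> G3 i3 g3 j3
    using assms unfolding P2 P3 by (intro insertionI) auto
  have "htype G = case_sum (htype G2) (htype G3)"
    by (simp add: graph_insert_def)
  then show ?thesis
    unfolding P2 P3 gluings_eq using star_Inr[OF assms(5)] by simp
qed

lemma sum_insert_exchange:
  fixes T :: "'t qft"
  assumes val: "valid_pair T P1" "valid_pair T P2" "valid_pair T P3"
    and v: "v \<in> sites P2 P3" and u: "u \<in> sites P1 P3" and uv: "u \<noteq> v"
  shows "(\<Sum>\<psi> \<in> pair_gluings P2 P3 v. \<Sum>\<phi> \<in> pair_gluings P1 (pair_insert P2 v \<psi> P3) (Inr u).
      pair_vec (pair_insert P1 (Inr u) \<phi> (pair_insert P2 v \<psi> P3))) =
    (\<Sum>\<phi> \<in> pair_gluings P1 P3 u. \<Sum>\<psi> \<in> pair_gluings P2 (pair_insert P1 u \<phi> P3) (Inr v).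
      pair_vec (pair_insert P2 (Inr v) \<psi> (pair_insert P1 u \<phi> P3)) :: ('t, 'k::field) pvec)"
    (is "(\<Sum>\<psi> \<in> _. \<Sum>\<phi> \<in> _. ?L \<psi> \<phi>) = (\<Sum>\<phi> \<in> _. \<Sum>\<psi> \<in> _. ?R \<phi> \<psi>)")
proof -
  let ?G1 = "fst (fst P1)" and ?G2 = "fst (fst P2)" and ?G3 = "fst (fst P3)"
  let ?B = "type_bijections (Inr ` star ?G3 u) (case_sum (htype ?G2) (htype ?G3))
    (ext_edges ?G1) (htype ?G1)"
  have "(\<Sum>\<psi> \<in> pair_gluings P2 P3 v. \<Sum>\<phi> \<in> pair_gluings P1 (pair_insert P2 v \<psi> P3) (Inr u). ?L \<psi> \<phi>) =
      (\<Sum>\<psi> \<in> pair_gluings P2 P3 v. \<Sum>\<phi> \<in> ?B. ?L \<psi> \<phi>)"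
    by (intro sum.cong[OF refl] sum.cong[OF _ refl] gluings_insert_Inr[OF val(2,3) v _ uv])
  also have "\<dots> = (\<Sum>\<phi> \<in> ?B. \<Sum>\<psi> \<in> pair_gluings P2 P3 v. ?L \<psi> \<phi>)"
    by (rule sum.swap)
  also have "\<dots> = (\<Sum>\<phi> \<in> pair_gluings P1 P3 u. \<Sum>\<psi> \<in> pair_gluings P2 (pair_insert P1 u \<phi> P3) (Inr v). ?R \<phi> \<psi>)"
    unfolding gluings_eq[of ?G1 ?G3]
  proof (rule sum_type_bijections[symmetric, where b = Inr and c = "\<lambda>e. e"])
    fix \<phi>' \<phi>
    assume \<phi>': "\<phi>' \<in> type_bijections (star ?G3 u) (htype ?G3) (ext_edges ?G1) (htype ?G1)"
      and \<phi>: "\<phi> \<in> ?B" and eq\<phi>: "\<And>e. e \<in> star ?G3 u \<Longrightarrow> \<phi> (Inr e) = \<phi>' e"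
    have \<phi>'_gl: "\<phi>' \<in> pair_gluings P1 P3 u"
      using \<phi>' by (simp add: gluings_eq)
    note gl_R = gluings_insert_Inr[OF val(1,3) u \<phi>'_gl uv[symmetric]]
    show "(\<Sum>\<psi> \<in> pair_gluings P2 (pair_insert P1 u \<phi>' P3) (Inr v). ?R \<phi>' \<psi>) =
        (\<Sum>\<psi> \<in> pair_gluings P2 P3 v. ?L \<psi> \<phi>)"
      unfolding gl_R unfolding gluings_eq
    proof (rule sum_type_bijections[symmetric, where b = Inr and c = "\<lambda>e. e"])
      fix \<psi> \<psi>'
      assume "\<psi> \<in> type_bijections (star ?G3 v) (htype ?G3) (ext_edges ?G2) (htype ?G2)"
        and "\<psi>' \<in> type_bijections (Inr ` star ?G3 v) (case_sum (htype ?G1) (htype ?G3))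
          (ext_edges ?G2) (htype ?G2)"
        and eq\<psi>: "\<And>e. e \<in> star ?G3 v \<Longrightarrow> \<psi>' (Inr e) = \<psi> e"
      then have gl: "\<psi> \<in> pair_gluings P2 P3 v" "\<psi>' \<in> pair_gluings P2 (pair_insert P1 u \<phi>' P3) (Inr v)"
        unfolding gl_R unfolding gluings_eq by blast+
      have "\<phi> \<in> pair_gluings P1 (pair_insert P2 v \<psi> P3) (Inr u)"
        using \<phi> by (simp only: gluings_insert_Inr[OF val(2,3) v gl(1) uv])
      then show "?L \<psi> \<phi> = ?R \<phi>' \<psi>'"
        using pair_vec_insert_exchange[OF val v u uv gl(1) \<phi>'_gl _ gl(2) eq\<phi> eq\<psi>] by blast
    qed (auto simp: bij_betw_def)
  qed (auto simp: bij_betw_def)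
  finally show ?thesis .
qed

section \<open>The bilinear product\<close>

lemma lookup_pm_scale: "Poly_Mapping.lookup (pm_scale a x) c = a * Poly_Mapping.lookup x c"
  by (simp add: pm_scale_def Poly_Mapping.map.rep_eq when_def)

lemma vector_space_pm_scale: "vector_space (pm_scale :: 'k::field \<Rightarrow> ('a \<Rightarrow>\<^sub>0 'k) \<Rightarrow> ('a \<Rightarrow>\<^sub>0 'k))"
  by unfold_locales
    (auto intro!: poly_mapping_eqI simp: lookup_pm_scale lookup_add algebra_simps)

interpretation pm: vector_space "pm_scale :: 'k::field \<Rightarrow> ('a \<Rightarrow>\<^sub>0 'k) \<Rightarrow> ('a \<Rightarrow>\<^sub>0 'k)"
  by (rule vector_space_pm_scale)

text \<open>
  Classes with coefficient zero contribute nothing.  The linearity laws follow by summing over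
  one set of classes that contains the keys of all vectors involved.
\<close>

lemma odot_eq_sum:
  assumes "finite A" "Poly_Mapping.keys x \<subseteq> A" "finite B" "Poly_Mapping.keys y \<subseteq> B"
  shows "odot x y = (\<Sum>c \<in> A. \<Sum>d \<in> B.
    pm_scale (Poly_Mapping.lookup x c * Poly_Mapping.lookup y d)
      (odot_pairs (SOME P. P \<in> c) (SOME Q. Q \<in> d)))"
proof -
  let ?t = "\<lambda>c d. pm_scale (Poly_Mapping.lookup x c * Poly_Mapping.lookup y d)
      (odot_pairs (SOME P. P \<in> c) (SOME Q. Q \<in> d))"
  have "odot x y = (\<Sum>c \<in> Poly_Mapping.keys x. \<Sum>d \<in> B. ?t c d)"
    unfolding odot_def using assms(3,4)
    by (intro sum.cong sum.mono_neutral_left) (auto simp: in_keys_iff)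
  also have "\<dots> = (\<Sum>c \<in> A. \<Sum>d \<in> B. ?t c d)"
    using assms(1,2) by (intro sum.mono_neutral_left) (auto simp: in_keys_iff)
  finally show ?thesis .
qed

lemma odot_add_left: "odot (x + y) z = odot x z + odot y z"
proof -
  let ?A = "Poly_Mapping.keys x \<union> Poly_Mapping.keys y"
  have "Poly_Mapping.keys (x + y) \<subseteq> ?A"
    by (rule Poly_Mapping.keys_add)
  then show ?thesis
    using odot_eq_sum[of ?A _ "Poly_Mapping.keys z" z]
    by (simp add: lookup_add distrib_right pm.scale_left_distrib sum.distrib)
qed

lemma odot_add_right: "odot z (x + y) = odot z x + odot z y"
proof -
  let ?A = "Poly_Mapping.keys x \<union> Poly_Mapping.keys y"
  have "Poly_Mapping.keys (x + y) \<subseteq> ?A"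
    by (rule Poly_Mapping.keys_add)
  then show ?thesis
    using odot_eq_sum[of "Poly_Mapping.keys z" z ?A]
    by (simp add: lookup_add distrib_left pm.scale_left_distrib sum.distrib)
qed

lemma keys_pm_scale: "Poly_Mapping.keys (pm_scale a x) \<subseteq> Poly_Mapping.keys x"
  by (auto simp: in_keys_iff lookup_pm_scale)

lemma odot_scale_left: "odot (pm_scale a x) y = pm_scale a (odot x y)"
  using odot_eq_sum[of "Poly_Mapping.keys x" _ "Poly_Mapping.keys y" y] keys_pm_scale[of a x]
  by (simp add: lookup_pm_scale pm.scale_sum_right mult.assoc)

lemma odot_scale_right: "odot x (pm_scale a y) = pm_scale a (odot x y)"
  using odot_eq_sum[of "Poly_Mapping.keys x" x "Poly_Mapping.keys y"] keys_pm_scale[of a y]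
  by (simp add: lookup_pm_scale pm.scale_sum_right mult_ac)

lemma odot_zero: "odot 0 y = 0" "odot x 0 = 0"
  by (simp_all add: odot_def)

lemma odot_sum_left: "odot (\<Sum>a \<in> A. f a) y = (\<Sum>a \<in> A. odot (f a) y)"
  by (induction A rule: infinite_finite_induct) (simp_all add: odot_zero odot_add_left)

lemma odot_sum_right: "odot x (\<Sum>a \<in> A. f a) = (\<Sum>a \<in> A. odot x (f a))"
  by (induction A rule: infinite_finite_induct) (simp_all add: odot_zero odot_add_right)

lemma some_iso_class:
  assumes "wf_pair P"
  shows "pair_iso P (SOME Q. Q \<in> iso_class P)"
proof -
  have "\<exists>Q. Q \<in> iso_class P"
    using ex_pair_iso_nat[OF assms] by (simp add: iso_class_def)
  then show ?thesis
    by (metis (mono_tags, lifting) iso_class_def mem_Collect_eq someI_ex)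
qed

lemma odot_pair_vec:
  fixes T :: "'t qft"
  assumes "valid_pair T P1" "valid_pair T P2"
  shows "odot (pair_vec P1) (pair_vec P2) = (odot_pairs P1 P2 :: ('t, 'k::field) pvec)"
proof -
  have "odot (pair_vec P1) (pair_vec P2) = (odot_pairs
      (SOME Q. Q \<in> iso_class P1) (SOME Q. Q \<in> iso_class P2) :: ('t, 'k) pvec)"
    by (simp add: odot_def pair_vec_def)
  also have "\<dots> = odot_pairs P1 P2"
    using odot_pairs_cong[OF assms] some_iso_class valid_pair_wf assms by metis
  finally show ?thesis .
qed

lemma pair_vec_in_F_space:
  fixes T :: "'t qft"
  assumes "valid_pair T P"
  shows "(pair_vec P :: ('t, 'k::field) pvec) \<in> F_space T"
proof -
  obtain Q :: "(nat, nat, 't) gpair" where Q: "pair_iso P Q"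
    using ex_pair_iso_nat[OF valid_pair_wf[OF assms]] by blast
  have eq: "(pair_vec P :: ('t, 'k) pvec) = pair_vec Q"
    using iso_class_eq[OF valid_pair_wf[OF assms] Q] by (simp add: pair_vec_def)
  then show ?thesis
    unfolding F_space_def eq using valid_pair_iso[OF assms Q] by (intro pm.span_base) blast
qed

lemma odot_pairs_in_F_space:
  fixes T :: "'t qft"
  assumes "valid_pair T P1" "valid_pair T P2"
  shows "(odot_pairs P1 P2 :: ('t, 'k::field) pvec) \<in> F_space T"
proof -
  have "(pair_vec (pair_insert P1 v \<phi> P2) :: ('t, 'k) pvec) \<in> F_space T"
    if "v \<in> sites P1 P2" "\<phi> \<in> pair_gluings P1 P2 v" for v \<phi>
    using valid_pair_insert[OF assms that] by (rule pair_vec_in_F_space)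
  then show ?thesis
    unfolding odot_pairs_eq F_space_def by (intro pm.span_sum)
qed

text \<open>
  The terms of \<open>P1 \<odot> (P2 \<odot> P3)\<close> in which the first two pairs are inserted at different
  vertices of the third one.
\<close>

definition separate_insertions ::
  "('v, 'h, 't) gpair \<Rightarrow> ('w, 'l, 't) gpair \<Rightarrow> ('x, 'm, 't) gpair \<Rightarrow> ('t, 'k::field) pvec" where
  "separate_insertions P1 P2 P3 =
     (\<Sum>v \<in> sites P2 P3. \<Sum>\<psi> \<in> pair_gluings P2 P3 v. \<Sum>u \<in> sites P1 P3 - {v}.
        \<Sum>\<phi> \<in> pair_gluings P1 (pair_insert P2 v \<psi> P3) (Inr u).
          pair_vec (pair_insert P1 (Inr u) \<phi> (pair_insert P2 v \<psi> P3)))"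

lemma separate_insertions_commute:
  fixes T :: "'t qft"
  assumes val: "valid_pair T P1" "valid_pair T P2" "valid_pair T P3"
  shows "separate_insertions P1 P2 P3 = (separate_insertions P2 P1 P3 :: ('t, 'k::field) pvec)"
proof -
  let ?L = "\<lambda>v \<psi> u. \<Sum>\<phi> \<in> pair_gluings P1 (pair_insert P2 v \<psi> P3) (Inr u).
      pair_vec (pair_insert P1 (Inr u) \<phi> (pair_insert P2 v \<psi> P3)) :: ('t, 'k) pvec"
  let ?R = "\<lambda>u \<phi> v. \<Sum>\<psi> \<in> pair_gluings P2 (pair_insert P1 u \<phi> P3) (Inr v).
      pair_vec (pair_insert P2 (Inr v) \<psi> (pair_insert P1 u \<phi> P3)) :: ('t, 'k) pvec"
  have fin: "finite (sites P1 P3)" "finite (sites P2 P3)"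
    by (rule finite_sites[OF val(3)])+
  have "separate_insertions P1 P2 P3 =
      (\<Sum>v \<in> sites P2 P3. \<Sum>u \<in> sites P1 P3 - {v}. \<Sum>\<psi> \<in> pair_gluings P2 P3 v. ?L v \<psi> u)"
    unfolding separate_insertions_def by (intro sum.cong sum.swap refl)
  also have "\<dots> = (\<Sum>v \<in> sites P2 P3. \<Sum>u \<in> sites P1 P3 - {v}. \<Sum>\<phi> \<in> pair_gluings P1 P3 u. ?R u \<phi> v)"
    using sum_insert_exchange[OF val] by (intro sum.cong refl) auto
  \<comment> \<open>The condition \<open>u \<noteq> v\<close> moves into the summand, so that the outer sums can be interchanged.\<close>
  also have "\<dots> = (\<Sum>v \<in> sites P2 P3. \<Sum>u \<in> sites P1 P3.
      if u = v then 0 else \<Sum>\<phi> \<in> pair_gluings P1 P3 u. ?R u \<phi> v)"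
    using fin by (intro sum.cong refl sum.mono_neutral_cong_left) auto
  also have "\<dots> = (\<Sum>u \<in> sites P1 P3. \<Sum>v \<in> sites P2 P3.
      if u = v then 0 else \<Sum>\<phi> \<in> pair_gluings P1 P3 u. ?R u \<phi> v)"
    by (rule sum.swap)
  also have "\<dots> = (\<Sum>u \<in> sites P1 P3. \<Sum>v \<in> sites P2 P3 - {u}. \<Sum>\<phi> \<in> pair_gluings P1 P3 u. ?R u \<phi> v)"
    using fin by (intro sum.cong refl sum.mono_neutral_cong_right) auto
  also have "\<dots> = separate_insertions P2 P1 P3"
    unfolding separate_insertions_def by (intro sum.cong sum.swap refl)
  finally show ?thesis .
qed

text \<open>
  By \<open>sites_insert_right\<close> the inner sum splits according to whether the vertex belongs to \<open>P2\<close> or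
  to \<open>P3\<close>.  The former part is the other bracketing.
\<close>

lemma associator_pair_vec:
  fixes T :: "'t qft"
  assumes val: "valid_pair T P1" "valid_pair T P2" "valid_pair T P3"
  shows "odot (pair_vec P1) (odot (pair_vec P2) (pair_vec P3)) =
    odot (odot (pair_vec P1) (pair_vec P2)) (pair_vec P3) +
    (separate_insertions P1 P2 P3 :: ('t, 'k::field) pvec)"
proof -
  let ?t = "\<lambda>x v \<psi>. \<Sum>\<phi> \<in> pair_gluings P1 (pair_insert P2 v \<psi> P3) x.
      pair_vec (pair_insert P1 x \<phi> (pair_insert P2 v \<psi> P3)) :: ('t, 'k) pvec"
  have fin: "finite (sites P1 P2)" "finite (sites P1 P3)"
    by (rule finite_sites[OF val(2)]) (rule finite_sites[OF val(3)])
  have R: "odot (pair_vec P1) (pair_vec (pair_insert P2 v \<psi> P3)) =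
      (\<Sum>w \<in> sites P1 P2. ?t (Inl w) v \<psi>) + (\<Sum>u \<in> sites P1 P3 - {v}. ?t (Inr u) v \<psi>)"
    if v: "v \<in> sites P2 P3" and \<psi>: "\<psi> \<in> pair_gluings P2 P3 v" for v \<psi>
  proof -
    have "odot (pair_vec P1) (pair_vec (pair_insert P2 v \<psi> P3)) =
        (\<Sum>x \<in> Inl ` sites P1 P2 \<union> Inr ` (sites P1 P3 - {v}). ?t x v \<psi>)"
      unfolding odot_pair_vec[OF val(1) valid_pair_insert[OF val(2,3) v \<psi>]]
      by (simp only: odot_pairs_eq sites_insert_right[OF val(2,3) v \<psi>])
    also have "\<dots> = (\<Sum>x \<in> Inl ` sites P1 P2. ?t x v \<psi>) + (\<Sum>x \<in> Inr ` (sites P1 P3 - {v}). ?t x v \<psi>)"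
      using fin by (intro sum.union_disjoint) auto
    finally show ?thesis
      by (simp add: sum.reindex)
  qed
  have "odot (pair_vec P1) (odot (pair_vec P2) (pair_vec P3)) =
      (\<Sum>v \<in> sites P2 P3. \<Sum>\<psi> \<in> pair_gluings P2 P3 v. odot (pair_vec P1) (pair_vec (pair_insert P2 v \<psi> P3)))"
    by (simp only: odot_pair_vec[OF val(2,3)] odot_pairs_eq[of P2 P3] odot_sum_right)
  also have "\<dots> = (\<Sum>v \<in> sites P2 P3. \<Sum>\<psi> \<in> pair_gluings P2 P3 v.
      (\<Sum>w \<in> sites P1 P2. ?t (Inl w) v \<psi>) + (\<Sum>u \<in> sites P1 P3 - {v}. ?t (Inr u) v \<psi>))"
    using R by (intro sum.cong refl)
  also have "\<dots> = (\<Sum>v \<in> sites P2 P3. \<Sum>\<psi> \<in> pair_gluings P2 P3 v. \<Sum>w \<in> sites P1 P2. ?t (Inl w) v \<psi>) +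
      separate_insertions P1 P2 P3"
    by (simp only: sum.distrib separate_insertions_def)
  also have "(\<Sum>v \<in> sites P2 P3. \<Sum>\<psi> \<in> pair_gluings P2 P3 v. \<Sum>w \<in> sites P1 P2. ?t (Inl w) v \<psi>) =
      (\<Sum>v \<in> sites P2 P3. \<Sum>w \<in> sites P1 P2. \<Sum>\<psi> \<in> pair_gluings P2 P3 v. ?t (Inl w) v \<psi>)"
    by (intro sum.cong sum.swap refl)
  also have "\<dots> = (\<Sum>w \<in> sites P1 P2. \<Sum>v \<in> sites P2 P3. \<Sum>\<psi> \<in> pair_gluings P2 P3 v. ?t (Inl w) v \<psi>)"
    by (rule sum.swap)
  also have "\<dots> = (\<Sum>w \<in> sites P1 P2. \<Sum>v \<in> sites P2 P3. \<Sum>\<phi> \<in> pair_gluings P1 P2 w.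
      \<Sum>\<psi> \<in> pair_gluings (pair_insert P1 w \<phi> P2) P3 v.
        pair_vec (pair_insert (pair_insert P1 w \<phi> P2) v \<psi> P3))"
    by (intro sum.cong refl sum_insert_assoc[OF val, symmetric])
  also have "\<dots> = (\<Sum>w \<in> sites P1 P2. \<Sum>\<phi> \<in> pair_gluings P1 P2 w. \<Sum>v \<in> sites P2 P3.
      \<Sum>\<psi> \<in> pair_gluings (pair_insert P1 w \<phi> P2) P3 v.
        pair_vec (pair_insert (pair_insert P1 w \<phi> P2) v \<psi> P3))"
    by (intro sum.cong sum.swap refl)
  also have "\<dots> = (\<Sum>w \<in> sites P1 P2. \<Sum>\<phi> \<in> pair_gluings P1 P2 w.
      odot (pair_vec (pair_insert P1 w \<phi> P2)) (pair_vec P3))"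
  proof (intro sum.cong refl)
    fix w \<phi> assume w: "w \<in> sites P1 P2" and \<phi>: "\<phi> \<in> pair_gluings P1 P2 w"
    show "(\<Sum>v \<in> sites P2 P3. \<Sum>\<psi> \<in> pair_gluings (pair_insert P1 w \<phi> P2) P3 v.
          pair_vec (pair_insert (pair_insert P1 w \<phi> P2) v \<psi> P3)) =
        (odot (pair_vec (pair_insert P1 w \<phi> P2)) (pair_vec P3) :: ('t, 'k) pvec)"
      unfolding odot_pair_vec[OF valid_pair_insert[OF val(1,2) w \<phi>] val(3)]
      by (simp only: odot_pairs_eq sites_insert_left[OF val(1,2) w \<phi>])
  qed
  also have "\<dots> = odot (odot (pair_vec P1) (pair_vec P2)) (pair_vec P3)"
    by (simp only: odot_pair_vec[OF val(1,2)] odot_pairs_eq[of P1 P2] odot_sum_left)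
  finally show ?thesis .
qed

lemma pre_Lie_pair_vec:
  fixes T :: "'t qft"
  assumes val: "valid_pair T P1" "valid_pair T P2" "valid_pair T P3"
  defines "x \<equiv> pair_vec P1 :: ('t, 'k::field) pvec" and "y \<equiv> pair_vec P2" and "z \<equiv> pair_vec P3"
  shows "odot (odot x y) z - odot x (odot y z) = odot (odot y x) z - odot y (odot x z)"
  unfolding x_def y_def z_def associator_pair_vec[OF val] associator_pair_vec[OF val(2,1,3)]
  by (simp add: separate_insertions_commute[OF val])

text \<open>
  The difference of both sides of the pre-Lie identity is linear in each argument, so that it
  vanishes on the span once it does on generators.
\<close>

definition pre_Lie_defect :: "('t, 'k::field) pvec \<Rightarrow> ('t, 'k) pvec \<Rightarrow> ('t, 'k) pvec \<Rightarrow> ('t, 'k) pvec"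
  where "pre_Lie_defect x y z =
    odot (odot x y) z - odot x (odot y z) - (odot (odot y x) z - odot y (odot x z))"

lemma pre_Lie_defect_linear:
  "pm.subspace {x. pre_Lie_defect x y z = 0}"
  "pm.subspace {y. pre_Lie_defect x y z = 0}"
  "pm.subspace {z. pre_Lie_defect x y z = 0}"
  by (rule pm.subspaceI; simp add: pre_Lie_defect_def odot_zero odot_add_left odot_add_right
      odot_scale_left odot_scale_right algebra_simps flip: pm.scale_right_diff_distrib
      pm.scale_right_distrib; simp add: algebra_simps)+

lemma pre_Lie_defect_zero:
  fixes T :: "'t qft"
  assumes "x \<in> F_space T" "y \<in> F_space T" "z \<in> F_space T"
  shows "pre_Lie_defect x y (z :: ('t, 'k::field) pvec) = 0"
proof -
  let ?B = "{pair_vec P | P :: (nat, nat, 't) gpair. valid_pair T P} :: ('t, 'k) pvec set"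
  have span: "x \<in> pm.span ?B" "y \<in> pm.span ?B" "z \<in> pm.span ?B"
    using assms by (simp_all add: F_space_def)
  have 1: "pre_Lie_defect x y z = 0" if xyz: "x \<in> ?B" "y \<in> ?B" "z \<in> ?B" for x y z
  proof -
    obtain P Q R :: "(nat, nat, 't) gpair" where "x = pair_vec P" "y = pair_vec Q" "z = pair_vec R"
      and PQR: "valid_pair T P" "valid_pair T Q" "valid_pair T R"
      using xyz by blast
    then show ?thesis
      using pre_Lie_pair_vec[OF PQR] by (simp only: pre_Lie_defect_def right_minus_eq)
  qed
  have 2: "pre_Lie_defect x y z = 0" if "x \<in> ?B" "y \<in> ?B" "z \<in> pm.span ?B" for x y z
    using that(3) pre_Lie_defect_linear(3) by (rule pm.span_induct) (rule 1[OF that(1,2)])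
  have 3: "pre_Lie_defect x y z = 0" if "x \<in> ?B" "y \<in> pm.span ?B" "z \<in> pm.span ?B" for x y z
    using that(2) pre_Lie_defect_linear(2) by (rule pm.span_induct) (rule 2[OF that(1) _ that(3)])
  show ?thesis
    using span(1) pre_Lie_defect_linear(1) by (rule pm.span_induct) (rule 3[OF _ span(2,3)])
qed

lemma odot_in_F_space:
  fixes T :: "'t qft"
  assumes "x \<in> F_space T" "y \<in> F_space T"
  shows "odot x y \<in> (F_space T :: ('t, 'k::field) pvec set)"
proof -
  let ?B = "{pair_vec P | P :: (nat, nat, 't) gpair. valid_pair T P} :: ('t, 'k) pvec set"
  have span: "x \<in> pm.span ?B" "y \<in> pm.span ?B"
    using assms by (simp_all add: F_space_def)
  have F: "pm.subspace (F_space T :: ('t, 'k) pvec set)"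
    unfolding F_space_def by (rule pm.subspace_span)
  have 1: "odot x y \<in> F_space T" if xy: "x \<in> ?B" "y \<in> ?B" for x y
  proof -
    obtain P Q :: "(nat, nat, 't) gpair" where "x = pair_vec P" "y = pair_vec Q"
      and PQ: "valid_pair T P" "valid_pair T Q"
      using xy by blast
    then show ?thesis
      using odot_pairs_in_F_space[OF PQ] by (simp only: odot_pair_vec[OF PQ])
  qed
  have sub: "pm.subspace {y. odot x y \<in> F_space T}" "pm.subspace {x. odot x y \<in> F_space T}"
    for x y :: "('t, 'k) pvec"
    using F by (auto simp: pm.subspace_def odot_zero odot_add_left odot_add_right
        odot_scale_left odot_scale_right)
  have 2: "odot x y \<in> F_space T" if "x \<in> ?B" "y \<in> pm.span ?B" for x y
    using that(2) sub(1) by (rule pm.span_induct) (rule 1[OF that(1)])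
  show ?thesis
    using span(1) sub(2) by (rule pm.span_induct) (rule 2[OF _ span(2)])
qed

theorem theorem3:
  fixes T :: "'t qft"
  assumes "is_qft T"
  shows "left_pre_Lie_algebra (pm_scale :: 'k::field \<Rightarrow> ('t, 'k) pvec \<Rightarrow> ('t, 'k) pvec)
           (F_space T) odot \<and>
         (\<forall>(P1 :: (nat, nat, 't) gpair) (P2 :: (nat, nat, 't) gpair).
            valid_pair T P1 \<longrightarrow> valid_pair T P2 \<longrightarrow>
            odot (pair_vec P1) (pair_vec P2) = (odot_pairs P1 P2 :: ('t, 'k) pvec))"
proof
  show "left_pre_Lie_algebra (pm_scale :: 'k \<Rightarrow> ('t, 'k) pvec \<Rightarrow> ('t, 'k) pvec) (F_space T) odot"
  proof
    show "pm.subspace (F_space T :: ('t, 'k) pvec set)"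
      unfolding F_space_def by (rule pm.subspace_span)
    fix x y z :: "('t, 'k) pvec" and a
    show "odot x y \<in> F_space T" if "x \<in> F_space T" "y \<in> F_space T"
      using that by (rule odot_in_F_space)
    show "odot (odot x y) z - odot x (odot y z) = odot (odot y x) z - odot y (odot x z)"
      if "x \<in> F_space T" "y \<in> F_space T" "z \<in> F_space T"
      using pre_Lie_defect_zero[OF that] by (simp add: pre_Lie_defect_def)
  qed (simp_all add: odot_add_left odot_add_right odot_scale_left odot_scale_right)
qed (use odot_pair_vec in blast)

end
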